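(* If $\mathfrak{A}$ is a unital C*-algebra such that $\mathrm{Prim}(\mathfrak{A})$ equipped with its Jacobson topology is Hausdorff, then on $\mathrm{Prim}(\mathfrak{A})$ the relative Fell topology agrees with the Jacobson topology, and $\mathrm{Prim}(\mathfrak{A})$ is a compact and thus closed subset of $\mathrm{Ideal}(\mathfrak{A})$ with the Fell topology.
   Context: $\mathrm{Ideal}(\mathfrak{A})$ is the set of norm-closed two-sided ideals of $\mathfrak{A}$, including $\{0\}$ and $\mathfrak{A}$; $\mathrm{Prim}(\mathfrak{A})\subseteq\mathrm{Ideal}(\mathfrak{A})$ is the set of kernels of non-zero irreducible *-representations of $\mathfrak{A}$. The Jacobson topology on $\mathrm{Prim}(\mathfrak{A})$ is the topology whose closed sets are the sets $\{J\in\mathrm{Prim}(\mathfrak{A}): J\supseteq I\}$, $I\in\mathrm{Ideal}(\mathfrak{A})$. For a topological space $X$, let $\mathcal{C}l(X)$ be the set of its closed subsets; the Fell topology on $\mathcal{C}l(X)$ has as basis the sets $U(K,F)=\{Y\in\mathcal{C}l(X): Y\cap K=\emptyset \text{ and } Y\cap A\neq\emptyset \text{ for all } A\in F\}$, where $K\subseteq X$ is compact and $F$ is a finite family of non-empty open subsets of $X$. The Fell topology on $\mathrm{Ideal}(\mathfrak{A})$ is the initial topology induced by the bijection $I\in\mathrm{Ideal}(\mathfrak{A})\mapsto\{J\in\mathrm{Prim}(\mathfrak{A}):J\supseteq I\}\in\mathcal{C}l(\mathrm{Prim}(\mathfrak{A}))$, where $\mathrm{Prim}(\mathfrak{A})$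 carries the Jacobson topology. *)

theory Defs
  imports "HOL-Analysis.Analysis" "HOL-Library.Function_Algebras"
begin

section \<open>C*-algebras and their closed ideals\<close>

text \<open>No unit is required, and \<open>0 = 1\<close> is not excluded: the zero algebra is a unital C*-algebra.\<close>

class cstar_algebra = real_normed_algebra + complete_space +
  fixes scaleC :: "complex \<Rightarrow> 'a \<Rightarrow> 'a"
    and star :: "'a \<Rightarrow> 'a"
  assumes scaleC_add_right: "scaleC c (x + y) = scaleC c x + scaleC c y"
    and scaleC_add_left: "scaleC (c + d) x = scaleC c x + scaleC d x"
    and scaleC_scaleC: "scaleC c (scaleC d x) = scaleC (c * d) x"
    and scaleC_of_real: "scaleC (complex_of_real r) x = scaleR r x"
    and norm_scaleC: "norm (scaleC c x) = cmod c * norm x"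
    and mult_scaleC_left: "scaleC c x * y = scaleC c (x * y)"
    and mult_scaleC_right: "x * scaleC c y = scaleC c (x * y)"
    and star_add: "star (x + y) = star x + star y"
    and star_scaleC: "star (scaleC c x) = scaleC (cnj c) (star x)"
    and star_mult: "star (x * y) = star y * star x"
    and star_star: "star (star x) = x"
    and norm_star_mult: "norm (star x * x) = (norm x)\<^sup>2"

definition closed_ideals :: "'a::cstar_algebra set set" where
  "closed_ideals =
     {I. module.subspace scaleC I \<and> closed I \<and> (\<forall>x\<in>I. \<forall>a. a * x \<in> I \<and> x * a \<in> I)}"

section \<open>Hilbert spaces and *-representations\<close>

text \<open>A Hilbert space is a linear subspace \<open>H\<close> of an ambient complex vector space,
  with an inner product \<open>ip\<close> on \<open>H\<close>, linear in the second argument, for which \<open>H\<close>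
  is complete. The ambient space carries no topology, and the values of \<open>ip\<close> outside
  \<open>H\<close> are irrelevant.\<close>

locale complex_hilbert = vector_space scale
  for scale :: "complex \<Rightarrow> 'h::ab_group_add \<Rightarrow> 'h" +
  fixes H :: "'h set" and ip :: "'h \<Rightarrow> 'h \<Rightarrow> complex"
  assumes subspace_H: "subspace H"
    and ip_cnj: "\<lbrakk>x \<in> H; y \<in> H\<rbrakk> \<Longrightarrow> ip x y = cnj (ip y x)"
    and ip_add: "\<lbrakk>x \<in> H; y \<in> H; z \<in> H\<rbrakk> \<Longrightarrow> ip x (y + z) = ip x y + ip x z"
    and ip_scale: "\<lbrakk>x \<in> H; y \<in> H\<rbrakk> \<Longrightarrow> ip x (scale c y) = c * ip x y"
    and ip_nonneg: "x \<in> H \<Longrightarrow> Re (ip x x) \<ge> 0"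
    and ip_definite: "\<lbrakk>x \<in> H; ip x x = 0\<rbrakk> \<Longrightarrow> x = 0"
    and complete_H: "\<lbrakk>\<And>n::nat. s n \<in> H;
        \<And>e::real. e > 0 \<Longrightarrow>
          \<exists>N. \<forall>m\<ge>N. \<forall>n\<ge>N. sqrt (Re (ip (s m - s n) (s m - s n))) < e\<rbrakk>
      \<Longrightarrow> \<exists>x\<in>H. (\<lambda>n. sqrt (Re (ip (s n - x) (s n - x)))) \<longlonglongrightarrow> 0"
begin

definition hnorm :: "'h \<Rightarrow> real" where
  "hnorm x = sqrt (Re (ip x x))"

definition closed_subspace :: "'h set \<Rightarrow> bool" where
  "closed_subspace M \<longleftrightarrow> subspace M \<and> M \<subseteq> H \<and>
     (\<forall>s x. (\<forall>n. s n \<in> M) \<and> x \<in> H \<and> (\<lambda>n. hnorm (s n - x)) \<longlonglongrightarrow> 0 \<longrightarrow> x \<in> M)"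

end

text \<open>Only the restrictions of the maps \<open>\<pi> a\<close> to \<open>H\<close> matter.\<close>

locale star_representation = complex_hilbert scale H ip
  for scale :: "complex \<Rightarrow> 'h::ab_group_add \<Rightarrow> 'h" and H :: "'h set"
    and ip :: "'h \<Rightarrow> 'h \<Rightarrow> complex" +
  fixes \<pi> :: "'a::cstar_algebra \<Rightarrow> 'h \<Rightarrow> 'h"
  assumes rep_in: "x \<in> H \<Longrightarrow> \<pi> a x \<in> H"
    and rep_add_vec: "\<lbrakk>x \<in> H; y \<in> H\<rbrakk> \<Longrightarrow> \<pi> a (x + y) = \<pi> a x + \<pi> a y"
    and rep_scale_vec: "x \<in> H \<Longrightarrow> \<pi> a (scale c x) = scale c (\<pi> a x)"
    and rep_bounded: "\<exists>K. \<forall>x\<in>H. hnorm (\<pi> a x) \<le> K * hnorm x"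
    and rep_add: "x \<in> H \<Longrightarrow> \<pi> (a + b) x = \<pi> a x + \<pi> b x"
    and rep_scaleC: "x \<in> H \<Longrightarrow> \<pi> (scaleC c a) x = scale c (\<pi> a x)"
    and rep_mult: "x \<in> H \<Longrightarrow> \<pi> (a * b) x = \<pi> a (\<pi> b x)"
    and rep_star: "\<lbrakk>x \<in> H; y \<in> H\<rbrakk> \<Longrightarrow> ip (\<pi> (star a) x) y = ip x (\<pi> a y)"
begin

definition kernel :: "'a set" where
  "kernel = {a. \<forall>x\<in>H. \<pi> a x = 0}"

end

locale irreducible_star_representation = star_representation scale H ip \<pi>
  for scale :: "complex \<Rightarrow> 'h::ab_group_add \<Rightarrow> 'h" and H :: "'h set"
    and ip :: "'h \<Rightarrow> 'h \<Rightarrow> complex" and \<pi> :: "'a::cstar_algebra \<Rightarrow> 'h \<Rightarrow> 'h" +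
  assumes rep_nonzero: "\<exists>a. \<exists>x\<in>H. \<pi> a x \<noteq> 0"
    and irreducible: "\<lbrakk>closed_subspace M; \<And>a x. x \<in> M \<Longrightarrow> \<pi> a x \<in> M\<rbrakk> \<Longrightarrow> M = {0} \<or> M = H"

section \<open>Primitive ideals\<close>

text \<open>HOL cannot quantify over the type of the ambient vector space, so the definition
  uses Hilbert spaces of functions \<open>'a \<Rightarrow> complex\<close> with pointwise operations and an
  arbitrary inner product. This loses nothing: lemma \<open>kernel_in_primitive_ideals\<close> below
  shows that the kernel of every non-zero irreducible *-representation, in whatever ambient
  space, is obtained.\<close>

definition fun_scale :: "complex \<Rightarrow> ('x \<Rightarrow> complex) \<Rightarrow> 'x \<Rightarrow> complex" where
  "fun_scale c f = (\<lambda>x. c * f x)"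

definition primitive_ideals :: "'a::cstar_algebra set set" where
  "primitive_ideals =
     {star_representation.kernel H \<pi> | (H :: ('a \<Rightarrow> complex) set) ip \<pi>.
        irreducible_star_representation fun_scale H ip \<pi>}"

lemma vector_space_fun_scale: "vector_space fun_scale"
  by unfold_locales (auto simp: fun_scale_def fun_eq_iff algebra_simps)

context complex_hilbert
begin

lemma H_0: "0 \<in> H" and H_add: "\<lbrakk>x \<in> H; y \<in> H\<rbrakk> \<Longrightarrow> x + y \<in> H"
  and H_scale: "x \<in> H \<Longrightarrow> scale c x \<in> H" and H_diff: "\<lbrakk>x \<in> H; y \<in> H\<rbrakk> \<Longrightarrow> x - y \<in> H"
  using subspace_H by (auto simp: subspace_0 subspace_add subspace_scale subspace_diff)

lemma ip_add_left: "\<lbrakk>x \<in> H; y \<in> H; z \<in> H\<rbrakk> \<Longrightarrow> ip (x + y) z = ip x z + ip y z"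
  by (metis H_add complex_cnj_add ip_add ip_cnj)

lemma ip_scale_left: "\<lbrakk>x \<in> H; y \<in> H\<rbrakk> \<Longrightarrow> ip (scale c x) y = cnj c * ip x y"
  by (metis H_scale complex_cnj_mult ip_cnj ip_scale)

lemma ip_0: "x \<in> H \<Longrightarrow> ip x 0 = 0"
  using ip_scale[of x 0 0] H_0 by simp

lemma ip_minus: "\<lbrakk>x \<in> H; y \<in> H\<rbrakk> \<Longrightarrow> ip x (- y) = - ip x y"
  using ip_scale[of x y "-1"] by simp

lemma ip_diff: "\<lbrakk>x \<in> H; y \<in> H; z \<in> H\<rbrakk> \<Longrightarrow> ip x (y - z) = ip x y - ip x z"
  using ip_add[of x "y - z" z] H_diff by simp

lemma ip_diff_left: "\<lbrakk>x \<in> H; y \<in> H; z \<in> H\<rbrakk> \<Longrightarrow> ip (x - y) z = ip x z - ip y z"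
  using ip_add_left[of "x - y" y z] H_diff by simp

lemma ip_self_real: "x \<in> H \<Longrightarrow> ip x x = complex_of_real (Re (ip x x))"
  using ip_cnj[of x x] by (simp add: complex_eq_iff)

lemma hnorm_sq: "x \<in> H \<Longrightarrow> (hnorm x)\<^sup>2 = Re (ip x x)"
  by (simp add: hnorm_def ip_nonneg)

lemma cauchy_schwarz:
  assumes "x \<in> H" "y \<in> H"
  shows "cmod (ip x y) \<le> hnorm x * hnorm y"
proof (cases "x = 0")
  case True
  have "ip 0 y = 0" using ip_cnj[of 0 y] ip_0[of y] assms H_0 by simp
  then show ?thesis using True ip_nonneg[OF assms(2)] ip_0[OF H_0] by (simp add: hnorm_def)
next
  case False
  define r where "r = Re (ip x x)"
  have r: "ip x x = of_real r" using ip_self_real[OF assms(1)] r_def by simp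
  have r0: "r > 0"
    using False ip_definite[OF assms(1)] ip_nonneg[OF assms(1)] r
    by (metis less_eq_real_def of_real_0 r_def)
  define z where "z = ip x y"
  define c where "c = z / of_real r"
  define w where "w = y - scale c x"
  have cx: "scale c x \<in> H" and w: "w \<in> H" using assms H_scale H_diff w_def by auto
  have yx: "ip y x = cnj z" using ip_cnj[of y x] assms z_def by simp
  have xw: "ip x w = 0"
  proof -
    have "ip x w = z - c * ip x x"
      using ip_diff[OF assms(1) assms(2) cx] ip_scale[OF assms(1) assms(1)]
      by (simp add: w_def z_def)
    then show ?thesis using r0 by (simp add: r c_def)
  qed
  have "ip w w = ip y w - cnj c * ip x w"
    using assms cx w by (subst (1) w_def) (simp add: ip_diff_left ip_scale_left)
  also have "\<dots> = ip y y - c * cnj z"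
    using assms cx by (simp add: xw) (simp add: w_def ip_diff ip_scale yx)
  also have "c * cnj z = of_real ((cmod z)\<^sup>2 / r)"
    using complex_norm_square[of z] by (simp add: c_def)
  finally have "Re (ip w w) = Re (ip y y) - (cmod z)\<^sup>2 / r" by simp
  then have "(cmod z)\<^sup>2 / r \<le> Re (ip y y)" using ip_nonneg[OF w] by simp
  then have "(cmod z)\<^sup>2 \<le> r * Re (ip y y)" using r0 by (simp add: field_simps)
  also have "\<dots> = (hnorm x * hnorm y)\<^sup>2"
    using assms by (simp add: power_mult_distrib hnorm_sq r_def)
  finally show ?thesis unfolding z_def
    by (rule power2_le_imp_le) (simp add: hnorm_def ip_nonneg assms)
qed

end

text \<open>The transport: fix \<open>v\<close> with \<open>\<pi> a v \<noteq> 0\<close> for some \<open>a\<close>, and map \<open>x\<close> to the function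
  \<open>\<lambda>b. ip (\<pi> b v) x\<close>. This is linear, and injective by irreducibility.\<close>

lemma kernel_in_primitive_ideals:
  fixes scale :: "complex \<Rightarrow> 'h::ab_group_add \<Rightarrow> 'h"
  assumes "irreducible_star_representation scale H ip \<pi>"
  shows "star_representation.kernel H \<pi> \<in> primitive_ideals"
proof -
  interpret irreducible_star_representation scale H ip \<pi> by fact
  interpret F: vector_space fun_scale by (rule vector_space_fun_scale)
  obtain a0 v where v: "v \<in> H" "\<pi> a0 v \<noteq> 0" using rep_nonzero by blast
  define M where "M = {x\<in>H. \<forall>b. ip (\<pi> b v) x = 0}"
  have "subspace M"
    by (rule subspaceI)
      (auto simp: M_def H_0 H_add H_scale ip_0 ip_add ip_scale rep_in v)
  moreover have "x \<in> M"
    if s: "\<And>n. s n \<in> M" and x: "x \<in> H" and lim: "(\<lambda>n. hnorm (s n - x)) \<longlonglongrightarrow> 0" for s :: "nat \<Rightarrow> _" and x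
  proof -
    have "ip (\<pi> b v) x = 0" for b
    proof -
      have bv: "\<pi> b v \<in> H" by (simp add: rep_in v)
      have "cmod (ip (\<pi> b v) x) \<le> hnorm (\<pi> b v) * hnorm (s n - x)" for n
      proof -
        have sn: "s n \<in> H" "ip (\<pi> b v) (s n) = 0" using s[of n] by (auto simp: M_def)
        then show ?thesis
          using cauchy_schwarz[OF bv H_diff[OF sn(1) x]] by (simp add: ip_diff bv x)
      qed
      moreover have "(\<lambda>n. hnorm (\<pi> b v) * hnorm (s n - x)) \<longlonglongrightarrow> hnorm (\<pi> b v) * 0"
        by (intro tendsto_mult tendsto_const lim)
      ultimately have "cmod (ip (\<pi> b v) x) \<le> 0"
        by (intro LIMSEQ_le_const[of "\<lambda>n. hnorm (\<pi> b v) * hnorm (s n - x)"]) auto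
      then show ?thesis by simp
    qed
    then show ?thesis using x by (simp add: M_def)
  qed
  ultimately have clM: "closed_subspace M"
    unfolding closed_subspace_def by (auto simp: M_def)
  have "\<pi> a x \<in> M" if "x \<in> M" for a x
  proof -
    have "ip (\<pi> b v) (\<pi> a x) = ip (\<pi> (star a * b) v) x" for b
      using that v by (simp add: M_def rep_star rep_in rep_mult)
    then show ?thesis using that by (simp add: M_def rep_in)
  qed
  then have "M = {0} \<or> M = H" by (intro irreducible clM)
  moreover have "M \<noteq> H"
  proof
    assume "M = H"
    then have "\<pi> a0 v \<in> M" by (simp add: rep_in v)
    then show False using v ip_definite[of "\<pi> a0 v"] by (auto simp: M_def)
  qed
  ultimately have M0: "M = {0}" by blast
  define T where "T x = (\<lambda>b. ip (\<pi> b v) x)" for x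
  have T_add: "T (x + y) = T x + T y" if "x \<in> H" "y \<in> H" for x y
    using that v by (auto simp: T_def fun_eq_iff ip_add rep_in)
  have T_diff: "T (x - y) = T x - T y" if "x \<in> H" "y \<in> H" for x y
    using that v by (auto simp: T_def fun_eq_iff ip_diff rep_in)
  have T_scale: "T (scale c x) = fun_scale c (T x)" if "x \<in> H" for c x
    using that v by (auto simp: T_def fun_eq_iff fun_scale_def ip_scale rep_in)
  have T_0: "T 0 = 0"
    using v by (auto simp: T_def fun_eq_iff ip_0 rep_in)
  have T_inj: "x = y" if "x \<in> H" "y \<in> H" "T x = T y" for x y
  proof -
    have "T (x - y) = 0" using that T_diff by simp
    then have "x - y \<in> M" using that by (auto simp: M_def T_def fun_eq_iff H_diff)
    then show ?thesis using M0 by simp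
  qed
  define S where "S = inv_into H T"
  have ST: "S (T x) = x" if "x \<in> H" for x
    unfolding S_def using that T_inj by (intro inv_into_f_f inj_onI) auto
  define H' where "H' = T ` H"
  define ip' where "ip' f g = ip (S f) (S g)" for f g
  define \<pi>' where "\<pi>' a f = T (\<pi> a (S f))" for a f
  have ip': "ip' (T x) (T y) = ip x y" if "x \<in> H" "y \<in> H" for x y
    using that by (simp add: ip'_def ST)
  have \<pi>': "\<pi>' a (T x) = T (\<pi> a x)" if "x \<in> H" for a x
    using that by (simp add: \<pi>'_def ST)
  have T_H': "T x \<in> H'" if "x \<in> H" for x using that by (simp add: H'_def)
  note simps = T_add[symmetric] T_diff[symmetric] T_scale[symmetric] ip' \<pi>' H_0 H_add H_diff H_scale rep_in
  interpret H': complex_hilbert fun_scale H' ip'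
  proof
    have "0 \<in> H'" using T_H'[OF H_0] T_0 by simp
    then show "F.subspace H'"
      by (auto simp: F.subspace_def H'_def simps)
  next
    fix s :: "nat \<Rightarrow> _"
    assume s: "\<And>n. s n \<in> H'"
      and C: "\<And>e. e > 0 \<Longrightarrow> \<exists>N. \<forall>m\<ge>N. \<forall>n\<ge>N. sqrt (Re (ip' (s m - s n) (s m - s n))) < e"
    from s have "\<forall>n. \<exists>x. x \<in> H \<and> s n = T x" by (auto simp: H'_def)
    then obtain t where t: "\<And>n. t n \<in> H" "\<And>n. s n = T (t n)" by metis
    have "\<exists>x\<in>H. (\<lambda>n. sqrt (Re (ip (t n - x) (t n - x)))) \<longlonglongrightarrow> 0"
      using C by (intro complete_H t) (simp add: t simps)
    then obtain x where "x \<in> H" "(\<lambda>n. sqrt (Re (ip (t n - x) (t n - x)))) \<longlonglongrightarrow> 0" by blast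
    then show "\<exists>x\<in>H'. (\<lambda>n. sqrt (Re (ip' (s n - x) (s n - x)))) \<longlonglongrightarrow> 0"
      by (intro bexI[of _ "T x"]) (simp_all add: t simps T_H')
  next
    fix f
    assume "f \<in> H'" "ip' f f = 0"
    then show "f = 0" unfolding H'_def using ip_definite T_0 ip' by (metis imageE)
  qed (auto simp: H'_def simps ip_add ip_scale ip_nonneg intro: ip_cnj)
  have hn: "H'.hnorm (T x) = hnorm x" if "x \<in> H" for x
    using that by (simp add: H'.hnorm_def hnorm_def ip')
  interpret R': star_representation fun_scale H' ip' \<pi>'
  proof
    fix a
    obtain K where "\<forall>x\<in>H. hnorm (\<pi> a x) \<le> K * hnorm x" using rep_bounded by blast
    then have "\<forall>f\<in>H'. H'.hnorm (\<pi>' a f) \<le> K * H'.hnorm f" by (auto simp: H'_def hn simps)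
    then show "\<exists>K. \<forall>f\<in>H'. H'.hnorm (\<pi>' a f) \<le> K * H'.hnorm f" by blast
  qed (auto simp: H'_def simps rep_add_vec rep_scale_vec rep_add rep_scaleC rep_mult rep_star)
  have "irreducible_star_representation fun_scale H' ip' \<pi>'"
  proof
    have "T (\<pi> a0 v) \<noteq> 0" using v T_inj[of "\<pi> a0 v" 0] T_0 by (auto simp: simps)
    then show "\<exists>a. \<exists>x\<in>H'. \<pi>' a x \<noteq> 0" using v T_H'[of v] \<pi>'[of v] by metis
  next
    fix N
    assume N: "H'.closed_subspace N" and inv: "\<And>a x. x \<in> N \<Longrightarrow> \<pi>' a x \<in> N"
    define L where "L = {x\<in>H. T x \<in> N}"
    have sN: "F.subspace N" and NH: "N \<subseteq> H'" using N by (auto simp: H'.closed_subspace_def)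
    have NL: "N = T ` L" using NH by (auto simp: L_def H'_def)
    have "subspace L"
      by (rule subspaceI)
        (auto simp: L_def H_0 H_add H_scale T_0 T_add T_scale
          F.subspace_0[OF sN] F.subspace_add[OF sN] F.subspace_scale[OF sN])
    moreover have "x \<in> L"
      if s: "\<And>n. s n \<in> L" and x: "x \<in> H" and lim: "(\<lambda>n. hnorm (s n - x)) \<longlonglongrightarrow> 0" for s :: "nat \<Rightarrow> _" and x
    proof -
      have sH: "s n \<in> H" and sNn: "T (s n) \<in> N" for n using s[of n] by (auto simp: L_def)
      have "(\<lambda>n. H'.hnorm (T (s n) - T x)) \<longlonglongrightarrow> 0"
        using lim by (simp add: simps sH x hn)
      then have "T x \<in> N"
        using N sNn T_H'[OF x] unfolding H'.closed_subspace_def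
        by (elim conjE) (erule allE[of _ "\<lambda>n. T (s n)"], erule allE[of _ "T x"], simp)
      then show ?thesis using x by (simp add: L_def)
    qed
    ultimately have "closed_subspace L" unfolding closed_subspace_def by (auto simp: L_def)
    moreover have "\<pi> a x \<in> L" if "x \<in> L" for a x
      using that inv[of "T x" a] by (auto simp: L_def simps)
    ultimately have "L = {0} \<or> L = H" by (rule irreducible)
    then show "N = {0} \<or> N = H'" by (auto simp: NL H'_def T_0)
  qed
  moreover have "star_representation.kernel H \<pi> = star_representation.kernel H' \<pi>'"
  proof -
    have "T (\<pi> a x) = 0 \<longleftrightarrow> \<pi> a x = 0" if "x \<in> H" for a x
      using that T_inj[of "\<pi> a x" 0] T_0 by (auto simp: simps)
    then show ?thesis unfolding kernel_def R'.kernel_def by (auto simp: H'_def simps)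
  qed
  ultimately show ?thesis unfolding primitive_ideals_def by blast
qed

section \<open>The Jacobson and Fell topologies\<close>

definition ideal_hull :: "'a::cstar_algebra set \<Rightarrow> 'a set set" where
  "ideal_hull I = {J \<in> primitive_ideals. I \<subseteq> J}"

definition jacobson_topology :: "'a::cstar_algebra set topology" where
  "jacobson_topology = topology (\<lambda>U. \<exists>I\<in>closed_ideals. U = primitive_ideals - ideal_hull I)"

definition fell_basic :: "'b topology \<Rightarrow> 'b set \<Rightarrow> 'b set set \<Rightarrow> 'b set set" where
  "fell_basic X K F = {Y. closedin X Y \<and> Y \<inter> K = {} \<and> (\<forall>A\<in>F. Y \<inter> A \<noteq> {})}"

text \<open>The sets \<open>fell_basic X K F\<close> are closed under finite intersections and include the set
  \<open>fell_basic X {} {}\<close> of all closed subsets, so they form a basis of the topology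
  they generate.\<close>

definition fell_topology :: "'b topology \<Rightarrow> 'b set topology" where
  "fell_topology X = topology_generated_by
     {fell_basic X K F | K F. compactin X K \<and> finite F \<and> (\<forall>A\<in>F. openin X A \<and> A \<noteq> {})}"

definition fell_ideal_topology :: "'a::cstar_algebra set topology" where
  "fell_ideal_topology = pullback_topology closed_ideals ideal_hull (fell_topology jacobson_topology)"

end

theory Submission
  imports Defs
begin

text \<open>The topological part is short. If the space of primitive ideals is Hausdorff, then every primitive
ideal \<open>P\<close> is its own hull, so the Fell topology on primitive ideals is the topology pulled back along
\<open>P \<mapsto> {P}\<close>. For a Hausdorff space this map into the closed sets is a homeomorphism onto its image:
it is continuous because compact sets are closed, and an open set \<open>U\<close> is the preimage of the closed sets
that meet \<open>U\<close>. Compactness of the set of primitive ideals is therefore compactness in the Jacobson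
topology. For closedness, a closed ideal that is not primitive has a hull that is empty or has two points;
a hull with two points is kept away from singletons by two disjoint open sets, and the empty hull by the
condition of missing the compact set of all primitive ideals.

Two facts on C*-algebras make this work. A closed ideal is the intersection of the primitive ideals that
contain it (otherwise a non-primitive ideal might have a singleton hull), and the space of primitive
ideals of a unital algebra is compact. Compactness follows from the first fact: if no
primitive ideal contains all the ideals of a family, then the closure of their sum contains the unit,
hence the sum itself does, since elements near the unit are invertible; and the unit then lies in
the sum of finitely many of them. That the Jacobson topology is a topology at all rests on
primitive ideals being closed and prime.

The first fact is \<open>closed_ideal_separated_by_primitive\<close>. Given \<open>a\<close> outside the closed ideal \<open>I\<close>, one looks
for an irreducible representation that vanishes on \<open>I\<close> but not at \<open>a\<close>. It is the GNS representation of a pure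
state, that is, of an extreme point of the compact convex set of states that vanish on \<open>I\<close>, chosen so that
the value at \<open>a\<^sup>* a\<close> is as large as possible. That this largest value is positive is a separation
argument: otherwise \<open>\<delta> - a\<^sup>* a\<close> would be the sum of a positive and a self-adjoint element of \<open>I\<close> for every
\<open>\<delta> > 0\<close>, and then \<open>a \<in> I\<close>.

All this depends on the order of the algebra. Positivity is introduced without spectra:
a self-adjoint \<open>a\<close> is positive if \<open>\<parallel>t - a\<parallel> \<le> t\<close> for some \<open>t \<ge> 0\<close>, which visibly defines a convex cone.
Square roots come from an iteration, and they suffice for the theorem that \<open>x\<^sup>* x\<close> is always
positive (\<open>star_mult_positive\<close>). Hilbert spaces enter through the completion of the algebra for the
semi-inner product of a state; it is realised as a space of functions on the algebra, on which the
representation acts by translation of the argument.\<close>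

section \<open>The involution and complex scalars\<close>

lemma star_0: "star (0::'a::cstar_algebra) = 0"
  by (metis add.right_neutral add_left_cancel star_add)

lemma star_minus: "star (- x) = - star (x::'a::cstar_algebra)"
  by (metis star_0 star_add add_eq_0_iff)

lemma star_diff: "star (x - y) = star x - star (y::'a::cstar_algebra)"
  by (metis diff_conv_add_uminus star_add star_minus)

lemma star_scaleR: "star (r *\<^sub>R x) = r *\<^sub>R star (x::'a::cstar_algebra)"
  by (metis complex_cnj_complex_of_real scaleC_of_real star_scaleC)

lemmas star_simps = star_0 star_minus star_diff star_scaleR star_add star_mult star_star star_scaleC

lemma norm_star: "norm (star x) = norm (x::'a::cstar_algebra)"
proof -
  have *: "norm y \<le> norm (star y)" for y :: 'a
  proof (cases "norm y = 0")
    case False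
    have "(norm y)\<^sup>2 \<le> norm (star y) * norm y"
      by (metis norm_star_mult norm_mult_ineq)
    then show ?thesis using False by (simp add: power2_eq_square)
  qed simp
  show ?thesis using *[of x] *[of "star x"] by (simp add: star_star)
qed

lemma norm_square_selfadjoint:
  "star h = h \<Longrightarrow> norm (h * h) = (norm (h::'a::cstar_algebra))\<^sup>2"
  by (metis norm_star_mult)

lemma tendsto_star:
  assumes "s \<longlonglongrightarrow> (x::'a::cstar_algebra)"
  shows "(\<lambda>n. star (s n)) \<longlonglongrightarrow> star x"
proof -
  have "(\<lambda>n. norm (s n - x)) \<longlonglongrightarrow> 0" using assms by (simp add: LIM_zero_iff tendsto_norm_zero_iff)
  then have "(\<lambda>n. norm (star (s n) - star x)) \<longlonglongrightarrow> 0" by (simp add: star_diff[symmetric] norm_star)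
  then show ?thesis by (simp add: LIM_zero_iff tendsto_norm_zero_iff)
qed

lemma scaleC_minus_one: "scaleC (-1) x = - (x::'a::cstar_algebra)"
  by (metis of_real_1 of_real_minus scaleC_of_real scaleR_minus1_left)

lemma scaleC_1: "scaleC 1 x = (x::'a::cstar_algebra)"
  by (metis of_real_1 scaleC_of_real scaleR_one)

lemma module_scaleC: "module (scaleC :: complex \<Rightarrow> 'a::cstar_algebra \<Rightarrow> 'a)"
  by unfold_locales (simp_all add: scaleC_add_left scaleC_add_right scaleC_scaleC scaleC_1)

lemma scaleC_minus_right: "scaleC c (- x) = - scaleC c (x::'a::cstar_algebra)"
  by (metis scaleC_minus_one scaleC_scaleC mult.commute)

lemma scaleC_diff_right: "scaleC c (x - y) = scaleC c x - scaleC c (y::'a::cstar_algebra)"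
  by (simp only: diff_conv_add_uminus scaleC_add_right scaleC_minus_right)

lemma scaleC_minus_left: "scaleC (- c) x = - scaleC c (x::'a::cstar_algebra)"
  by (metis scaleC_minus_one scaleC_scaleC mult_minus1)

lemma scaleC_scaleR: "scaleC c (r *\<^sub>R x) = r *\<^sub>R scaleC c (x::'a::cstar_algebra)"
  by (metis scaleC_of_real scaleC_scaleC mult.commute)

lemma tendsto_scaleC:
  assumes "s \<longlonglongrightarrow> (x::'a::cstar_algebra)"
  shows "(\<lambda>n. scaleC c (s n)) \<longlonglongrightarrow> scaleC c x"
proof -
  have "(\<lambda>n. norm (s n - x)) \<longlonglongrightarrow> 0" using assms by (simp add: LIM_zero_iff tendsto_norm_zero_iff)
  from tendsto_mult_left[OF this, of "cmod c"]
  have "(\<lambda>n. norm (scaleC c (s n) - scaleC c x)) \<longlonglongrightarrow> 0" by (simp add: scaleC_diff_right[symmetric] norm_scaleC)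
  then show ?thesis by (simp add: LIM_zero_iff tendsto_norm_zero_iff)
qed

section \<open>The positive cone of a unital C*-algebra\<close>

lemma commute_mult:
  fixes a b c :: "'a::semigroup_mult"
  assumes "a * b = b * a" "a * c = c * a"
  shows "a * (b * c) = (b * c) * a"
proof -
  have "a * (b * c) = b * (a * c)" by (simp only: mult.assoc[symmetric] assms(1))
  then show ?thesis by (simp only: mult.assoc assms(2))
qed

text \<open>The unit is a parameter of the locale, since the class does not carry one. In the zero algebra it is \<open>0\<close>,
so that \<open>norm e \<le> 1\<close> is the general statement about its norm.\<close>

locale unital_cstar =
  fixes e :: "'a::cstar_algebra"
  assumes e_left [simp]: "e * x = x" and e_right [simp]: "x * e = x"
begin

lemma star_e [simp]: "star e = e"
  by (metis e_left e_right star_mult star_star)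

lemma norm_e_le: "norm e \<le> 1"
proof -
  have "(norm e)\<^sup>2 = norm e" using norm_star_mult[of e] by simp
  then have "norm e * (norm e - 1) = 0" by (simp add: power2_eq_square algebra_simps)
  then show ?thesis by auto
qed

lemma norm_scaleR_e: "norm (t *\<^sub>R e) \<le> \<bar>t\<bar>"
  using norm_e_le by (simp add: mult_left_le)

text \<open>The element \<open>w = 1 - sqrt (1 - h)\<close> solves \<open>w = (h + w\<^sup>2) / 2\<close> and is found by iterating this equation from \<open>0\<close>.
The iterates are dominated by those of the scalar equation with \<open>h = 1\<close>, which increase and stay below \<open>1\<close>;
hence the iteration converges even in the boundary case \<open>norm h = 1\<close>, where it is not a contraction.
Being a limit of polynomials in \<open>h\<close>, the solution commutes with all that commutes with \<open>h\<close>.\<close>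

lemma sqrt_one_minus:
  assumes h: "star h = h" "norm h \<le> 1"
  obtains w where "star w = w" "norm w \<le> 1" "(e - w) * (e - w) = e - h"
    "\<And>x. x * h = h * x \<Longrightarrow> x * w = w * x"
proof -
  define W where "W w = (1/2) *\<^sub>R (h + w * w)" for w
  define V :: "real \<Rightarrow> real" where "V v = (1 + v * v) / 2" for v
  define w where "w n = (W ^^ n) 0" for n
  define v where "v n = (V ^^ n) 0" for n
  have w0: "w 0 = 0" and ws: "w (Suc n) = (1/2) *\<^sub>R (h + w n * w n)" for n
    by (simp_all add: w_def W_def)
  have v0: "v 0 = 0" and vs: "v (Suc n) = (1 + v n * v n) / 2" for n
    by (simp_all add: v_def V_def)
  have vb: "0 \<le> v n \<and> v n \<le> 1" for n
  proof (induction n)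
    case (Suc n)
    then have "v n * v n \<le> 1" by (simp add: mult_le_one)
    then show ?case using Suc by (simp add: vs)
  qed (simp add: v0)
  have wv: "norm (w n) \<le> v n" for n
  proof (induction n)
    case (Suc n)
    have "norm (w n * w n) \<le> v n * v n"
      by (rule order_trans[OF norm_mult_ineq]) (simp add: mult_mono Suc vb)
    then have "norm (h + w n * w n) \<le> 1 + v n * v n"
      using h(2) norm_triangle_ineq[of h "w n * w n"] by linarith
    then show ?case by (simp add: ws vs)
  qed (simp add: w0 v0)
  have step: "norm (w (Suc n) - w n) \<le> v (Suc n) - v n" for n
  proof (induction n)
    case 0
    then show ?case using h(2) by (simp add: ws vs w0 v0)
  next
    case (Suc n)
    let ?d = "w (Suc n) - w n" and ?s = "v (Suc n) - v n"
    have "w (Suc (Suc n)) - w (Suc n) = (1/2) *\<^sub>R (w (Suc n) * ?d + ?d * w n)"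
      unfolding ws[of "Suc n"] by (subst (3) ws) (simp add: algebra_simps)
    moreover have "norm (w (Suc n) * ?d) \<le> v (Suc n) * ?s"
      by (rule order_trans[OF norm_mult_ineq]) (intro mult_mono wv Suc; simp add: vb)
    moreover have "norm (?d * w n) \<le> ?s * v n"
      by (rule order_trans[OF norm_mult_ineq]) (intro mult_mono wv Suc; use Suc norm_ge_zero order_trans in blast)
    ultimately have "norm (w (Suc (Suc n)) - w (Suc n)) \<le> (v (Suc n) * ?s + ?s * v n) / 2"
      using norm_triangle_ineq[of "w (Suc n) * ?d" "?d * w n"] by simp
    also have "\<dots> = v (Suc (Suc n)) - v (Suc n)"
      unfolding vs[of "Suc n"] by (subst (5) vs) (simp add: field_simps)
    finally show ?case .
  qed
  have vmono: "incseq v"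
  proof (rule incseq_SucI)
    show "v n \<le> v (Suc n)" for n using order_trans[OF norm_ge_zero step[of n]] by simp
  qed
  have dist_wv: "norm (w (n + k) - w n) \<le> v (n + k) - v n" for n k
  proof (induction k)
    case (Suc k)
    have "norm (w (n + Suc k) - w n) \<le> norm (w (Suc (n + k)) - w (n + k)) + norm (w (n + k) - w n)"
      by (simp add: norm_triangle_ineq[of "w (Suc (n+k)) - w (n+k)" "w (n + k) - w n", simplified])
    then show ?case using step[of "n + k"] Suc by simp
  qed simp
  have "Cauchy v"
    using vmono vb by (intro convergent_Cauchy Bseq_mono_convergent BseqI'[of _ 1]) (auto simp: incseq_def)
  have "Cauchy w"
  proof (rule metric_CauchyI)
    fix r :: real assume "r > 0"
    then obtain N where N: "\<And>m n. m \<ge> N \<Longrightarrow> n \<ge> N \<Longrightarrow> dist (v m) (v n) < r"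
      using \<open>Cauchy v\<close> unfolding Cauchy_def by blast
    have "dist (w m) (w n) < r" if "n \<ge> N" "m \<ge> n" for m n
    proof -
      have "norm (w m - w n) \<le> v m - v n" using dist_wv[of n "m - n"] that by simp
      then show ?thesis using N[of m n] that by (auto simp: dist_norm)
    qed
    then have "dist (w m) (w n) < r" if "n \<ge> N" "m \<ge> N" for m n
      using that by (metis dist_commute nle_le)
    then show "\<exists>N. \<forall>m\<ge>N. \<forall>n\<ge>N. dist (w m) (w n) < r" by blast
  qed
  then obtain u where u: "w \<longlonglongrightarrow> u" using Cauchy_convergent convergent_def by blast
  have "star (w n) = w n" for n by (induction n) (simp_all add: w0 ws star_simps h)
  then have 1: "star u = u" using tendsto_star[OF u] u LIMSEQ_unique by auto
  have 2: "norm u \<le> 1"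
    by (rule LIMSEQ_le_const2[OF tendsto_norm[OF u]]) (use wv vb order_trans in blast)
  have "(\<lambda>n. w (Suc n)) \<longlonglongrightarrow> (1/2) *\<^sub>R (h + u * u)" unfolding ws by (intro tendsto_intros u)
  then have "u = (1/2) *\<^sub>R (h + u * u)" using LIMSEQ_Suc[OF u] LIMSEQ_unique by blast
  then have "u + u = h + u * u"
    by (metis field_sum_of_halves scaleR_add_left scaleR_one scaleR_scaleR mult.commute mult_1 scaleR_half_double)
  then have 3: "(e - u) * (e - u) = e - h" by (simp add: algebra_simps)
  have 4: "x * u = u * x" if x: "x * h = h * x" for x
  proof -
    have "x * w n = w n * x" for n
      by (induction n) (simp_all add: w0 ws x distrib_left distrib_right, metis mult.assoc)
    then have "(\<lambda>n. x * w n) \<longlonglongrightarrow> u * x" by (simp add: tendsto_mult_right u)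
    then show ?thesis using tendsto_mult_left[OF u, of x] LIMSEQ_unique by blast
  qed
  show ?thesis using that 1 2 3 4 by blast
qed

text \<open>In terms of spectra, \<open>\<parallel>t - a\<parallel> \<le> t\<close> says that the spectrum of the self-adjoint element \<open>a\<close> lies in \<open>[0, 2 t]\<close>.\<close>

definition positive :: "'a set" where
  "positive = {a. star a = a \<and> (\<exists>t\<ge>0. norm (t *\<^sub>R e - a) \<le> t)}"

lemma positive_star: "a \<in> positive \<Longrightarrow> star a = a"
  by (simp add: positive_def)

lemma positive_0: "0 \<in> positive"
  by (auto simp: positive_def star_0 intro!: exI[of _ 0])

lemma positive_e: "e \<in> positive"
  by (auto simp: positive_def intro!: exI[of _ 1])

lemma positive_add:
  assumes "a \<in> positive" "b \<in> positive"
  shows "a + b \<in> positive"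
proof -
  obtain t s where "t \<ge> 0" "norm (t *\<^sub>R e - a) \<le> t" "s \<ge> 0" "norm (s *\<^sub>R e - b) \<le> s"
    using assms by (auto simp: positive_def)
  moreover have "norm ((t + s) *\<^sub>R e - (a + b)) \<le> norm (t *\<^sub>R e - a) + norm (s *\<^sub>R e - b)"
    using norm_triangle_ineq[of "t *\<^sub>R e - a" "s *\<^sub>R e - b"] by (simp add: algebra_simps)
  ultimately show ?thesis using assms
    by (auto simp: positive_def star_simps intro!: exI[of _ "t + s"])
qed

lemma positive_scaleR:
  assumes "a \<in> positive" "r \<ge> 0"
  shows "r *\<^sub>R a \<in> positive"
proof -
  obtain t where "t \<ge> 0" "norm (t *\<^sub>R e - a) \<le> t" using assms by (auto simp: positive_def)
  moreover have "norm ((r * t) *\<^sub>R e - r *\<^sub>R a) = r * norm (t *\<^sub>R e - a)"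
    using assms(2) norm_scaleR[of r "t *\<^sub>R e - a"] by (simp add: scaleR_diff_right)
  ultimately show ?thesis using assms
    by (auto simp: positive_def star_simps mult_left_mono intro!: exI[of _ "r * t"])
qed

lemma positive_diff_norm:
  assumes "star h = h" "norm h \<le> t"
  shows "t *\<^sub>R e - h \<in> positive" "t *\<^sub>R e + h \<in> positive"
  using assms order_trans[OF norm_ge_zero assms(2)]
  by (auto simp: positive_def star_simps intro!: exI[of _ t])

text \<open>If \<open>\<parallel>t - a\<parallel> \<le> t\<close>, then \<open>a = t (1 - h)\<close> with \<open>\<parallel>h\<parallel> \<le> 1\<close>.\<close>

lemma positive_sqrt:
  assumes "a \<in> positive"
  obtains p where "p \<in> positive" "p * p = a" "\<And>x. x * a = a * x \<Longrightarrow> x * p = p * x"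
proof -
  obtain t where t: "t \<ge> 0" "norm (t *\<^sub>R e - a) \<le> t" and a: "star a = a"
    using assms by (auto simp: positive_def)
  show ?thesis
  proof (cases "t = 0")
    case True
    then have "a = 0" using t by simp
    then show ?thesis using that[of 0] positive_0 by simp
  next
    case False
    then have t0: "t > 0" using t by simp
    define h where "h = e - (1/t) *\<^sub>R a"
    have th: "t *\<^sub>R h = t *\<^sub>R e - a" using t0 by (simp add: h_def algebra_simps)
    have "t * norm h \<le> t" using t th t0 by (metis abs_of_pos norm_scaleR)
    then have "norm h \<le> 1" using t0 by simp
    moreover have "star h = h" by (simp add: h_def star_simps a)
    ultimately obtain w where w: "star w = w" "norm w \<le> 1" "(e - w) * (e - w) = e - h"
      "\<And>x. x * h = h * x \<Longrightarrow> x * w = w * x" using sqrt_one_minus by metis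
    show ?thesis
    proof (rule that[of "sqrt t *\<^sub>R (e - w)"])
      show "sqrt t *\<^sub>R (e - w) \<in> positive"
        using positive_diff_norm(1)[of w 1] w t by (intro positive_scaleR) auto
      have "t *\<^sub>R (e - h) = a" using t0 by (simp add: h_def)
      then show "sqrt t *\<^sub>R (e - w) * sqrt t *\<^sub>R (e - w) = a" using w(3) t by simp
      fix x assume "x * a = a * x"
      then have "x * h = h * x" by (simp add: h_def algebra_simps)
      then have "x * w = w * x" by (rule w)
      then show "x * sqrt t *\<^sub>R (e - w) = sqrt t *\<^sub>R (e - w) * x" by (simp add: algebra_simps)
    qed
  qed
qed

text \<open>The element \<open>u = h + \<i> k\<close> satisfies \<open>u\<^sup>* u = c\<close>, so its norm is at most \<open>sqrt c\<close>, and \<open>h\<close> is its real part.\<close>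

lemma norm_le_if_squares_sum:
  assumes "star h = h" "star k = k" "h * k = k * h" "h * h + k * k = c *\<^sub>R e" "c \<ge> 0"
  shows "(norm h)\<^sup>2 \<le> c"
proof -
  define u where "u = h + scaleC \<i> k"
  have su: "star u = h - scaleC \<i> k" using assms by (simp add: u_def star_simps scaleC_minus_left)
  have "star u * u = h * h + k * k"
    by (simp add: su) (simp add: u_def algebra_simps mult_scaleC_left mult_scaleC_right scaleC_scaleC
        scaleC_minus_one scaleC_diff_right assms(3))
  then have "(norm u)\<^sup>2 \<le> c"
    using norm_star_mult[of u] norm_scaleR_e[of c] assms by simp
  moreover have "norm h \<le> norm u"
  proof -
    have "2 *\<^sub>R h = u + star u" by (simp add: su) (simp add: u_def scaleR_2)
    then have "2 * norm h \<le> norm u + norm (star u)"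
      by (metis norm_scaleR norm_triangle_ineq abs_numeral)
    then show ?thesis by (simp add: norm_star)
  qed
  ultimately show ?thesis by (meson norm_ge_zero order_trans power_mono)
qed

text \<open>For \<open>\<parallel>h\<parallel> \<le> 1\<close> let \<open>k = sqrt (1 - h\<^sup>2)\<close>. Since \<open>k\<^sup>2 + h\<^sup>2 = 1\<close>, the previous lemma gives
\<open>\<parallel>1 - h\<^sup>2\<parallel> = \<parallel>k\<parallel>\<^sup>2 \<le> 1\<close>.\<close>

lemma positive_square:
  assumes h: "star h = h"
  shows "h * h \<in> positive"
proof -
  have *: "g * g \<in> positive" if g: "star g = g" "norm g \<le> 1" for g
  proof -
    have sg: "star (g * g) = g * g" and n: "norm (g * g) \<le> 1"
      using g norm_square_selfadjoint[of g] by (auto simp: star_simps power_le_one)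
    then obtain w where w: "star w = w" "(e - w) * (e - w) = e - g * g"
      "\<And>x. x * (g * g) = (g * g) * x \<Longrightarrow> x * w = w * x" using sqrt_one_minus by metis
    define k where "k = e - w"
    have k: "star k = k" "k * k = e - g * g" using w by (auto simp: k_def star_simps)
    have "g * w = w * g" using w(3)[of g] by (simp add: mult.assoc)
    then have "k * g = g * k" by (simp add: k_def algebra_simps)
    then have "(norm k)\<^sup>2 \<le> 1" using k g by (intro norm_le_if_squares_sum[of k g 1]) auto
    then have "norm (e - g * g) \<le> 1" using norm_square_selfadjoint[OF k(1)] k(2) by simp
    then show ?thesis unfolding positive_def using sg by (auto intro!: exI[of _ 1])
  qed
  define r where "r = norm h + 1"
  have r: "r > 0" by (simp add: r_def add_nonneg_pos)
  have "(r * r) *\<^sub>R (((1/r) *\<^sub>R h) * ((1/r) *\<^sub>R h)) \<in> positive"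
    using r h by (intro positive_scaleR *) (auto simp: star_simps r_def divide_simps)
  then show ?thesis using r by simp
qed

text \<open>The square roots of \<open>a\<close> and \<open>b\<close> commute, so that \<open>a b\<close> is the square of their self-adjoint product.\<close>

lemma positive_mult:
  assumes a: "a \<in> positive" and b: "b \<in> positive" and ab: "a * b = b * a"
  shows "a * b \<in> positive"
proof -
  obtain p where p: "p \<in> positive" "p * p = a" "\<And>x. x * a = a * x \<Longrightarrow> x * p = p * x"
    using positive_sqrt[OF a] by blast
  obtain q where q: "q \<in> positive" "q * q = b" "\<And>x. x * b = b * x \<Longrightarrow> x * q = q * x"
    using positive_sqrt[OF b] by blast
  have "b * p = p * b" using p(3)[of b] ab by simp
  then have pq: "p * q = q * p" using q(3)[of p] by simp
  then have "star (p * q) = p * q" using p(1) q(1) by (simp add: star_simps positive_star)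
  then have "(p * q) * (p * q) \<in> positive" by (rule positive_square)
  also have "(p * q) * (p * q) = a * b" by (metis mult.assoc pq p(2) q(2))
  finally show ?thesis .
qed

text \<open>Both \<open>a\<close> and \<open>- a\<close> are positive, hence so is \<open>- a\<^sup>2 = p\<^sup>2\<close>, and the sum of squares \<open>a\<^sup>2 + p\<^sup>2\<close> vanishes.\<close>

lemma positive_antisym:
  assumes a: "a \<in> positive" "- a \<in> positive"
  shows "a = 0"
proof -
  have "a * (- a) \<in> positive" using a by (intro positive_mult) auto
  then obtain p where p: "p \<in> positive" "p * p = a * (- a)"
    "\<And>x. x * (a * (- a)) = (a * (- a)) * x \<Longrightarrow> x * p = p * x"
    using positive_sqrt by blast
  have "a * p = p * a" by (rule p(3)) (simp add: mult.assoc)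
  then have "(norm a)\<^sup>2 \<le> 0"
    using a p(1,2) by (intro norm_le_if_squares_sum[of a p 0]) (auto simp: positive_star)
  then show ?thesis by simp
qed

text \<open>With \<open>p\<^sup>2 = g\<close> and \<open>q\<^sup>2 = c - g\<close> one has \<open>p\<^sup>2 + q\<^sup>2 = c\<close>.\<close>

lemma norm_le_if_positive_le:
  assumes g: "g \<in> positive" "c *\<^sub>R e - g \<in> positive" and c: "c \<ge> 0"
  shows "norm g \<le> c"
proof -
  obtain p where p: "p \<in> positive" "p * p = g" using positive_sqrt[OF g(1)] by blast
  obtain q where q: "q \<in> positive" "q * q = c *\<^sub>R e - g"
    "\<And>x. x * (c *\<^sub>R e - g) = (c *\<^sub>R e - g) * x \<Longrightarrow> x * q = q * x"
    using positive_sqrt[OF g(2)] by blast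
  have "p * q = q * p" by (rule q(3)) (simp add: algebra_simps p(2)[symmetric])
  then have "(norm p)\<^sup>2 \<le> c"
    using p q(1,2) c by (intro norm_le_if_squares_sum[of p q c]) (auto simp: positive_star)
  then show ?thesis using norm_square_selfadjoint[of p] p by (simp add: positive_star)
qed

text \<open>For \<open>x = a + \<i> b\<close> with \<open>a\<close> and \<open>b\<close> self-adjoint, this sum is \<open>2 a\<^sup>2 + 2 b\<^sup>2\<close>.\<close>

lemma positive_sum_star_mult: "star x * x + x * star x \<in> positive"
proof -
  define a where "a = (1/2) *\<^sub>R (x + star x)"
  define b where "b = scaleC (- \<i>) ((1/2) *\<^sub>R (x - star x))"
  have sa: "star a = a" by (simp add: a_def star_simps add.commute)
  have sb: "star b = b"
    by (simp add: b_def star_simps scaleC_minus_left scaleC_scaleR scaleC_diff_right algebra_simps)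
  have "2 *\<^sub>R (a * a) = (1/2) *\<^sub>R ((x + star x) * (x + star x))" by (simp add: a_def)
  moreover have "2 *\<^sub>R (b * b) = - (1/2) *\<^sub>R ((x - star x) * (x - star x))"
    by (simp add: b_def mult_scaleC_left mult_scaleC_right scaleC_scaleR scaleC_scaleC scaleC_minus_one)
  ultimately have "2 *\<^sub>R (a * a) + 2 *\<^sub>R (b * b)
      = (1/2) *\<^sub>R ((x + star x) * (x + star x) - (x - star x) * (x - star x))"
    by (simp add: scaleR_diff_right)
  also have "(x + star x) * (x + star x) - (x - star x) * (x - star x)
      = 2 *\<^sub>R (star x * x + x * star x)"
    by (simp add: algebra_simps scaleR_2)
  finally have "2 *\<^sub>R (a * a) + 2 *\<^sub>R (b * b) = star x * x + x * star x" by simp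
  moreover have "2 *\<^sub>R (a * a) + 2 *\<^sub>R (b * b) \<in> positive"
    using sa sb by (intro positive_add positive_scaleR positive_square) auto
  ultimately show ?thesis by simp
qed

text \<open>Let \<open>h = x\<^sup>* x\<close>, let \<open>k = sqrt (h\<^sup>2)\<close> be its absolute value and \<open>m = k - h\<close> twice its negative part, so that
\<open>h m = - k m\<close>. The claim is \<open>m = 0\<close>. The element \<open>y = x m\<close> satisfies \<open>y\<^sup>* y = - p\<close> with \<open>p = k m\<^sup>2\<close> positive.
Now \<open>z = y (sqrt p)\<close> has \<open>z\<^sup>* z = - p\<^sup>2\<close>, while \<open>z z\<^sup>* = y p y\<^sup>* = - (y y\<^sup>*)\<^sup>2\<close>. Both are negatives of squares, but their
sum is positive by the previous lemma, and therefore \<open>p\<^sup>2 = 0\<close>. As \<open>m\<^sup>3 = 2 k m\<^sup>2 = 2 p\<close>, also \<open>m = 0\<close>.\<close>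

theorem star_mult_positive: "star x * x \<in> positive"
proof -
  define h where "h = star x * x"
  have sh: "star h = h" by (simp add: h_def star_simps)
  obtain k where k: "k \<in> positive" "k * k = h * h"
    "\<And>x. x * (h * h) = (h * h) * x \<Longrightarrow> x * k = k * x"
    using positive_sqrt[OF positive_square[OF sh]] by blast
  have hk: "h * k = k * h" by (rule k(3)) (simp add: mult.assoc)
  define m where "m = k - h"
  have sm: "star m = m" using k(1) by (simp add: m_def star_simps sh positive_star)
  have km: "k * m = m * k" by (simp add: m_def algebra_simps hk)
  have hm: "h * m = - (k * m)" by (simp add: m_def algebra_simps hk k(2))
  define p where "p = k * (m * m)"
  have "k * (m * m) = (m * m) * k" by (rule commute_mult[OF km km])
  then have pp: "p \<in> positive" unfolding p_def
    by (rule positive_mult[OF k(1) positive_square[OF sm]])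
  define y where "y = x * m"
  have "star y * y = m * (h * m)" by (simp add: y_def h_def star_simps sm mult.assoc)
  also have "\<dots> = - ((m * k) * m)" unfolding hm by (simp add: mult.assoc)
  also have "(m * k) * m = p" by (simp only: p_def km[symmetric] mult.assoc)
  finally have yy: "star y * y = - p" .
  obtain s where s: "s \<in> positive" "s * s = p" "\<And>x. x * p = p * x \<Longrightarrow> x * s = s * x"
    using positive_sqrt[OF pp] by blast
  have sp: "p * s = s * p" by (metis mult.assoc s(2))
  have ss: "star s = s" using s(1) positive_star by blast
  define z where "z = y * s"
  define q where "q = y * star y"
  have "star z * z = s * (star y * y) * s" by (simp add: z_def star_simps ss mult.assoc)
  also have "\<dots> = - (p * p)" unfolding yy using sp s(2) by (metis mult.assoc mult_minus_left mult_minus_right)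
  finally have zz: "star z * z = - (p * p)" .
  have "z * star z = y * (s * s) * star y" by (simp add: z_def star_simps ss mult.assoc)
  also have "\<dots> = - (y * (star y * y) * star y)" unfolding s(2) yy by simp
  also have "\<dots> = - (q * q)" by (simp add: q_def mult.assoc)
  finally have zz': "z * star z = - (q * q)" .
  have sq: "star q = q" by (simp add: q_def star_simps)
  have "- (p * p) = (star z * z + z * star z) + q * q" using zz zz' by simp
  then have "- (p * p) \<in> positive"
    using positive_add[OF positive_sum_star_mult[of z] positive_square[OF sq]] by argo
  moreover have "p * p \<in> positive" using pp positive_square positive_star by blast
  ultimately have "p * p = 0" using positive_antisym by blast
  then have p0: "p = 0" using norm_square_selfadjoint[of p] pp positive_star by fastforce
  have "m * (m * m) = k * (m * m) - (h * m) * m" by (simp add: m_def algebra_simps)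
  also have "\<dots> = 0" using p0 unfolding hm p_def by (simp add: mult.assoc)
  finally have "(m * m) * (m * m) = 0" by (simp add: mult.assoc)
  moreover have "star (m * m) = m * m" by (simp add: star_simps sm)
  ultimately have "norm m = 0" using norm_square_selfadjoint[of "m * m"] norm_square_selfadjoint[OF sm] by simp
  then have "h = k" by (simp add: m_def)
  then show ?thesis using k(1) h_def by simp
qed

lemma positive_conjugate:
  assumes "k \<in> positive"
  shows "star x * k * x \<in> positive"
proof -
  obtain p where "p \<in> positive" "p * p = k" using positive_sqrt[OF assms] by blast
  then have "star x * k * x = star (p * x) * (p * x)" by (auto simp: star_simps positive_star mult.assoc)
  then show ?thesis using star_mult_positive by simp
qed

text \<open>The equation \<open>c a = 1\<close> reads \<open>c = 1 + c (1 - a)\<close>, a fixed point problem for a contraction.\<close>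

lemma left_inverse_near_e:
  assumes "norm (e - a) < 1"
  obtains c where "c * a = e"
proof -
  define h where "h = e - a"
  have "\<exists>!c. e + c * h = c"
  proof (rule banach_fix_type[of "norm h"], goal_cases)
    case 2
    show ?case using assms by (simp add: h_def)
  next
    case 3
    have "norm (x * h - y * h) \<le> norm h * norm (x - y)" for x y
      by (metis left_diff_distrib mult.commute norm_mult_ineq)
    then show ?case by (simp add: dist_norm)
  qed simp
  then obtain c where "e + c * h = c" by blast
  then have "c * a = e" by (simp add: h_def algebra_simps)
  then show ?thesis using that by blast
qed

text \<open>A multiple of \<open>1 + k\<close> lies within distance less than \<open>1\<close> of the unit: \<open>\<parallel>(t + 1) - (1 + k)\<parallel> \<le> t < t + 1\<close>.\<close>

lemma inverse_e_add_positive: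
  assumes k: "k \<in> positive"
  obtains r where "star r = r" "r * (e + k) = e" "(e + k) * r = e" "r \<in> positive" "e - r \<in> positive"
proof -
  obtain t where t: "t \<ge> 0" "norm (t *\<^sub>R e - k) \<le> t" using k by (auto simp: positive_def)
  have "e - (1/(t+1)) *\<^sub>R (e + k) = (1/(t+1)) *\<^sub>R (t *\<^sub>R e - k)"
  proof -
    have "(1/(t+1)) *\<^sub>R ((t+1) *\<^sub>R e - (e + k)) = (1/(t+1)) *\<^sub>R (t *\<^sub>R e - k)" by (simp add: algebra_simps)
    then show ?thesis using t by (simp add: scaleR_diff_right)
  qed
  then have "norm (e - (1/(t+1)) *\<^sub>R (e + k)) < 1" using t by (simp add: divide_simps)
  then obtain c where c: "c * ((1/(t+1)) *\<^sub>R (e + k)) = e" by (rule left_inverse_near_e)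
  define r where "r = (1/(t+1)) *\<^sub>R c"
  have r: "r * (e + k) = e" using c by (simp add: r_def)
  have "star (e + k) = e + k" using k by (simp add: star_simps positive_star)
  then have r': "(e + k) * star r = e" using arg_cong[OF r, of star] by (simp add: star_simps)
  have sr: "star r = r" by (metis e_left e_right mult.assoc r r')
  then have r2: "(e + k) * r = e" using r' by simp
  have "r = star r * (e + k) * r" using sr r by simp
  then have rp: "r \<in> positive" using positive_conjugate positive_add[OF positive_e k] by metis
  have "r + k * r = r + r * k" using r r2 by (simp add: algebra_simps)
  then have "k * r = r * k" by simp
  then have "k * r \<in> positive" using k rp positive_mult by blast
  moreover have "e - r = k * r" using r2 by (simp add: algebra_simps)
  ultimately show ?thesis using that[of r] sr r r2 rp by simp
qed

text \<open>Take \<open>r = (1 + n x\<^sup>* x)\<^bsup>-1\<^esup>\<close>. It makes \<open>x r\<close> small, although it differs from the unit only by an element of each ideal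
that contains \<open>x\<^sup>* x\<close>. So it serves as the complement of an approximate unit.\<close>

lemma approximate_annihilator:
  assumes n: "n > 0"
  obtains r where "star r = r" "norm r \<le> 1" "(norm (x * r))\<^sup>2 \<le> 1 / n"
    "e - r = n *\<^sub>R (star x * x) * r" "e - r = r * (n *\<^sub>R (star x * x))"
proof -
  define b where "b = n *\<^sub>R (star x * x)"
  have b: "b \<in> positive" using n by (auto simp: b_def intro: positive_scaleR star_mult_positive)
  obtain r where r: "star r = r" "r * (e + b) = e" "(e + b) * r = e" "r \<in> positive" "e - r \<in> positive"
    using inverse_e_add_positive[OF b] by blast
  have br: "e - r = b * r" and rb: "e - r = r * b" using r(2,3) by (simp_all add: algebra_simps)
  have nr: "norm r \<le> 1" using norm_le_if_positive_le[of r 1] r by simp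
  have rr: "r * (e - r) \<in> positive" by (intro positive_mult r) (simp add: algebra_simps)
  moreover have "1 *\<^sub>R e - r * (e - r) \<in> positive"
    using positive_add[OF r(5) positive_square[OF r(1)]] by (simp add: algebra_simps)
  ultimately have "norm (r * (e - r)) \<le> 1" by (intro norm_le_if_positive_le) auto
  also have "r * (e - r) = n *\<^sub>R (star (x * r) * (x * r))"
    unfolding br by (simp add: b_def star_simps r(1) mult.assoc)
  finally have "n * (norm (x * r))\<^sup>2 \<le> 1" using n by (simp add: norm_star_mult)
  then have "(norm (x * r))\<^sup>2 \<le> 1 / n" using n by (simp add: field_simps)
  then show ?thesis using that[of r] r nr br rb unfolding b_def by blast
qed

end

section \<open>Positive functionals and extreme points\<close>

text \<open>A maximal convex cone \<open>C\<close> among those that contain \<open>W\<close> but not \<open>- u\<close> is total: for every \<open>h\<close> it contains \<open>h\<close> or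
\<open>- h\<close>. So it orders the space like a half space, and the functional is the cut
\<open>\<phi> h = Sup {t. h - t u \<in> C}\<close>.\<close>

lemma order_unit_functional:
  fixes W :: "'b::real_vector set" and u :: 'b
  assumes add: "\<And>a b. \<lbrakk>a \<in> W; b \<in> W\<rbrakk> \<Longrightarrow> a + b \<in> W"
    and scale: "\<And>r a. \<lbrakk>a \<in> W; 0 \<le> r\<rbrakk> \<Longrightarrow> r *\<^sub>R a \<in> W"
    and u: "u \<in> W" and unit: "\<And>h. \<exists>s. s *\<^sub>R u - h \<in> W"
    and proper: "- u \<notin> W"
  obtains \<phi> :: "'b \<Rightarrow> real" where "linear \<phi>" "\<phi> u = 1" "\<And>w. w \<in> W \<Longrightarrow> 0 \<le> \<phi> w"
proof -
  define \<C> where "\<C> = {C. W \<subseteq> C \<and> - u \<notin> C \<and> (\<forall>a\<in>C. \<forall>b\<in>C. a + b \<in> C) \<and> (\<forall>a\<in>C. \<forall>r\<ge>0. r *\<^sub>R a \<in> C)}"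
  have "\<exists>M\<in>\<C>. \<forall>X\<in>\<C>. M \<subseteq> X \<longrightarrow> X = M"
  proof (rule subset_Zorn_nonempty)
    have "W \<in> \<C>" using add scale proper by (simp add: \<C>_def)
    then show "\<C> \<noteq> {}" by blast
    fix \<D> assume "\<D> \<noteq> {}" and ch: "subset.chain \<C> \<D>"
    have "a + b \<in> \<Union>\<D>" if ab: "a \<in> \<Union>\<D>" "b \<in> \<Union>\<D>" for a b
    proof -
      obtain A B where AB: "A \<in> \<D>" "B \<in> \<D>" "a \<in> A" "b \<in> B" using ab by blast
      then have "A \<subseteq> B \<or> B \<subseteq> A" using ch by (auto simp: subset_chain_def)
      then obtain D where "D \<in> \<D>" "a \<in> D" "b \<in> D" using AB by blast
      moreover from this have "D \<in> \<C>" using ch by (auto simp: subset_chain_def)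
      ultimately show ?thesis by (auto simp: \<C>_def)
    qed
    moreover have D: "W \<subseteq> D" "- u \<notin> D" "\<And>a r. a \<in> D \<Longrightarrow> r \<ge> 0 \<Longrightarrow> r *\<^sub>R a \<in> D" if "D \<in> \<D>" for D
    proof -
      have "D \<in> \<C>" using that ch by (auto simp: subset_chain_def)
      then show "W \<subseteq> D" "- u \<notin> D" "\<And>a r. a \<in> D \<Longrightarrow> r \<ge> 0 \<Longrightarrow> r *\<^sub>R a \<in> D" by (auto simp: \<C>_def)
    qed
    moreover have "W \<subseteq> \<Union>\<D>" using \<open>\<D> \<noteq> {}\<close> D(1) by blast
    moreover have "- u \<notin> \<Union>\<D>" using D(2) by blast
    moreover have "r *\<^sub>R a \<in> \<Union>\<D>" if "a \<in> \<Union>\<D>" "r \<ge> 0" for a r using D(3) that by blast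
    ultimately show "\<Union>\<D> \<in> \<C>" by (simp add: \<C>_def)
  qed
  then obtain C where C: "C \<in> \<C>" and max: "\<And>X. X \<in> \<C> \<Longrightarrow> C \<subseteq> X \<Longrightarrow> X = C" by blast
  have WC: "\<And>w. w \<in> W \<Longrightarrow> w \<in> C" and uC: "- u \<notin> C" and C_add: "\<And>a b. a \<in> C \<Longrightarrow> b \<in> C \<Longrightarrow> a + b \<in> C"
    and C_scale: "\<And>r a. a \<in> C \<Longrightarrow> 0 \<le> r \<Longrightarrow> r *\<^sub>R a \<in> C" using C by (auto simp: \<C>_def)
  have C0: "0 \<in> C" using C_scale[OF WC[OF u], of 0] by simp
  have su: "s \<ge> 0" if "s *\<^sub>R u \<in> C" for s
  proof (rule ccontr)
    assume s: "\<not> s \<ge> 0"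
    then have "(1 / - s) *\<^sub>R s *\<^sub>R u \<in> C" by (intro C_scale that) simp
    then show False using uC s by simp
  qed
  have ext: "\<exists>c\<in>C. \<exists>t>0. - u = c + t *\<^sub>R h" if "h \<notin> C" for h
  proof -
    define D where "D = {c + t *\<^sub>R h | c t. c \<in> C \<and> t \<ge> 0}"
    have DI: "c + t *\<^sub>R h \<in> D" if "c \<in> C" "t \<ge> 0" for c t unfolding D_def using that by blast
    have "C \<subseteq> D" using DI[of _ 0] by auto
    have "h \<in> D" using DI[OF C0, of 1] by simp
    then have "D \<notin> \<C>" using max[of D] \<open>C \<subseteq> D\<close> that by blast
    moreover have "a + b \<in> D" if "a \<in> D" "b \<in> D" for a b
    proof -
      obtain c t c' t' where "a = c + t *\<^sub>R h" "b = c' + t' *\<^sub>R h" "c \<in> C" "c' \<in> C" "t \<ge> 0" "t' \<ge> 0"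
        using \<open>a \<in> D\<close> \<open>b \<in> D\<close> unfolding D_def by blast
      then show ?thesis using DI[OF C_add, of c c' "t + t'"] by (simp add: algebra_simps)
    qed
    moreover have "r *\<^sub>R a \<in> D" if "a \<in> D" "r \<ge> 0" for a r
    proof -
      obtain c t where "a = c + t *\<^sub>R h" "c \<in> C" "t \<ge> 0"
        using \<open>a \<in> D\<close> unfolding D_def by blast
      then show ?thesis using DI[OF C_scale, of c r "r * t"] \<open>r \<ge> 0\<close> by (simp add: scaleR_add_right)
    qed
    moreover have "W \<subseteq> D" using \<open>C \<subseteq> D\<close> WC by blast
    ultimately have "- u \<in> D" by (auto simp: \<C>_def)
    then obtain c t where ct: "- u = c + t *\<^sub>R h" "c \<in> C" "t \<ge> 0" unfolding D_def by blast
    then have "t \<noteq> 0" using uC by auto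
    then have "t > 0" using ct by simp
    then show ?thesis using ct by blast
  qed
  have total: "h \<in> C \<or> - h \<in> C" for h
  proof (rule ccontr)
    assume "\<not> (h \<in> C \<or> - h \<in> C)"
    then obtain c t c' t' where c: "c \<in> C" "t > 0" "- u = c + t *\<^sub>R h" "c' \<in> C" "t' > 0" "- u = c' + t' *\<^sub>R (- h)"
      using ext[of h] ext[of "- h"] by blast
    \<comment> \<open>The combination of the two equations that cancels \<open>h\<close>.\<close>
    have "t' *\<^sub>R (- u) + t *\<^sub>R (- u) = t' *\<^sub>R c + t *\<^sub>R c'"
      by (subst c(3), subst c(6)) (simp add: algebra_simps)
    then have "(- (t' + t)) *\<^sub>R u = t' *\<^sub>R c + t *\<^sub>R c'" by (simp add: algebra_simps)
    also have "\<dots> \<in> C" using c by (intro C_add C_scale) auto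
    finally show False using su[of "- (t' + t)"] c by simp
  qed
  define T where "T h = {t. h - t *\<^sub>R u \<in> C}" for h
  define \<phi> where "\<phi> h = Sup (T h)" for h
  have T_ne: "T h \<noteq> {}" for h
  proof -
    obtain s where "s *\<^sub>R u - (- h) \<in> W" using unit by blast
    then have "- s \<in> T h" using WC by (auto simp: T_def algebra_simps)
    then show ?thesis by blast
  qed
  have T_bdd: "\<exists>s. \<forall>t\<in>T h. t \<le> s" for h
  proof -
    obtain s where s: "s *\<^sub>R u - h \<in> C" using unit WC by blast
    have "t \<le> s" if "t \<in> T h" for t
    proof -
      have "(s *\<^sub>R u - h) + (h - t *\<^sub>R u) \<in> C" using s that by (intro C_add) (auto simp: T_def)
      then have "(s - t) *\<^sub>R u \<in> C" by (simp add: algebra_simps)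
      then show ?thesis using su by force
    qed
    then show ?thesis by blast
  qed
  have bdd: "bdd_above (T h)" for h using T_bdd[of h] by (auto simp: bdd_above_def)
  have le: "t \<le> \<phi> h" if "h - t *\<^sub>R u \<in> C" for t h
    unfolding \<phi>_def using that by (intro cSup_upper bdd) (simp add: T_def)
  have ge: "h - t *\<^sub>R u \<in> C" if t: "t < \<phi> h" for t h
  proof -
    obtain s where "s \<in> T h" "t < s" using less_cSupD[OF T_ne t[unfolded \<phi>_def]] by blast
    then have "(h - s *\<^sub>R u) + (s - t) *\<^sub>R u \<in> C" using WC[OF u] by (intro C_add C_scale) (simp_all add: T_def)
    then show ?thesis by (simp add: algebra_simps)
  qed
  have super: "\<phi> h + \<phi> g \<le> \<phi> (h + g)" for h g
  proof (rule field_le_epsilon)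
    fix r :: real assume "r > 0"
    then have "(h - (\<phi> h - r/2) *\<^sub>R u) + (g - (\<phi> g - r/2) *\<^sub>R u) \<in> C" by (intro C_add ge) auto
    also have "(h - (\<phi> h - r/2) *\<^sub>R u) + (g - (\<phi> g - r/2) *\<^sub>R u)
        = (h + g) - ((\<phi> h - r/2) + (\<phi> g - r/2)) *\<^sub>R u"
      by (simp only: scaleR_add_left) simp
    also have "(\<phi> h - r/2) + (\<phi> g - r/2) = \<phi> h + \<phi> g - r" by simp
    finally show "\<phi> h + \<phi> g \<le> \<phi> (h + g) + r" using le by fastforce
  qed
  have phi_u: "\<phi> (t *\<^sub>R u) = t" for t
  proof (rule antisym)
    show "t \<le> \<phi> (t *\<^sub>R u)" using C0 by (intro le) simp
    show "\<phi> (t *\<^sub>R u) \<le> t" unfolding \<phi>_def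
    proof (rule cSup_least[OF T_ne])
      fix s assume "s \<in> T (t *\<^sub>R u)"
      then have "(t - s) *\<^sub>R u \<in> C" by (simp add: T_def algebra_simps)
      then show "s \<le> t" using su by force
    qed
  qed
  have neg: "\<phi> (- h) = - \<phi> h" for h
  proof (rule antisym)
    show "\<phi> (- h) \<le> - \<phi> h" using super[of h "- h"] phi_u[of 0] by simp
    show "- \<phi> h \<le> \<phi> (- h)"
    proof (rule field_le_epsilon)
      fix r :: real assume "r > 0"
      then have "h - (\<phi> h + r) *\<^sub>R u \<notin> C" using le[of h "\<phi> h + r"] by auto
      then have "- (h - (\<phi> h + r) *\<^sub>R u) \<in> C" using total by blast
      then have "- h - (- (\<phi> h + r)) *\<^sub>R u \<in> C" by (simp add: algebra_simps)
      then show "- \<phi> h \<le> \<phi> (- h) + r" using le[of "- h" "- (\<phi> h + r)"] by simp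
    qed
  qed
  have phi_add: "\<phi> (h + g) = \<phi> h + \<phi> g" for h g
    using super[of h g] super[of "- h" "- g"] neg[of "h + g"] neg[of h] neg[of g] by (simp add: add.commute)
  have pos: "0 \<le> \<phi> w" if "w \<in> C" for w using le[of w 0] that by simp
  have pos_scale: "\<phi> (r *\<^sub>R h) = r * \<phi> h" if r: "r > 0" for r h
  proof -
    have half: "r * \<phi> h \<le> \<phi> (r *\<^sub>R h)" if r: "r > 0" for r h
    proof (rule field_le_epsilon)
      fix d :: real assume d: "d > 0"
      then have "r *\<^sub>R (h - (\<phi> h - d / r) *\<^sub>R u) \<in> C" using r by (intro C_scale ge) auto
      then have "r *\<^sub>R h - (r * \<phi> h - d) *\<^sub>R u \<in> C" using r by (simp add: algebra_simps)
      then show "r * \<phi> h \<le> \<phi> (r *\<^sub>R h) + d" using le by fastforce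
    qed
    have "(1/r) * \<phi> (r *\<^sub>R h) \<le> \<phi> h" using half[of "1/r" "r *\<^sub>R h"] r by simp
    then show ?thesis using half[OF r, of h] r by (simp add: field_simps)
  qed
  have phi_scale: "\<phi> (r *\<^sub>R h) = r * \<phi> h" for r h
  proof -
    consider "r > 0" | "r = 0" | "- r > 0" by linarith
    then show ?thesis
    proof cases
      case 3
      then show ?thesis using pos_scale[of "- r" h] neg[of "r *\<^sub>R h"] by simp
    qed (use pos_scale phi_u[of 0] in auto)
  qed
  have "linear \<phi>" by (rule linearI) (simp_all add: phi_add phi_scale)
  then show ?thesis using that phi_u[of 1] pos WC by auto
qed

text \<open>The existence part of the Krein-Milman theorem for a compact set of functions. Among the closed faces inside
the face where evaluation at \<open>b\<close> is largest there is a minimal one. Since the maximum set of any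
evaluation on a face is again a face, all evaluations are constant on a minimal face, which is thus a single point.\<close>

lemma extreme_point_maximizing:
  fixes S :: "('x \<Rightarrow> real) set"
  assumes S: "compact S" "closed S" "S \<noteq> {}"
  obtains f where "f \<in> S" "\<And>g. g \<in> S \<Longrightarrow> g b \<le> f b"
    "\<And>g h t. \<lbrakk>g \<in> S; h \<in> S; 0 < t; t < 1; f = (\<lambda>x. t * g x + (1 - t) * h x)\<rbrakk> \<Longrightarrow> g = f"
proof -
  have conv: "g x = m \<and> h x = m" if "g x \<le> m" "h x \<le> m" "0 < t" "t < 1" "t * g x + (1 - t) * h x = m"
    for g h :: "'x \<Rightarrow> real" and x m and t :: real
  proof -
    have "t * (m - g x) + (1 - t) * (m - h x) = 0" using that(5) by (simp add: algebra_simps)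
    moreover have "0 \<le> t * (m - g x)" "0 \<le> (1 - t) * (m - h x)" using that by auto
    ultimately have "t * (m - g x) = 0" "(1 - t) * (m - h x) = 0" by linarith+
    then show ?thesis using that by simp
  qed
  define face where "face F \<longleftrightarrow> F \<subseteq> S \<and> F \<noteq> {} \<and> closed F \<and>
      (\<forall>g\<in>S. \<forall>h\<in>S. \<forall>t. 0 < t \<and> t < 1 \<and> (\<lambda>x. t * g x + (1 - t) * h x) \<in> F \<longrightarrow> g \<in> F \<and> h \<in> F)" for F
  have face_max: "face {f\<in>F. \<forall>g\<in>F. g a \<le> f a}" if F: "face F" for F a
  proof -
    have "compact F" using F S by (metis face_def compact_Int_closed inf.absorb2)
    moreover have "F \<noteq> {}" using F by (simp add: face_def)
    ultimately obtain f0 where f0: "f0 \<in> F" "\<And>g. g \<in> F \<Longrightarrow> g a \<le> f0 a"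
      using continuous_attains_sup[of F "\<lambda>f. f a"]
        continuous_on_subset[OF continuous_on_product_coordinates[of a] subset_UNIV] by blast
    then have eq: "{f\<in>F. \<forall>g\<in>F. g a \<le> f a} = {f\<in>F. f a = f0 a}" by (auto intro: antisym)
    have "{f\<in>F. f a = f0 a} = F \<inter> {f. f a = f0 a}" by blast
    moreover have "closed {f::'x \<Rightarrow> real. f a = f0 a}"
      by (intro closed_Collect_eq continuous_on_product_coordinates continuous_on_const)
    ultimately have "closed {f\<in>F. f a = f0 a}" using F by (simp add: face_def closed_Int)
    moreover have "g a = f0 a \<and> h a = f0 a \<and> g \<in> F \<and> h \<in> F"
      if "g \<in> S" "h \<in> S" "0 < t" "t < 1" "(\<lambda>x. t * g x + (1 - t) * h x) \<in> F"
        "t * g a + (1 - t) * h a = f0 a" for g h t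
    proof -
      have "g \<in> F \<and> h \<in> F" using F that unfolding face_def by blast
      then show ?thesis using conv[of g a "f0 a" h t] f0(2) that by blast
    qed
    ultimately show ?thesis using F f0(1) unfolding eq face_def by blast
  qed
  have fS: "face S" using S by (simp add: face_def)
  define F0 where "F0 = {f\<in>S. \<forall>g\<in>S. g b \<le> f b}"
  have F0: "face F0" unfolding F0_def by (rule face_max[OF fS])
  \<comment> \<open>Complements turn minimal faces into the maximal elements that the lemma of Zorn provides.\<close>
  define \<A> where "\<A> = {- F | F. face F \<and> F \<subseteq> F0}"
  have "\<exists>M\<in>\<A>. \<forall>X\<in>\<A>. M \<subseteq> X \<longrightarrow> X = M"
  proof (rule subset_Zorn_nonempty)
    show "\<A> \<noteq> {}" unfolding \<A>_def using F0 by blast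
    fix \<C> assume ne: "\<C> \<noteq> {}" and ch: "subset.chain \<A> \<C>"
    define \<F> where "\<F> = uminus ` \<C>"
    have f: "face F \<and> F \<subseteq> F0" if "F \<in> \<F>" for F
    proof -
      have "- F \<in> \<A>" using that ch by (auto simp: \<F>_def subset_chain_def)
      then obtain G where "- F = - G" "face G" "G \<subseteq> F0" unfolding \<A>_def by blast
      then show ?thesis by simp
    qed
    have "S \<inter> \<Inter>\<F> \<noteq> {}"
    proof (rule compact_imp_fip[OF S(1)])
      show "closed F" if "F \<in> \<F>" for F using f[OF that] by (simp add: face_def)
      fix \<G> assume \<G>: "finite \<G>" "\<G> \<subseteq> \<F>"
      show "S \<inter> \<Inter>\<G> \<noteq> {}"
      proof (cases "\<G> = {}")
        case False
        then obtain G where G: "G \<in> \<G>" "\<And>F. F \<in> \<G> \<Longrightarrow> F \<subseteq> G \<Longrightarrow> G = F"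
          using finite_has_minimal[OF \<G>(1)] by blast
        have "F \<subseteq> G \<or> G \<subseteq> F" if "F \<in> \<G>" for F
        proof -
          have "- F \<in> \<C>" "- G \<in> \<C>" using that G(1) \<G>(2) by (auto simp: \<F>_def)
          then have "- F \<subseteq> - G \<or> - G \<subseteq> - F" using ch unfolding subset_chain_def by blast
          then show ?thesis by blast
        qed
        then have "G \<subseteq> \<Inter>\<G>" using G(2) by blast
        moreover have "face G" using f G(1) \<G>(2) by blast
        then have "G \<subseteq> S" "G \<noteq> {}" by (simp_all add: face_def)
        ultimately show ?thesis by blast
      qed (use S in simp)
    qed
    then have "\<Inter>\<F> \<noteq> {}" by blast
    moreover have "\<F> \<noteq> {}" using ne by (simp add: \<F>_def)
    moreover have "closed (\<Inter>\<F>)" using f by (auto simp: face_def intro: closed_Inter)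
    ultimately have "face (\<Inter>\<F>) \<and> \<Inter>\<F> \<subseteq> F0"
      using f unfolding face_def by blast
    moreover have "\<Union>\<C> = - \<Inter>\<F>" by (auto simp: \<F>_def)
    ultimately show "\<Union>\<C> \<in> \<A>" unfolding \<A>_def by blast
  qed
  then obtain M where M: "M \<in> \<A>" "\<And>X. X \<in> \<A> \<Longrightarrow> M \<subseteq> X \<Longrightarrow> X = M" by blast
  then obtain F where F: "face F" "F \<subseteq> F0" and MF: "M = - F" unfolding \<A>_def by blast
  have min: "G = F" if "face G" "G \<subseteq> F" for G
  proof -
    have "- G \<in> \<A>" using that F(2) unfolding \<A>_def by blast
    moreover have "M \<subseteq> - G" using that(2) MF by blast
    ultimately have "- G = - F" using M(2) MF by blast
    then show ?thesis by simp
  qed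
  obtain f where f: "f \<in> F" using F by (auto simp: face_def)
  have single: "g = f" if g: "g \<in> F" for g
  proof
    fix a
    have "{f\<in>F. \<forall>g\<in>F. g a \<le> f a} = F" by (rule min[OF face_max[OF F(1)]]) blast
    then show "g a = f a" using f g by (metis (mono_tags, lifting) antisym mem_Collect_eq)
  qed
  show ?thesis
  proof (rule that[of f])
    show "f \<in> S" "\<And>g. g \<in> S \<Longrightarrow> g b \<le> f b" using f F(2) by (auto simp: F0_def)
    fix g h t
    assume "g \<in> S" "h \<in> S" "0 < t" "t < 1" "f = (\<lambda>x. t * g x + (1 - t) * h x)"
    then have "g \<in> F" using F(1) f unfolding face_def by blast
    then show "g = f" by (rule single)
  qed
qed

section \<open>Two-sided ideals\<close>

definition two_sided_ideal :: "'a::cstar_algebra set \<Rightarrow> bool" where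
  "two_sided_ideal I \<longleftrightarrow> module.subspace scaleC I \<and> (\<forall>x\<in>I. \<forall>a. a * x \<in> I \<and> x * a \<in> I)"

lemma closed_ideals_iff: "I \<in> closed_ideals \<longleftrightarrow> two_sided_ideal I \<and> closed I"
  by (auto simp: closed_ideals_def two_sided_ideal_def)

lemma
  assumes "two_sided_ideal I"
  shows ideal_0: "0 \<in> I"
    and ideal_add: "\<lbrakk>x \<in> I; y \<in> I\<rbrakk> \<Longrightarrow> x + y \<in> I"
    and ideal_scaleC: "x \<in> I \<Longrightarrow> scaleC c x \<in> I"
    and ideal_scaleR: "x \<in> I \<Longrightarrow> r *\<^sub>R x \<in> I"
    and ideal_minus: "x \<in> I \<Longrightarrow> - x \<in> I"
    and ideal_mult_left: "x \<in> I \<Longrightarrow> a * x \<in> I"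
    and ideal_mult_right: "x \<in> I \<Longrightarrow> x * a \<in> I"
proof -
  have s: "module.subspace scaleC I" using assms by (simp add: two_sided_ideal_def)
  note m = module_scaleC
  show "0 \<in> I" by (rule module.subspace_0[OF m s])
  show "x + y \<in> I" if "x \<in> I" "y \<in> I" for x y by (rule module.subspace_add[OF m s that])
  show c: "scaleC c x \<in> I" if "x \<in> I" for x c by (rule module.subspace_scale[OF m s that])
  show "r *\<^sub>R x \<in> I" if "x \<in> I" using c[OF that, of "of_real r"] by (simp add: scaleC_of_real)
  show "- x \<in> I" if "x \<in> I" for x using c[OF that, of "-1"] by (simp add: scaleC_minus_one)
  show "a * x \<in> I" "x * a \<in> I" if "x \<in> I" using assms that by (auto simp: two_sided_ideal_def)
qed

lemma two_sided_idealI: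
  assumes "0 \<in> I" "\<And>x y. \<lbrakk>x \<in> I; y \<in> I\<rbrakk> \<Longrightarrow> x + y \<in> I" "\<And>c x. x \<in> I \<Longrightarrow> scaleC c x \<in> I"
    "\<And>a x. x \<in> I \<Longrightarrow> a * x \<in> I" "\<And>a x. x \<in> I \<Longrightarrow> x * a \<in> I"
  shows "two_sided_ideal I"
  unfolding two_sided_ideal_def using assms by (simp add: module.subspace_def[OF module_scaleC])

lemma closure_ideal:
  fixes I :: "'a::cstar_algebra set"
  assumes I: "two_sided_ideal I"
  shows "closure I \<in> closed_ideals"
  unfolding closed_ideals_iff
proof
  have lim: "\<exists>s. (\<forall>n. s n \<in> I) \<and> s \<longlonglongrightarrow> x" if "x \<in> closure I" for x
    using that closure_sequential by blast
  have cl: "x \<in> closure I" if "\<And>n. s n \<in> I" "s \<longlonglongrightarrow> x" for s x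
    using that closure_sequential by blast
  show "two_sided_ideal (closure I)"
  proof (rule two_sided_idealI)
    show "0 \<in> closure I" using ideal_0[OF I] closure_subset by blast
    fix x assume "x \<in> closure I"
    then obtain s where s: "\<And>n. s n \<in> I" "s \<longlonglongrightarrow> x" using lim by blast
    show "scaleC c x \<in> closure I" for c by (rule cl[OF ideal_scaleC[OF I s(1)] tendsto_scaleC[OF s(2)]])
    show "a * x \<in> closure I" for a by (rule cl[OF ideal_mult_left[OF I s(1)] tendsto_mult_left[OF s(2)]])
    show "x * a \<in> closure I" for a by (rule cl[OF ideal_mult_right[OF I s(1)] tendsto_mult_right[OF s(2)]])
    fix y assume "y \<in> closure I"
    then obtain t where t: "\<And>n. t n \<in> I" "t \<longlonglongrightarrow> y" using lim by blast
    show "x + y \<in> closure I" by (rule cl[OF ideal_add[OF I s(1) t(1)] tendsto_add[OF s(2) t(2)]])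
  qed
qed simp

lemma Inter_closed_ideals:
  assumes "\<L> \<subseteq> closed_ideals"
  shows "\<Inter>\<L> \<in> closed_ideals"
proof -
  have id: "two_sided_ideal L" and cl: "closed L" if "L \<in> \<L>" for L
    using assms that closed_ideals_iff by auto
  have "two_sided_ideal (\<Inter>\<L>)"
    by (rule two_sided_idealI)
      (auto intro: ideal_0[OF id] ideal_add[OF id] ideal_scaleC[OF id] ideal_mult_left[OF id] ideal_mult_right[OF id])
  then show ?thesis using cl by (auto simp: closed_ideals_iff intro: closed_Inter)
qed

lemma closed_if_approximable:
  fixes x :: "'b::real_normed_vector"
  assumes "closed I" "\<And>d. d > 0 \<Longrightarrow> \<exists>y\<in>I. norm (x - y) < d"
  shows "x \<in> I"
proof -
  have "x \<in> closure I" unfolding closure_approachable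
    using assms(2) by (metis dist_norm norm_minus_commute)
  then show ?thesis using assms(1) by simp
qed

section \<open>States that vanish on a closed ideal\<close>

context unital_cstar
begin

text \<open>A state is represented by its real part, a real-linear functional that is invariant under the involution.
Vanishing is required on the self-adjoint elements of \<open>I\<close> only, as \<open>I\<close> is an arbitrary set here and its elements
need not have their real parts in \<open>I\<close>; for an ideal this forces the left kernel to contain all of \<open>I\<close>,
because \<open>y\<^sup>* y\<close> is self-adjoint.\<close>

definition states_vanishing_on :: "'a set \<Rightarrow> ('a \<Rightarrow> real) set" where
  "states_vanishing_on I = {\<phi>. (\<forall>a b. \<phi> (a + b) = \<phi> a + \<phi> b) \<and> (\<forall>r a. \<phi> (r *\<^sub>R a) = r * \<phi> a)
     \<and> (\<forall>a. \<phi> (star a) = \<phi> a) \<and> (\<forall>x. 0 \<le> \<phi> (star x * x)) \<and> \<phi> e = 1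
     \<and> (\<forall>y\<in>I. star y = y \<longrightarrow> \<phi> y = 0)}"

lemma state_positive:
  assumes "\<phi> \<in> states_vanishing_on I" "a \<in> positive"
  shows "0 \<le> \<phi> a"
proof -
  obtain p where "p \<in> positive" "p * p = a" using positive_sqrt[OF assms(2)] by blast
  then have "a = star p * p" by (simp add: positive_star)
  then show ?thesis using assms by (simp add: states_vanishing_on_def)
qed

text \<open>For the self-adjoint part \<open>h\<close> of \<open>a\<close>, both \<open>\<parallel>a\<parallel> - h\<close> and \<open>\<parallel>a\<parallel> + h\<close> are positive.\<close>

lemma state_bound:
  assumes "\<phi> \<in> states_vanishing_on I"
  shows "\<bar>\<phi> a\<bar> \<le> norm a"
proof -
  have add: "\<phi> (a + b) = \<phi> a + \<phi> b" and sc: "\<phi> (r *\<^sub>R a) = r * \<phi> a" for a b r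
    using assms by (auto simp: states_vanishing_on_def)
  have e: "\<phi> e = 1" and st: "\<phi> (star a) = \<phi> a" using assms by (auto simp: states_vanishing_on_def)
  define h where "h = (1/2) *\<^sub>R (a + star a)"
  have "norm h \<le> norm a"
    using norm_triangle_ineq[of a "star a"] by (simp add: h_def norm_star)
  moreover have "star h = h" by (simp add: h_def star_simps add.commute)
  ultimately have "0 \<le> \<phi> (norm a *\<^sub>R e - h)" "0 \<le> \<phi> (norm a *\<^sub>R e + h)"
    using assms positive_diff_norm state_positive by metis+
  moreover have "\<phi> (norm a *\<^sub>R e - h) + \<phi> h = norm a" using add[of "norm a *\<^sub>R e - h" h] sc e by simp
  moreover have "\<phi> (norm a *\<^sub>R e + h) = norm a + \<phi> h" using add sc e by simp
  moreover have "\<phi> h = \<phi> a" using st by (simp add: h_def sc add)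
  ultimately show ?thesis by linarith
qed

text \<open>This is the theorem of Banach and Alaoglu: states form a closed subset of a product of compact intervals.\<close>

lemma compact_states: "compact (states_vanishing_on I)" and closed_states: "closed (states_vanishing_on I)"
proof -
  have "compactin (product_topology (\<lambda>_. euclidean) UNIV) (PiE UNIV (\<lambda>a. {- norm a..norm a}))"
    by (subst compactin_PiE) simp
  then have c: "compact (PiE UNIV (\<lambda>a::'a. {- norm a..norm a}))"
    by (simp add: euclidean_product_topology)
  have "states_vanishing_on I = (\<Inter>a. \<Inter>b. {\<phi>. \<phi> (a + b) = \<phi> a + \<phi> b}) \<inter> (\<Inter>r. \<Inter>a. {\<phi>. \<phi> (r *\<^sub>R a) = r * \<phi> a})
     \<inter> (\<Inter>a. {\<phi>. \<phi> (star a) = \<phi> a}) \<inter> (\<Inter>x. {\<phi>. 0 \<le> \<phi> (star x * x)}) \<inter> {\<phi>. \<phi> e = 1}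
     \<inter> (\<Inter>y\<in>{y\<in>I. star y = y}. {\<phi>. \<phi> y = 0})"
    unfolding states_vanishing_on_def by auto
  also have "closed \<dots>"
    by (intro closed_Int closed_INT ballI closed_Collect_eq closed_Collect_le
        continuous_intros continuous_on_product_coordinates)
  finally show "closed (states_vanishing_on I)" .
  moreover have "states_vanishing_on I \<subseteq> PiE UNIV (\<lambda>a. {- norm a..norm a})"
    using state_bound by (auto simp: abs_le_iff) (metis abs_le_D2 minus_le_iff)
  ultimately show "compact (states_vanishing_on I)" using c by (metis compact_Int_closed inf.absorb2)
qed

text \<open>The elements \<open>x - x r\<close> lie in the ideal and approach \<open>x\<close> when \<open>r = (1 + n x\<^sup>* x)\<^bsup>-1\<^esup>\<close> and \<open>n\<close> grows.\<close>

lemma closed_ideal_semiprime: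
  fixes x :: 'a
  assumes I: "I \<in> closed_ideals" and x: "star x * x \<in> I"
  shows "x \<in> I"
proof (rule closed_if_approximable)
  have id: "two_sided_ideal I" and "closed I" using I by (auto simp: closed_ideals_iff)
  then show "closed I" by simp
  fix d :: real assume d: "d > 0"
  \<comment> \<open>The parameter is chosen to make the norm of \<open>x r\<close> at most \<open>d / 2\<close>.\<close>
  obtain r where r: "(norm (x * r))\<^sup>2 \<le> 1 / (4 / d\<^sup>2)" "e - r = (4 / d\<^sup>2) *\<^sub>R (star x * x) * r"
    by (rule approximate_annihilator[of "4 / d\<^sup>2" x]) (use d in auto)
  have eq: "1 / (4 / d\<^sup>2) = (d/2)\<^sup>2" by (simp add: power_divide)
  have "norm (x * r) \<le> d / 2"
    by (rule power2_le_imp_le[OF r(1)[unfolded eq]]) (use d in simp)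
  then have "norm (x * r) < d" using d by simp
  moreover have "x * (e - r) \<in> I" unfolding r(2)
    by (rule ideal_mult_left[OF id ideal_mult_right[OF id ideal_scaleR[OF id x]]])
  then have "x - x * r \<in> I" by (simp add: algebra_simps)
  moreover have "x - (x - x * r) = x * r" by simp
  ultimately show "\<exists>y\<in>I. norm (x - y) < d" by metis
qed

text \<open>Suppose \<open>b = d - k - y\<close>. Conjugating with \<open>r = (1 + y\<^sup>* y / d\<^sup>2)\<^bsup>-1\<^esup>\<close> changes \<open>b\<close> only by an element of the ideal and makes
the norm of \<open>r y r\<close> at most \<open>d\<close>. Hence \<open>0 \<le> r b r \<le> 2 d\<close>, and \<open>b\<close> has distance at most \<open>2 d\<close> from the ideal.\<close>

lemma closed_ideal_if_dominated:
  fixes b :: 'a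
  assumes I: "I \<in> closed_ideals" and b: "b \<in> positive"
    and dom: "\<And>d. d > 0 \<Longrightarrow> \<exists>k\<in>positive. \<exists>y\<in>I. star y = y \<and> d *\<^sub>R e - b = k + y"
  shows "b \<in> I"
proof (rule closed_if_approximable)
  have id: "two_sided_ideal I" and "closed I" using I by (auto simp: closed_ideals_iff)
  then show "closed I" by simp
  fix d' :: real assume d': "d' > 0"
  define d where "d = d' / 4"
  have d: "d > 0" using d' by (simp add: d_def)
  obtain k y where k: "k \<in> positive" and y: "y \<in> I" "star y = y" and eq: "d *\<^sub>R e - b = k + y"
    using dom[OF d] by blast
  obtain r where r: "star r = r" "norm r \<le> 1" "(norm (y * r))\<^sup>2 \<le> 1 / (1 / d\<^sup>2)"
    "e - r = (1 / d\<^sup>2) *\<^sub>R (star y * y) * r"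
    by (rule approximate_annihilator[of "1 / d\<^sup>2" y]) (use d in auto)
  have eq': "1 / (1 / d\<^sup>2) = d\<^sup>2" by simp
  have "norm (y * r) \<le> d"
    by (rule power2_le_imp_le[OF r(3)[unfolded eq']]) (use d in simp)
  then have "norm (r * (y * r)) \<le> 1 * d"
    by (rule order_trans[OF norm_mult_ineq mult_mono[OF r(2)]]) auto
  then have nryr: "norm (r * (y * r)) \<le> d" by simp
  have "norm (r * r) \<le> 1" using r(2) norm_square_selfadjoint[OF r(1)] by (simp add: power_le_one)
  then have "1 *\<^sub>R e - r * r \<in> positive" by (intro positive_diff_norm) (auto simp: star_simps r(1))
  then have 1: "d *\<^sub>R (e - r * r) \<in> positive" using d by (intro positive_scaleR) auto
  have 2: "d *\<^sub>R e + r * (y * r) \<in> positive"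
    using nryr by (intro positive_diff_norm) (simp_all add: star_simps r(1) y(2) mult.assoc)
  have 3: "r * k * r \<in> positive" using positive_conjugate[OF k, of r] r(1) by simp
  have "b = d *\<^sub>R e - k - y" using eq by (simp add: algebra_simps)
  then have "r * b * r = r * (d *\<^sub>R e - k - y) * r" by simp
  also have "\<dots> = d *\<^sub>R (r * r) - r * k * r - r * (y * r)" by (simp add: algebra_simps)
  finally have "(2 * d) *\<^sub>R e - r * b * r = d *\<^sub>R (e - r * r) + (d *\<^sub>R e + r * (y * r)) + r * k * r"
    by (simp add: algebra_simps scaleR_2[symmetric])
  also have "\<dots> \<in> positive" by (intro positive_add 1 2 3)
  finally have "norm (r * b * r) \<le> 2 * d"
    using positive_conjugate[OF b, of r] r(1) d by (intro norm_le_if_positive_le) auto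
  then have "norm (r * b * r) < d'" using d' by (simp add: d_def)
  moreover have "b - r * b * r \<in> I"
  proof -
    have er: "e - r \<in> I" unfolding r(4) by (rule ideal_mult_right[OF id ideal_scaleR[OF id ideal_mult_left[OF id y(1)]]])
    have "b - r * b * r = (e - r) * b + r * b * (e - r)" by (simp add: algebra_simps)
    then show ?thesis using ideal_add[OF id ideal_mult_right[OF id er] ideal_mult_left[OF id er]] by simp
  qed
  moreover have "b - (b - r * b * r) = r * b * r" by simp
  ultimately show "\<exists>y\<in>I. norm (b - y) < d'" by metis
qed

text \<open>By the previous two lemmas there is \<open>d > 0\<close> such that \<open>d - a\<^sup>* a\<close> is not the sum of a positive element and a self-adjoint
element of \<open>I\<close>. A state with the value at least \<open>d\<close> at \<open>a\<^sup>* a\<close> is then a functional that is nonnegative on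
the cone generated by the positive elements, by the self-adjoint part of \<open>I\<close> and by \<open>a\<^sup>* a - d\<close>. This cone
does not contain \<open>-1\<close>.\<close>

lemma separating_state:
  fixes a :: 'a
  assumes I: "I \<in> closed_ideals" and a: "a \<notin> I"
  obtains \<phi> where "\<phi> \<in> states_vanishing_on I" "0 < \<phi> (star a * a)"
proof -
  have id: "two_sided_ideal I" using I by (simp add: closed_ideals_iff)
  define b where "b = star a * a"
  have b: "b \<in> positive" and sb: "star b = b" by (simp_all add: b_def star_mult_positive star_simps)
  have "b \<notin> I" using closed_ideal_semiprime[OF I] a b_def by blast
  then obtain d where d: "d > 0" "\<And>k y. k \<in> positive \<Longrightarrow> y \<in> I \<Longrightarrow> star y = y \<Longrightarrow> d *\<^sub>R e - b \<noteq> k + y"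
    using closed_ideal_if_dominated[OF I b] by blast
  define W0 where "W0 = {k + y + t *\<^sub>R (b - d *\<^sub>R e) | k y t. k \<in> positive \<and> y \<in> I \<and> star y = y \<and> t \<ge> 0}"
  \<comment> \<open>Passing to the preimage under \<open>x \<mapsto> x + x\<^sup>*\<close> makes every functional that is nonnegative on it invariant under the involution.\<close>
  define W where "W = {x. x + star x \<in> W0}"
  have W0_add: "x + x' \<in> W0" if "x \<in> W0" "x' \<in> W0" for x x'
  proof -
    obtain k y t k' y' t' where "x = k + y + t *\<^sub>R (b - d *\<^sub>R e)" "x' = k' + y' + t' *\<^sub>R (b - d *\<^sub>R e)"
      and *: "k \<in> positive" "y \<in> I" "star y = y" "t \<ge> 0" "k' \<in> positive" "y' \<in> I" "star y' = y'" "t' \<ge> 0"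
      using \<open>x \<in> W0\<close> \<open>x' \<in> W0\<close> unfolding W0_def by blast
    then have "x + x' = (k + k') + (y + y') + (t + t') *\<^sub>R (b - d *\<^sub>R e)"
      by (simp only: scaleR_add_left ac_simps)
    moreover have "k + k' \<in> positive" "y + y' \<in> I" "star (y + y') = y + y'" "t + t' \<ge> 0"
      using * id by (auto simp: star_simps intro: positive_add ideal_add)
    ultimately show ?thesis unfolding W0_def by blast
  qed
  have W0_scale: "r *\<^sub>R x \<in> W0" if "x \<in> W0" "r \<ge> 0" for x r
  proof -
    obtain k y t where "x = k + y + t *\<^sub>R (b - d *\<^sub>R e)"
      and *: "k \<in> positive" "y \<in> I" "star y = y" "t \<ge> 0"
      using \<open>x \<in> W0\<close> unfolding W0_def by blast
    then have "r *\<^sub>R x = r *\<^sub>R k + r *\<^sub>R y + (r * t) *\<^sub>R (b - d *\<^sub>R e)"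
      by (simp only: scaleR_add_right scaleR_scaleR)
    moreover have "r *\<^sub>R k \<in> positive" "r *\<^sub>R y \<in> I" "star (r *\<^sub>R y) = r *\<^sub>R y" "r * t \<ge> 0"
      using * id \<open>r \<ge> 0\<close> by (auto simp: star_simps intro: positive_scaleR ideal_scaleR)
    ultimately show ?thesis unfolding W0_def by blast
  qed
  have W0I: "k + y + t *\<^sub>R (b - d *\<^sub>R e) \<in> W0" if "k \<in> positive" "y \<in> I" "star y = y" "t \<ge> 0" for k y t
    unfolding W0_def using that by blast
  have pW0: "k \<in> W0" if "k \<in> positive" for k
    using W0I[OF that ideal_0[OF id] star_0, of 0] by simp
  have yW0: "y \<in> W0" if "y \<in> I" "star y = y" for y
    using W0I[OF positive_0 that, of 0] by simp
  have bW0: "b - d *\<^sub>R e \<in> W0"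
    using W0I[OF positive_0 ideal_0[OF id] star_0, of 1] by simp
  have eW0: "- e \<notin> W0"
  proof
    assume "- e \<in> W0"
    then obtain k y t where eq: "- e = k + y + t *\<^sub>R (b - d *\<^sub>R e)"
      and *: "k \<in> positive" "y \<in> I" "star y = y" "t \<ge> 0" unfolding W0_def by blast
    show False
    proof (cases "t = 0")
      case True
      then have "e + k = - y" using eq by (simp add: algebra_simps eq_neg_iff_add_eq_0 add_eq_0_iff)
      then have "e + k \<in> I" using * id ideal_minus by metis
      moreover obtain r where "r * (e + k) = e" using inverse_e_add_positive[OF *(1)] by blast
      ultimately have "e \<in> I" using id ideal_mult_left by metis
      then have "a * e \<in> I" using id ideal_mult_left by blast
      then show False using a by simp
    next
      case False
      then have t: "t > 0" using * by simp
      \<comment> \<open>Solved for \<open>d - b\<close>, the equation contradicts the choice of \<open>d\<close>.\<close>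
      have "t *\<^sub>R (d *\<^sub>R e - b) = e + (t *\<^sub>R (d *\<^sub>R e - b) + - e)" by simp
      also have "\<dots> = e + (t *\<^sub>R (d *\<^sub>R e - b) + (k + y + t *\<^sub>R (b - d *\<^sub>R e)))" by (simp only: eq)
      also have "\<dots> = e + k + y" by (simp add: algebra_simps)
      finally have "(1/t) *\<^sub>R t *\<^sub>R (d *\<^sub>R e - b) = (1/t) *\<^sub>R (e + k + y)" by (rule arg_cong)
      then have "d *\<^sub>R e - b = (1/t) *\<^sub>R (e + k) + (1/t) *\<^sub>R y" using t by (simp add: scaleR_add_right)
      moreover have "(1/t) *\<^sub>R (e + k) \<in> positive" "(1/t) *\<^sub>R y \<in> I" "star ((1/t) *\<^sub>R y) = (1/t) *\<^sub>R y"
        using * t by (auto simp: star_simps intro!: positive_scaleR positive_add positive_e ideal_scaleR[OF id])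
      ultimately show False using d(2) by blast
    qed
  qed
  have two: "2 *\<^sub>R x \<in> W0 \<longleftrightarrow> x \<in> W0" for x
    using W0_scale[of x 2] W0_scale[of "2 *\<^sub>R x" "1/2"] by auto
  have saW: "x \<in> W \<longleftrightarrow> x \<in> W0" if "star x = x" for x
    using two[of x] that by (simp add: W_def scaleR_2)
  have skewW: "x \<in> W" if "star x = - x" for x
    using that pW0[OF positive_0] by (simp add: W_def)
  have "\<exists>\<phi> :: 'a \<Rightarrow> real. linear \<phi> \<and> \<phi> e = 1 \<and> (\<forall>w\<in>W. 0 \<le> \<phi> w)"
  proof (rule order_unit_functional[of W e])
    show "x + y \<in> W" if "x \<in> W" "y \<in> W" for x y
      using that W0_add[of "x + star x" "y + star y"] by (simp add: W_def star_simps algebra_simps)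
    show "r *\<^sub>R x \<in> W" if "x \<in> W" "r \<ge> 0" for x r
      using that W0_scale[of "x + star x" r] by (simp add: W_def star_simps scaleR_add_right)
    show "e \<in> W" using saW pW0[OF positive_e] by simp
    show "- e \<notin> W" using saW[of "- e"] eW0 by (simp add: star_simps)
    fix h
    have "norm (h + star h) *\<^sub>R e - (h + star h) \<in> positive"
      by (intro positive_diff_norm) (auto simp: star_simps add.commute)
    then have "norm (h + star h) *\<^sub>R e - (h + star h) \<in> W0" by (rule pW0)
    moreover have "norm (h + star h) *\<^sub>R e - (h + star h)
      = (norm (h + star h) / 2) *\<^sub>R e - h + star ((norm (h + star h) / 2) *\<^sub>R e - h)"
      by (simp add: star_simps algebra_simps flip: scaleR_left_distrib)
    ultimately show "\<exists>s. s *\<^sub>R e - h \<in> W" unfolding W_def by auto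
  qed blast
  then obtain \<phi> :: "'a \<Rightarrow> real" where \<phi>: "linear \<phi>" "\<phi> e = 1" "\<And>w. w \<in> W \<Longrightarrow> 0 \<le> \<phi> w"
    by blast
  have zero: "\<phi> x = 0" if "x \<in> W" "- x \<in> W" for x
    using \<phi>(3)[OF that(1)] \<phi>(3)[OF that(2)] linear_neg[OF \<phi>(1)] by simp
  have "\<phi> (star x) = \<phi> x" for x
  proof -
    have "\<phi> (star x - x) = 0" by (intro zero skewW) (auto simp: star_simps)
    then show ?thesis using linear_diff[OF \<phi>(1)] by simp
  qed
  moreover have "0 \<le> \<phi> (star x * x)" for x
    using \<phi>(3) saW[of "star x * x"] pW0[OF star_mult_positive] by (simp add: star_simps)
  moreover have "\<phi> y = 0" if "y \<in> I" "star y = y" for y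
    using that saW[of y] saW[of "- y"] yW0[of y] yW0[of "- y"] id
    by (intro zero) (auto simp: star_simps intro: ideal_minus)
  ultimately have "\<phi> \<in> states_vanishing_on I"
    using linear_add[OF \<phi>(1)] linear_scale[OF \<phi>(1)] \<phi>(2) by (simp add: states_vanishing_on_def)
  moreover have "0 \<le> \<phi> (b - d *\<^sub>R e)" using \<phi>(3) saW[of "b - d *\<^sub>R e"] bW0 by (simp add: star_simps sb)
  then have "\<phi> b \<ge> d" using \<phi> linear_diff[OF \<phi>(1)] linear_scale[OF \<phi>(1)] by simp
  ultimately show ?thesis using that d(1) b_def by force
qed

lemma separating_pure_state:
  fixes a :: 'a
  assumes "I \<in> closed_ideals" "a \<notin> I"
  obtains \<phi> where "\<phi> \<in> states_vanishing_on I" "0 < \<phi> (star a * a)"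
    "\<And>\<psi> \<omega> t. \<lbrakk>\<psi> \<in> states_vanishing_on I; \<omega> \<in> states_vanishing_on I; 0 < t; t < 1;
       \<phi> = (\<lambda>x. t * \<psi> x + (1 - t) * \<omega> x)\<rbrakk> \<Longrightarrow> \<psi> = \<phi>"
proof -
  obtain \<phi>0 where \<phi>0: "\<phi>0 \<in> states_vanishing_on I" "0 < \<phi>0 (star a * a)"
    using separating_state[OF assms] by blast
  obtain \<phi> where \<phi>: "\<phi> \<in> states_vanishing_on I"
      "\<And>g. g \<in> states_vanishing_on I \<Longrightarrow> g (star a * a) \<le> \<phi> (star a * a)"
    and ext: "\<And>\<psi> \<omega> t. \<lbrakk>\<psi> \<in> states_vanishing_on I; \<omega> \<in> states_vanishing_on I; 0 < t; t < 1;
       \<phi> = (\<lambda>x. t * \<psi> x + (1 - t) * \<omega> x)\<rbrakk> \<Longrightarrow> \<psi> = \<phi>"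
    using extreme_point_maximizing[OF compact_states closed_states, of I "star a * a"] \<phi>0(1)
    by (metis (no_types, lifting) empty_iff)
  have "0 < \<phi> (star a * a)" using \<phi>(2)[OF \<phi>0(1)] \<phi>0(2) by linarith
  then show ?thesis using that[of \<phi>] \<phi>(1) ext by blast
qed

end

section \<open>Completion of semi-inner product spaces\<close>

text \<open>Minimise the right-hand side over \<open>t\<close>; for \<open>r = 0\<close> it is unbounded below unless \<open>Z = 0\<close>.\<close>

lemma quadratic_defect:
  fixes Z r q \<delta> :: real
  assumes "\<And>t. \<delta> \<le> q - 2 * t * Z + t\<^sup>2 * Z * r" "0 \<le> Z" "0 \<le> r"
  shows "Z \<le> r * (q - \<delta>)"
proof (cases "r = 0")
  case True
  have "Z = 0"
  proof (rule ccontr)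
    assume "Z \<noteq> 0"
    then have "2 * ((q - \<delta> + 1) / (2 * Z)) * Z = q - \<delta> + 1" by simp
    then show False using assms(1)[of "(q - \<delta> + 1) / (2 * Z)"] True by simp
  qed
  then show ?thesis using True by simp
next
  case False
  then have r: "r > 0" using assms(3) by simp
  have "\<delta> \<le> q - Z / r" using assms(1)[of "1 / r"] r by (simp add: power2_eq_square)
  then show ?thesis using r by (simp add: field_simps)
qed

locale semi_inner_product = vector_space scale
  for scale :: "complex \<Rightarrow> 'v::ab_group_add \<Rightarrow> 'v" +
  fixes V :: "'v set" and s :: "'v \<Rightarrow> 'v \<Rightarrow> complex"
  assumes subspace_V: "subspace V"
    and s_cnj: "\<lbrakk>x \<in> V; y \<in> V\<rbrakk> \<Longrightarrow> s x y = cnj (s y x)"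
    and s_add: "\<lbrakk>x \<in> V; y \<in> V; z \<in> V\<rbrakk> \<Longrightarrow> s x (y + z) = s x y + s x z"
    and s_scale: "\<lbrakk>x \<in> V; y \<in> V\<rbrakk> \<Longrightarrow> s x (scale c y) = c * s x y"
    and s_nonneg: "x \<in> V \<Longrightarrow> Re (s x x) \<ge> 0"
begin

definition nrm :: "'v \<Rightarrow> real" where
  "nrm x = sqrt (Re (s x x))"

lemma V_add: "\<lbrakk>x \<in> V; y \<in> V\<rbrakk> \<Longrightarrow> x + y \<in> V"
  and V_scale: "x \<in> V \<Longrightarrow> scale c x \<in> V" and V_diff: "\<lbrakk>x \<in> V; y \<in> V\<rbrakk> \<Longrightarrow> x - y \<in> V"
  using subspace_V by (auto simp: subspace_add subspace_scale subspace_diff)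

lemma s_add_left: "\<lbrakk>x \<in> V; y \<in> V; z \<in> V\<rbrakk> \<Longrightarrow> s (x + y) z = s x z + s y z"
  by (metis V_add complex_cnj_add s_add s_cnj)

lemma s_scale_left: "\<lbrakk>x \<in> V; y \<in> V\<rbrakk> \<Longrightarrow> s (scale c x) y = cnj c * s x y"
  by (metis V_scale complex_cnj_mult s_cnj s_scale)

lemma s_diff: "\<lbrakk>x \<in> V; y \<in> V; z \<in> V\<rbrakk> \<Longrightarrow> s x (y - z) = s x y - s x z"
  using s_add[of x "y - z" z] V_diff by simp

lemma s_diff_left: "\<lbrakk>x \<in> V; y \<in> V; z \<in> V\<rbrakk> \<Longrightarrow> s (x - y) z = s x z - s y z"
  using s_add_left[of "x - y" y z] V_diff by simp

lemma nrm_sq: "x \<in> V \<Longrightarrow> (nrm x)\<^sup>2 = Re (s x x)"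
  by (simp add: nrm_def s_nonneg)

lemma nrm_nonneg: "x \<in> V \<Longrightarrow> 0 \<le> nrm x"
  by (simp add: nrm_def s_nonneg)

text \<open>For \<open>\<delta> = 0\<close> this is the inequality of Cauchy and Schwarz. If \<open>\<delta>\<close> is the squared distance of a point from a
subspace through \<open>y\<close>, it says that the differences to near-optimal approximations are almost orthogonal to \<open>y\<close>.\<close>

lemma inner_sq_le:
  assumes y: "y \<in> V" and w: "w \<in> V" and \<delta>: "\<And>c. \<delta> \<le> (nrm (w - scale c y))\<^sup>2"
  shows "(cmod (s y w))\<^sup>2 \<le> (nrm y)\<^sup>2 * ((nrm w)\<^sup>2 - \<delta>)"
proof -
  define z where "z = s y w"
  have "\<delta> \<le> (nrm w)\<^sup>2 - 2 * t * (cmod z)\<^sup>2 + t\<^sup>2 * (cmod z)\<^sup>2 * (nrm y)\<^sup>2" for t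
  proof -
    define c where "c = of_real t * z"
    have zz: "z * cnj z = of_real ((cmod z)\<^sup>2)" by (rule complex_norm_square[symmetric])
    have cy: "scale c y \<in> V" using y by (rule V_scale)
    have wy: "s w y = cnj z" using s_cnj[OF w y] by (simp add: z_def)
    have "s (w - scale c y) (w - scale c y)
        = s w w - c * s w y - (cnj c * s y w - cnj c * (c * s y y))"
      using y w cy by (simp add: s_diff s_diff_left s_scale s_scale_left V_diff algebra_simps)
    also have "\<dots> = s w w - 2 * of_real t * (z * cnj z) + of_real (t\<^sup>2) * (z * cnj z) * s y y"
      unfolding wy z_def[symmetric] by (simp add: c_def algebra_simps power2_eq_square)
    finally have "Re (s (w - scale c y) (w - scale c y))
        = Re (s w w) - 2 * t * (cmod z)\<^sup>2 + t\<^sup>2 * (cmod z)\<^sup>2 * Re (s y y)"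
      unfolding zz by simp
    then show ?thesis using \<delta>[of c] y w cy by (simp add: nrm_sq V_diff)
  qed
  then show ?thesis unfolding z_def by (intro quadratic_defect) auto
qed

lemma cauchy_schwarz_semi:
  assumes "x \<in> V" "y \<in> V"
  shows "cmod (s x y) \<le> nrm x * nrm y"
proof -
  have "(cmod (s x y))\<^sup>2 \<le> (nrm x)\<^sup>2 * ((nrm y)\<^sup>2 - 0)"
    using assms by (intro inner_sq_le) auto
  then have "(cmod (s x y))\<^sup>2 \<le> (nrm x * nrm y)\<^sup>2" by (simp add: power_mult_distrib)
  then show ?thesis by (rule power2_le_imp_le) (simp add: nrm_nonneg assms)
qed

lemma nrm_triangle:
  assumes "x \<in> V" "y \<in> V"
  shows "nrm (x + y) \<le> nrm x + nrm y"
proof -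
  have "Re (s x y) \<le> nrm x * nrm y" "Re (s y x) \<le> nrm x * nrm y"
    using cauchy_schwarz_semi[of x y] cauchy_schwarz_semi[of y x] assms
      complex_Re_le_cmod[of "s x y"] complex_Re_le_cmod[of "s y x"] by (auto simp: mult.commute)
  then have "(nrm (x + y))\<^sup>2 \<le> (nrm x + nrm y)\<^sup>2"
    using assms by (simp add: nrm_sq V_add s_add s_add_left power2_sum)
  then show ?thesis by (rule power2_le_imp_le) (simp add: nrm_nonneg assms)
qed

lemma nrm_diff_triangle:
  assumes "x \<in> V" "y \<in> V" "z \<in> V"
  shows "nrm (x - z) \<le> nrm (x - y) + nrm (y - z)"
  using nrm_triangle[of "x - y" "y - z"] assms by (simp add: V_diff)

lemma nrm_minus_commute:
  assumes "x \<in> V" "y \<in> V"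
  shows "nrm (x - y) = nrm (y - x)"
  unfolding nrm_def using assms by (simp add: s_diff s_diff_left V_diff algebra_simps)

end

text \<open>The completion consists of the functions \<open>b \<mapsto> lim s b (a n)\<close> for Cauchy sequences \<open>a\<close>, that is, each point of the
completion is identified with the antilinear functional that it defines. Null sequences, and hence also the
vectors of length \<open>0\<close>, are divided out automatically, and the completion lives in the type of
functions that primitive ideals are defined with.\<close>

locale pre_hilbert = semi_inner_product scale UNIV s
  for scale :: "complex \<Rightarrow> 'v::ab_group_add \<Rightarrow> 'v" and s
begin

lemmas inner_simps = s_add[OF UNIV_I UNIV_I UNIV_I] s_add_left[OF UNIV_I UNIV_I UNIV_I]
  s_diff[OF UNIV_I UNIV_I UNIV_I] s_diff_left[OF UNIV_I UNIV_I UNIV_I]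
  s_scale[OF UNIV_I UNIV_I] s_scale_left[OF UNIV_I UNIV_I]

lemmas nrm_nonneg' = nrm_nonneg[OF UNIV_I]
lemmas cauchy_schwarz_pre = cauchy_schwarz_semi[OF UNIV_I UNIV_I]

lemma nrm_scale: "nrm (scale c x) = cmod c * nrm x"
proof -
  have "s (scale c x) (scale c x) = of_real ((cmod c)\<^sup>2) * s x x"
    using complex_norm_square[of c] by (simp add: inner_simps algebra_simps)
  then show ?thesis by (simp add: nrm_def real_sqrt_mult)
qed

definition cauchy_seq :: "(nat \<Rightarrow> 'v) \<Rightarrow> bool" where
  "cauchy_seq a \<longleftrightarrow> (\<forall>d>0. \<exists>N. \<forall>m\<ge>N. \<forall>n\<ge>N. nrm (a m - a n) < d)"

definition represents :: "(nat \<Rightarrow> 'v) \<Rightarrow> ('v \<Rightarrow> complex) \<Rightarrow> bool" where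
  "represents a u \<longleftrightarrow> cauchy_seq a \<and> (\<forall>b. (\<lambda>n. s b (a n)) \<longlonglongrightarrow> u b)"

definition completion :: "('v \<Rightarrow> complex) set" where
  "completion = {u. \<exists>a. represents a u}"

definition embed :: "'v \<Rightarrow> 'v \<Rightarrow> complex" where
  "embed x = (\<lambda>b. s b x)"

definition rep_of :: "('v \<Rightarrow> complex) \<Rightarrow> nat \<Rightarrow> 'v" where
  "rep_of u = (SOME a. represents a u)"

definition cip :: "('v \<Rightarrow> complex) \<Rightarrow> ('v \<Rightarrow> complex) \<Rightarrow> complex" where
  "cip u v = lim (\<lambda>n. s (rep_of u n) (rep_of v n))"

lemma represents_rep_of: "u \<in> completion \<Longrightarrow> represents (rep_of u) u"
  unfolding rep_of_def using someI_ex[of "\<lambda>a. represents a u"] by (simp add: completion_def)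

lemma representsD: "represents a u \<Longrightarrow> cauchy_seq a" "represents a u \<Longrightarrow> (\<lambda>n. s b (a n)) \<longlonglongrightarrow> u b"
  by (auto simp: represents_def)

lemma cauchy_bounded:
  assumes "cauchy_seq a"
  shows "\<exists>B>0. \<forall>n. nrm (a n) \<le> B"
proof -
  obtain N where N: "\<And>n. n \<ge> N \<Longrightarrow> nrm (a n - a N) < 1"
    using assms unfolding cauchy_seq_def by (meson le_refl zero_less_one)
  define B where "B = Max ((\<lambda>n. nrm (a n)) ` {..N}) + 1"
  have "nrm (a n) \<le> B" if "n \<le> N" for n
  proof -
    have "nrm (a n) \<le> Max ((\<lambda>n. nrm (a n)) ` {..N})" using that by (intro Max_ge) auto
    then show ?thesis by (simp add: B_def)
  qed
  moreover have "nrm (a n) \<le> B" if "n \<ge> N" for n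
  proof -
    have "nrm (a n) \<le> nrm (a n - a N) + nrm (a N)" using nrm_triangle[of "a n - a N" "a N"] by simp
    moreover have "nrm (a N) \<le> Max ((\<lambda>n. nrm (a n)) ` {..N})" by (intro Max_ge) auto
    ultimately show ?thesis using N[OF that] unfolding B_def by linarith
  qed
  ultimately have B: "nrm (a n) \<le> B" for n by (meson nle_le)
  have "nrm (a n) \<le> B + 1" for n using B[of n] by linarith
  moreover have "B + 1 > 0" using B[of 0] nrm_nonneg'[of "a 0"] by linarith
  ultimately show ?thesis by blast
qed

lemma cauchy_add:
  assumes "cauchy_seq a" "cauchy_seq c"
  shows "cauchy_seq (\<lambda>n. a n + c n)"
  unfolding cauchy_seq_def
proof (intro allI impI)
  fix d :: real assume "d > 0"
  then have d: "d / 2 > 0" by simp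
  obtain N1 where N1: "\<And>m n. m \<ge> N1 \<Longrightarrow> n \<ge> N1 \<Longrightarrow> nrm (a m - a n) < d / 2"
    using assms(1) d unfolding cauchy_seq_def by blast
  obtain N2 where N2: "\<And>m n. m \<ge> N2 \<Longrightarrow> n \<ge> N2 \<Longrightarrow> nrm (c m - c n) < d / 2"
    using assms(2) d unfolding cauchy_seq_def by blast
  have "nrm (a m + c m - (a n + c n)) < d" if "m \<ge> max N1 N2" "n \<ge> max N1 N2" for m n
  proof -
    have "nrm (a m + c m - (a n + c n)) \<le> nrm (a m - a n) + nrm (c m - c n)"
      using nrm_triangle[of "a m - a n" "c m - c n"] by (simp add: algebra_simps)
    then show ?thesis using N1[of m n] N2[of m n] that by simp
  qed
  then show "\<exists>N. \<forall>m\<ge>N. \<forall>n\<ge>N. nrm (a m + c m - (a n + c n)) < d" by blast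
qed

lemma cauchy_lipschitz:
  assumes "cauchy_seq a" "\<And>x y. nrm (f x - f y) \<le> K * nrm (x - y)"
  shows "cauchy_seq (\<lambda>n. f (a n))"
  unfolding cauchy_seq_def
proof (intro allI impI)
  fix d :: real assume d: "d > 0"
  then have "d / (\<bar>K\<bar> + 1) > 0" by (simp add: add_nonneg_pos)
  then obtain N where N: "\<And>m n. m \<ge> N \<Longrightarrow> n \<ge> N \<Longrightarrow> nrm (a m - a n) < d / (\<bar>K\<bar> + 1)"
    using assms(1) unfolding cauchy_seq_def by blast
  have "nrm (f (a m) - f (a n)) < d" if "m \<ge> N" "n \<ge> N" for m n
  proof -
    have "nrm (f (a m) - f (a n)) \<le> K * nrm (a m - a n)" by (rule assms)
    also have "\<dots> \<le> (\<bar>K\<bar> + 1) * nrm (a m - a n)" by (intro mult_right_mono nrm_nonneg') simp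
    also have "\<dots> < d" using N[OF that] by (simp add: field_simps add_nonneg_pos)
    finally show ?thesis .
  qed
  then show "\<exists>N. \<forall>m\<ge>N. \<forall>n\<ge>N. nrm (f (a m) - f (a n)) < d" by blast
qed

lemma cauchy_scale: "cauchy_seq a \<Longrightarrow> cauchy_seq (\<lambda>n. scale k (a n))"
  by (rule cauchy_lipschitz[of _ _ "cmod k"]) (simp_all add: nrm_scale scale_right_diff_distrib[symmetric])

lemma nrm_zero [simp]: "nrm 0 = 0"
  using nrm_scale[of 0 0] by simp

lemma cauchy_const: "cauchy_seq (\<lambda>n. x)"
  by (simp add: cauchy_seq_def)

lemma represents_exists:
  assumes "cauchy_seq a"
  obtains u where "represents a u"
proof -
  have "convergent (\<lambda>n. s b (a n))" for b
  proof (rule Cauchy_convergent, rule metric_CauchyI)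
    fix d :: real assume d: "d > 0"
    then have "d / (nrm b + 1) > 0" by (simp add: add_nonneg_pos nrm_nonneg')
    then obtain N where N: "\<And>m n. m \<ge> N \<Longrightarrow> n \<ge> N \<Longrightarrow> nrm (a m - a n) < d / (nrm b + 1)"
      using assms unfolding cauchy_seq_def by blast
    have "dist (s b (a m)) (s b (a n)) < d" if "m \<ge> N" "n \<ge> N" for m n
    proof -
      have "dist (s b (a m)) (s b (a n)) = cmod (s b (a m - a n))" by (simp add: dist_norm inner_simps)
      also have "\<dots> \<le> nrm b * nrm (a m - a n)" by (rule cauchy_schwarz_pre)
      also have "\<dots> \<le> (nrm b + 1) * nrm (a m - a n)" by (intro mult_right_mono nrm_nonneg') simp
      also have "\<dots> < d" using N[OF that] nrm_nonneg'[of b] by (simp add: field_simps add_nonneg_pos)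
      finally show ?thesis .
    qed
    then show "\<exists>N. \<forall>m\<ge>N. \<forall>n\<ge>N. dist (s b (a m)) (s b (a n)) < d" by blast
  qed
  then have "represents a (\<lambda>b. lim (\<lambda>n. s b (a n)))"
    using assms by (simp add: represents_def convergent_LIMSEQ_iff)
  then show ?thesis using that by blast
qed

lemma represents_add: "\<lbrakk>represents a u; represents c v\<rbrakk> \<Longrightarrow> represents (\<lambda>n. a n + c n) (u + v)"
  by (auto simp: represents_def inner_simps intro: cauchy_add tendsto_add)

lemma represents_scale: "represents a u \<Longrightarrow> represents (\<lambda>n. scale k (a n)) (fun_scale k u)"
  by (auto simp: represents_def inner_simps fun_scale_def intro: cauchy_scale tendsto_mult_left)

lemma represents_diff:
  assumes "represents a u" "represents c v"
  shows "represents (\<lambda>n. a n - c n) (u - v)"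
proof -
  have "fun_scale (- 1) v = - v" by (auto simp: fun_scale_def fun_eq_iff)
  then show ?thesis
    using represents_add[OF assms(1) represents_scale[OF assms(2), of "- 1"]] by simp
qed

lemma represents_embed: "represents (\<lambda>n. x) (embed x)"
  by (simp add: represents_def cauchy_const embed_def)

lemma embed_in: "embed x \<in> completion"
  using represents_embed completion_def by blast

lemma embed_diff: "embed (x - y) = embed x - embed y"
  by (simp add: embed_def fun_eq_iff inner_simps)

text \<open>A Cauchy sequence that tends to \<open>0\<close> weakly does so in norm: in
\<open>\<parallel>d n\<parallel>\<^sup>2 = \<langle>d n - d N, d n\<rangle> + \<langle>d N, d n\<rangle>\<close> the first term is small for large \<open>N\<close> by boundedness, and the second one
for large \<open>n\<close>.\<close>

lemma null_sequence:
  assumes d: "cauchy_seq d" and w: "\<And>b. (\<lambda>n. s b (d n)) \<longlonglongrightarrow> 0"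
  shows "(\<lambda>n. nrm (d n)) \<longlonglongrightarrow> 0"
proof (rule LIMSEQ_I)
  fix r :: real assume r: "r > 0"
  obtain B where B: "B > 0" "\<And>n. nrm (d n) \<le> B" using cauchy_bounded[OF d] by blast
  have "r\<^sup>2 / 2 / B > 0" using r B by simp
  then obtain N where N: "\<And>m n. m \<ge> N \<Longrightarrow> n \<ge> N \<Longrightarrow> nrm (d m - d n) < r\<^sup>2 / 2 / B"
    using d unfolding cauchy_seq_def by blast
  have "r\<^sup>2 / 2 > 0" using r by simp
  then obtain N' where N': "\<And>n. n \<ge> N' \<Longrightarrow> cmod (s (d N) (d n) - 0) < r\<^sup>2 / 2"
    using LIMSEQ_D[OF w[of "d N"]] by blast
  have "norm (nrm (d n) - 0) < r" if n: "n \<ge> max N N'" for n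
  proof -
    have "(nrm (d n))\<^sup>2 = Re (s (d n - d N) (d n)) + Re (s (d N) (d n))"
      by (simp add: nrm_sq inner_simps)
    also have "\<dots> \<le> nrm (d n - d N) * nrm (d n) + cmod (s (d N) (d n))"
      using cauchy_schwarz_pre[of "d n - d N" "d n"] complex_Re_le_cmod[of "s (d n - d N) (d n)"]
        complex_Re_le_cmod[of "s (d N) (d n)"] by linarith
    also have "\<dots> < r\<^sup>2 / 2 / B * B + r\<^sup>2 / 2"
    proof (rule add_le_less_mono)
      show "nrm (d n - d N) * nrm (d n) \<le> r\<^sup>2 / 2 / B * B"
        using N[of n N] n B nrm_nonneg' by (intro mult_mono) (auto intro: less_imp_le)
      show "cmod (s (d N) (d n)) < r\<^sup>2 / 2" using N'[of n] n by simp
    qed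
    also have "\<dots> = r\<^sup>2" using B by simp
    finally have "nrm (d n) < r" using r by (simp add: power2_less_imp_less)
    then show ?thesis using nrm_nonneg'[of "d n"] by simp
  qed
  then show "\<exists>no. \<forall>n\<ge>no. norm (nrm (d n) - 0) < r" by blast
qed

lemma inner_null:
  assumes "(\<lambda>n. nrm (d n)) \<longlonglongrightarrow> 0" "cauchy_seq c"
  shows "(\<lambda>n. s (d n) (c n)) \<longlonglongrightarrow> 0" "(\<lambda>n. s (c n) (d n)) \<longlonglongrightarrow> 0"
proof -
  obtain B where B: "B > 0" "\<And>n. nrm (c n) \<le> B" using cauchy_bounded[OF assms(2)] by blast
  have *: "(\<lambda>n. nrm (d n) * B) \<longlonglongrightarrow> 0" using tendsto_mult_right[OF assms(1), of B] by simp
  have le: "nrm (d n) * nrm (c n) \<le> nrm (d n) * B" for n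
    by (rule mult_left_mono[OF B(2) nrm_nonneg'])
  have "cmod (s (d n) (c n)) \<le> nrm (d n) * B" for n
    by (rule order_trans[OF cauchy_schwarz_pre le])
  then show "(\<lambda>n. s (d n) (c n)) \<longlonglongrightarrow> 0"
    by (intro Lim_null_comparison[OF _ *] always_eventually allI)
  have "cmod (s (c n) (d n)) \<le> nrm (d n) * B" for n
    using order_trans[OF cauchy_schwarz_pre[of "c n" "d n"]] le[of n] by (simp add: mult.commute)
  then show "(\<lambda>n. s (c n) (d n)) \<longlonglongrightarrow> 0"
    by (intro Lim_null_comparison[OF _ *] always_eventually allI)
qed

text \<open>The inner product was defined with one choice of representing sequences; all the others give the same limit because
two sequences representing the same point differ by a null sequence.\<close>

lemma tendsto_cip:
  assumes a: "represents a u" and c: "represents c v"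
  shows "(\<lambda>n. s (a n) (c n)) \<longlonglongrightarrow> cip u v"
proof -
  have diff: "(\<lambda>n. nrm (a n - a' n)) \<longlonglongrightarrow> 0" if "represents a u" "represents a' u" for a a' u
  proof (rule null_sequence)
    note rep = represents_diff[OF that]
    show "cauchy_seq (\<lambda>n. a n - a' n)" by (rule representsD(1)[OF rep])
    show "(\<lambda>n. s b (a n - a' n)) \<longlonglongrightarrow> 0" for b using representsD(2)[OF rep, of b] by simp
  qed
  define a' c' where "a' = rep_of u" and "c' = rep_of v"
  have a': "represents a' u" and c': "represents c' v"
    using a c represents_rep_of by (auto simp: a'_def c'_def completion_def)
  have "(\<lambda>n. s (a n - a' n) (c n) + s (a' n) (c n - c' n)) \<longlonglongrightarrow> 0 + 0"
    by (intro tendsto_add inner_null diff[OF a a'] diff[OF c c'] representsD(1)[OF c] representsD(1)[OF a'])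
  then have d: "(\<lambda>n. s (a n) (c n) - s (a' n) (c' n)) \<longlonglongrightarrow> 0"
    by (simp add: inner_simps)
  have "Cauchy (\<lambda>n. s (a' n) (c' n))"
  proof (rule metric_CauchyI)
    fix r :: real assume r: "r > 0"
    obtain B where B: "B > 0" "\<And>n. nrm (a' n) \<le> B" using cauchy_bounded[OF representsD(1)[OF a']] by blast
    obtain C where C: "C > 0" "\<And>n. nrm (c' n) \<le> C" using cauchy_bounded[OF representsD(1)[OF c']] by blast
    have "r / 2 / C > 0" "r / 2 / B > 0" using r B C by auto
    obtain N1 where N1: "\<And>m n. m \<ge> N1 \<Longrightarrow> n \<ge> N1 \<Longrightarrow> nrm (a' m - a' n) < r / 2 / C"
      using representsD(1)[OF a'] \<open>r / 2 / C > 0\<close> unfolding cauchy_seq_def by blast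
    obtain N2 where N2: "\<And>m n. m \<ge> N2 \<Longrightarrow> n \<ge> N2 \<Longrightarrow> nrm (c' m - c' n) < r / 2 / B"
      using representsD(1)[OF c'] \<open>r / 2 / B > 0\<close> unfolding cauchy_seq_def by blast
    have "dist (s (a' m) (c' m)) (s (a' n) (c' n)) < r" if "m \<ge> max N1 N2" "n \<ge> max N1 N2" for m n
    proof -
      have "s (a' m) (c' m) - s (a' n) (c' n) = s (a' m - a' n) (c' m) + s (a' n) (c' m - c' n)"
        by (simp add: inner_simps)
      then have "dist (s (a' m) (c' m)) (s (a' n) (c' n))
          \<le> cmod (s (a' m - a' n) (c' m)) + cmod (s (a' n) (c' m - c' n))"
        by (simp add: dist_norm norm_triangle_ineq)
      also have "\<dots> \<le> nrm (a' m - a' n) * nrm (c' m) + nrm (a' n) * nrm (c' m - c' n)"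
        by (intro add_mono cauchy_schwarz_pre)
      also have "\<dots> \<le> nrm (a' m - a' n) * C + B * nrm (c' m - c' n)"
        by (intro add_mono mult_left_mono mult_right_mono B C nrm_nonneg')
      also have "\<dots> < r / 2 / C * C + B * (r / 2 / B)"
        using N1[of m n] N2[of m n] that B C by (intro add_strict_mono mult_strict_right_mono mult_strict_left_mono) auto
      also have "\<dots> = r" using B C by simp
      finally show ?thesis .
    qed
    then show "\<exists>N. \<forall>m\<ge>N. \<forall>n\<ge>N. dist (s (a' m) (c' m)) (s (a' n) (c' n)) < r" by blast
  qed
  then have "(\<lambda>n. s (a' n) (c' n)) \<longlonglongrightarrow> cip u v"
    unfolding cip_def a'_def c'_def using Cauchy_convergent convergent_LIMSEQ_iff by blast
  from tendsto_add[OF d this] show ?thesis by simp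
qed

lemma completion_ex: "u \<in> completion \<Longrightarrow> \<exists>a. represents a u"
  by (simp add: completion_def)

lemma completion_antilinear:
  assumes "u \<in> completion"
  shows "u (x + y) = u x + u y" "u (scale k x) = cnj k * u x"
proof -
  obtain a where a: "represents a u" using completion_ex assms by blast
  have "(\<lambda>n. s (x + y) (a n)) \<longlonglongrightarrow> u x + u y"
    unfolding inner_simps by (intro tendsto_add representsD(2)[OF a])
  then show "u (x + y) = u x + u y" using representsD(2)[OF a] LIMSEQ_unique by blast
  have "(\<lambda>n. s (scale k x) (a n)) \<longlonglongrightarrow> cnj k * u x"
    unfolding inner_simps by (intro tendsto_mult_left representsD(2)[OF a])
  then show "u (scale k x) = cnj k * u x" using representsD(2)[OF a] LIMSEQ_unique by blast
qed

text \<open>The completion is a reproducing kernel space: point evaluations are inner products with embedded vectors.\<close>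

lemma cip_embed: "v \<in> completion \<Longrightarrow> cip (embed b) v = v b"
  using completion_ex tendsto_cip[OF represents_embed] representsD(2) LIMSEQ_unique by metis

lemma semi_inner_product_completion: "semi_inner_product fun_scale completion cip"
proof -
  interpret F: vector_space fun_scale by (rule vector_space_fun_scale)
  show ?thesis
  proof
    show "F.subspace completion"
    proof (rule F.subspaceI)
      show "0 \<in> completion" using embed_in[of 0] embed_diff[of 0 0] by simp
      show "u + v \<in> completion" if "u \<in> completion" "v \<in> completion" for u v
        using that represents_add unfolding completion_def by blast
      show "fun_scale k u \<in> completion" if "u \<in> completion" for u k
        using that represents_scale unfolding completion_def by blast
    qed
  next
    fix u v assume "u \<in> completion" "v \<in> completion"
    then obtain a c where a: "represents a u" and c: "represents c v" using completion_ex by blast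
    have eq: "s (a n) (c n) = cnj (s (c n) (a n))" for n by (rule s_cnj) auto
    show "cip u v = cnj (cip v u)"
      using tendsto_cnj[OF tendsto_cip[OF c a]] tendsto_cip[OF a c] LIMSEQ_unique unfolding eq by blast
    show "cip u (fun_scale k v) = k * cip u v" for k
    proof (rule LIMSEQ_unique[OF tendsto_cip[OF a represents_scale[OF c]]])
      show "(\<lambda>n. s (a n) (scale k (c n))) \<longlonglongrightarrow> k * cip u v"
        unfolding inner_simps by (intro tendsto_mult_left tendsto_cip[OF a c])
    qed
    fix w assume "w \<in> completion"
    then obtain d where d: "represents d w" using completion_ex by blast
    show "cip u (v + w) = cip u v + cip u w"
    proof (rule LIMSEQ_unique[OF tendsto_cip[OF a represents_add[OF c d]]])
      show "(\<lambda>n. s (a n) (c n + d n)) \<longlonglongrightarrow> cip u v + cip u w"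
        unfolding inner_simps by (intro tendsto_add tendsto_cip[OF a c] tendsto_cip[OF a d])
    qed
  next
    fix u assume "u \<in> completion"
    then obtain a where a: "represents a u" using completion_ex by blast
    show "Re (cip u u) \<ge> 0"
      by (rule LIMSEQ_le_const[OF tendsto_Re[OF tendsto_cip[OF a a]]]) (use s_nonneg in blast)
  qed
qed

interpretation C: semi_inner_product fun_scale completion cip
  by (rule semi_inner_product_completion)

lemma nrm_embed: "C.nrm (embed x) = nrm x"
  by (simp add: C.nrm_def nrm_def cip_embed embed_in) (simp add: embed_def)

lemma embed_dense:
  assumes a: "represents a u"
  shows "(\<lambda>n. C.nrm (u - embed (a n))) \<longlonglongrightarrow> 0"
proof (rule LIMSEQ_I)
  fix r :: real assume r: "r > 0"
  then have "r / 2 > 0" by simp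
  then obtain N where N: "\<And>m n. m \<ge> N \<Longrightarrow> n \<ge> N \<Longrightarrow> nrm (a m - a n) < r / 2"
    using representsD(1)[OF a] unfolding cauchy_seq_def by blast
  have "norm (C.nrm (u - embed (a n)) - 0) < r" if n: "n \<ge> N" for n
  proof -
    have rep: "represents (\<lambda>m. a m - a n) (u - embed (a n))"
      by (intro represents_diff a represents_embed)
    have "Re (cip (u - embed (a n)) (u - embed (a n))) \<le> (r / 2)\<^sup>2"
    proof (rule LIMSEQ_le_const2[OF tendsto_Re[OF tendsto_cip[OF rep rep]]])
      have "Re (s (a m - a n) (a m - a n)) \<le> (r / 2)\<^sup>2" if "m \<ge> N" for m
        using N[OF that n] nrm_nonneg'[of "a m - a n"] unfolding nrm_sq[OF UNIV_I, symmetric]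
        by (intro power_mono) auto
      then show "\<exists>N. \<forall>m\<ge>N. Re (s (a m - a n) (a m - a n)) \<le> (r / 2)\<^sup>2" by blast
    qed
    then have "C.nrm (u - embed (a n)) \<le> sqrt ((r / 2)\<^sup>2)" unfolding C.nrm_def by (rule real_sqrt_le_mono)
    then have "C.nrm (u - embed (a n)) \<le> r / 2" using r by (simp only: real_sqrt_abs)
    moreover have "u - embed (a n) \<in> completion" using rep completion_def by blast
    ultimately show ?thesis using C.nrm_nonneg r by fastforce
  qed
  then show "\<exists>no. \<forall>n\<ge>no. norm (C.nrm (u - embed (a n)) - 0) < r" by blast
qed

text \<open>A Cauchy sequence of points is replaced by embedded vectors \<open>c k\<close> at distances less than \<open>1 / (k + 1)\<close>, and these form a
Cauchy sequence of the original space.\<close>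

lemma completion_complete:
  assumes S: "\<And>k::nat. S k \<in> completion"
    and Cau: "\<And>d. d > 0 \<Longrightarrow> \<exists>N. \<forall>m\<ge>N. \<forall>n\<ge>N. C.nrm (S m - S n) < d"
  obtains u where "u \<in> completion" "(\<lambda>k. C.nrm (S k - u)) \<longlonglongrightarrow> 0"
proof -
  have "\<exists>x. C.nrm (S k - embed x) < inverse (real (Suc k))" for k
  proof -
    obtain a where a: "represents a (S k)" using completion_ex S by blast
    have "\<forall>\<^sub>F n in sequentially. C.nrm (S k - embed (a n)) < inverse (real (Suc k))"
      by (rule order_tendstoD(2)[OF embed_dense[OF a]]) simp
    then show ?thesis by (auto simp: eventually_sequentially)
  qed
  then obtain c where c: "\<And>k. C.nrm (S k - embed (c k)) < inverse (real (Suc k))" by metis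
  have small: "\<exists>N. \<forall>k\<ge>N. C.nrm (S k - embed (c k)) < d" if d: "d > 0" for d
  proof -
    obtain N where N: "inverse (real (Suc N)) < d" using reals_Archimedean[OF d] by blast
    have "C.nrm (S k - embed (c k)) < d" if "k \<ge> N" for k
    proof -
      have "inverse (real (Suc k)) \<le> inverse (real (Suc N))" using that by simp
      then show ?thesis using c[of k] N by linarith
    qed
    then show ?thesis by blast
  qed
  have "cauchy_seq c" unfolding cauchy_seq_def
  proof (intro allI impI)
    fix d :: real assume "d > 0"
    then have d: "d / 3 > 0" by simp
    obtain N1 where N1: "\<And>k. k \<ge> N1 \<Longrightarrow> C.nrm (S k - embed (c k)) < d / 3" using small[OF d] by blast
    obtain N2 where N2: "\<And>m n. m \<ge> N2 \<Longrightarrow> n \<ge> N2 \<Longrightarrow> C.nrm (S m - S n) < d / 3" using Cau[OF d] by blast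
    have "nrm (c m - c n) < d" if "m \<ge> max N1 N2" "n \<ge> max N1 N2" for m n
    proof -
      have "nrm (c m - c n) = C.nrm (embed (c m) - embed (c n))" by (simp add: nrm_embed[symmetric] embed_diff)
      also have "\<dots> \<le> C.nrm (embed (c m) - S m) + C.nrm (S m - embed (c n))"
        by (intro C.nrm_diff_triangle embed_in S)
      also have "\<dots> \<le> C.nrm (embed (c m) - S m) + (C.nrm (S m - S n) + C.nrm (S n - embed (c n)))"
        by (intro add_left_mono C.nrm_diff_triangle embed_in S)
      also have "C.nrm (embed (c m) - S m) = C.nrm (S m - embed (c m))"
        by (intro C.nrm_minus_commute embed_in S)
      finally have le: "nrm (c m - c n) \<le> C.nrm (S m - embed (c m))
          + (C.nrm (S m - S n) + C.nrm (S n - embed (c n)))" .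
      have mn: "m \<ge> N1" "n \<ge> N1" "m \<ge> N2" "n \<ge> N2" using that by auto
      show ?thesis using le N1[OF mn(1)] N1[OF mn(2)] N2[OF mn(3,4)] by linarith
    qed
    then show "\<exists>N. \<forall>m\<ge>N. \<forall>n\<ge>N. nrm (c m - c n) < d" by blast
  qed
  then obtain u where u: "represents c u" by (rule represents_exists)
  then have uC: "u \<in> completion" by (auto simp: completion_def)
  have "(\<lambda>k. C.nrm (S k - u)) \<longlonglongrightarrow> 0"
  proof (rule LIMSEQ_I)
    fix d :: real assume "d > 0"
    then have d: "d / 2 > 0" by simp
    obtain N1 where N1: "\<And>k. k \<ge> N1 \<Longrightarrow> C.nrm (S k - embed (c k)) < d / 2" using small[OF d] by blast
    obtain N2 where N2: "\<And>k. k \<ge> N2 \<Longrightarrow> norm (C.nrm (u - embed (c k)) - 0) < d / 2"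
      using LIMSEQ_D[OF embed_dense[OF u] d] by blast
    have "norm (C.nrm (S k - u) - 0) < d" if "k \<ge> max N1 N2" for k
    proof -
      have "C.nrm (S k - u) \<le> C.nrm (S k - embed (c k)) + C.nrm (embed (c k) - u)"
        by (intro C.nrm_diff_triangle embed_in S uC)
      also have "C.nrm (embed (c k) - u) = C.nrm (u - embed (c k))"
        by (intro C.nrm_minus_commute embed_in uC)
      finally have le: "C.nrm (S k - u) \<le> C.nrm (S k - embed (c k)) + C.nrm (u - embed (c k))" .
      have k: "k \<ge> N1" "k \<ge> N2" using that by auto
      show ?thesis using le N1[OF k(1)] N2[OF k(2)] C.nrm_nonneg[OF C.V_diff[OF S uC], of k]
        unfolding real_norm_def by linarith
    qed
    then show "\<exists>no. \<forall>k\<ge>no. norm (C.nrm (S k - u) - 0) < d" by blast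
  qed
  then show ?thesis using that uC by blast
qed

lemma complex_hilbert_completion: "complex_hilbert fun_scale completion cip"
proof
  show "C.subspace completion" by (rule C.subspace_V)
  show "cip x y = cnj (cip y x)" if "x \<in> completion" "y \<in> completion" for x y
    by (rule C.s_cnj[OF that])
  show "cip x (y + z) = cip x y + cip x z" if "x \<in> completion" "y \<in> completion" "z \<in> completion" for x y z
    by (rule C.s_add[OF that])
  show "cip x (fun_scale c y) = c * cip x y" if "x \<in> completion" "y \<in> completion" for x y c
    by (rule C.s_scale[OF that])
  show "0 \<le> Re (cip x x)" if "x \<in> completion" for x by (rule C.s_nonneg[OF that])
  show "u = 0" if u: "u \<in> completion" "cip u u = 0" for u
  proof
    fix b
    have "cmod (u b) \<le> C.nrm (embed b) * C.nrm u"
      using C.cauchy_schwarz_semi[OF embed_in[of b] u(1)] cip_embed[OF u(1)] by simp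
    then show "u b = 0 b" using u(2) by (simp add: C.nrm_def)
  qed
  fix S :: "nat \<Rightarrow> 'v \<Rightarrow> complex"
  assume S: "\<And>n. S n \<in> completion"
    and Cau: "\<And>d. d > 0 \<Longrightarrow> \<exists>N. \<forall>m\<ge>N. \<forall>n\<ge>N. sqrt (Re (cip (S m - S n) (S m - S n))) < d"
  obtain u where "u \<in> completion" "(\<lambda>k. C.nrm (S k - u)) \<longlonglongrightarrow> 0"
    using completion_complete[OF S Cau[folded C.nrm_def]] by blast
  then show "\<exists>x\<in>completion. (\<lambda>n. sqrt (Re (cip (S n - x) (S n - x)))) \<longlonglongrightarrow> 0"
    unfolding C.nrm_def by blast
qed

end

context complex_hilbert
begin

lemma semi_inner_product_H: "semi_inner_product scale H ip"
  by unfold_locales (use subspace_H ip_cnj ip_add ip_scale ip_nonneg in blast)+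

text \<open>A minimising sequence for the distance from \<open>x\<close> is Cauchy by the parallelogram law. The orthogonality relation holds
approximately along the sequence by \<open>inner_sq_le\<close>, and exactly in the limit.\<close>

lemma orthogonal_projection:
  assumes M: "closed_subspace M" and x: "x \<in> H"
  obtains m where "m \<in> M" "\<And>y. y \<in> M \<Longrightarrow> ip y (x - m) = 0"
proof -
  interpret S: semi_inner_product scale H ip by (rule semi_inner_product_H)
  have nrm: "S.nrm = hnorm" by (auto simp: S.nrm_def hnorm_def fun_eq_iff)
  have sM: "subspace M" and MH: "M \<subseteq> H" using M by (auto simp: closed_subspace_def)
  define D where "D = (\<lambda>y. (hnorm (x - y))\<^sup>2) ` M"
  define \<delta> where "\<delta> = Inf D"
  have bdd: "bdd_below D" unfolding D_def by (auto intro!: bdd_belowI[of _ 0])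
  have D0: "D \<noteq> {}" using subspace_0[OF sM] by (auto simp: D_def)
  have low: "\<delta> \<le> (hnorm (x - y))\<^sup>2" if "y \<in> M" for y
    unfolding \<delta>_def using that bdd by (intro cInf_lower) (auto simp: D_def)
  have "\<exists>y\<in>M. (hnorm (x - y))\<^sup>2 < \<delta> + inverse (real (Suc n))" for n
  proof -
    have "Inf D < \<delta> + inverse (real (Suc n))" by (simp add: \<delta>_def)
    then obtain z where "z \<in> D" "z < \<delta> + inverse (real (Suc n))" using cInf_lessD[OF D0] by blast
    then show ?thesis by (auto simp: D_def)
  qed
  then obtain y where y: "\<And>n. y n \<in> M" "\<And>n. (hnorm (x - y n))\<^sup>2 < \<delta> + inverse (real (Suc n))" by metis
  have yH: "y n \<in> H" for n using y(1) MH by blast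
  have par: "(hnorm (y m - y n))\<^sup>2 \<le> 2 * inverse (real (Suc m)) + 2 * inverse (real (Suc n))" for m n
  proof -
    define p q where "p = x - y m" and "q = x - y n"
    have pq: "p \<in> H" "q \<in> H" using x yH by (auto simp: p_def q_def H_diff)
    define c where "c = scale (1/2) (y m + y n)"
    have cM: "c \<in> M" unfolding c_def using sM y(1) by (intro subspace_scale subspace_add) auto
    have "y m - y n = q - p" by (simp add: p_def q_def)
    moreover have "x - c = scale (1/2) (p + q)"
    proof -
      have "p + q = scale 2 x - (y m + y n)"
        using scale_left_distrib[of 1 1 x] by (simp add: p_def q_def algebra_simps)
      then show ?thesis by (simp add: c_def scale_right_diff_distrib)
    qed
    moreover have "(hnorm (q - p))\<^sup>2 = 2 * (hnorm p)\<^sup>2 + 2 * (hnorm q)\<^sup>2 - 4 * (hnorm (scale (1/2) (p + q)))\<^sup>2"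
      using pq by (simp add: hnorm_sq H_diff H_add H_scale ip_add ip_add_left ip_diff ip_diff_left ip_scale ip_scale_left field_simps)
    moreover have "\<delta> \<le> (hnorm (x - c))\<^sup>2" by (rule low[OF cM])
    ultimately show ?thesis using y(2)[of m] y(2)[of n] by (simp add: p_def q_def)
  qed
  have "\<exists>m\<in>H. (\<lambda>n. sqrt (Re (ip (y n - m) (y n - m)))) \<longlonglongrightarrow> 0"
  proof (rule complete_H[OF yH])
    fix d :: real assume d: "d > 0"
    then obtain N where N: "inverse (real (Suc N)) < d\<^sup>2 / 4" using reals_Archimedean[of "d\<^sup>2 / 4"] by auto
    have "hnorm (y m - y n) < d" if "m \<ge> N" "n \<ge> N" for m n
    proof -
      have "inverse (real (Suc m)) \<le> inverse (real (Suc N))" "inverse (real (Suc n)) \<le> inverse (real (Suc N))"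
        using that by simp_all
      then have "(hnorm (y m - y n))\<^sup>2 < d\<^sup>2" using par[of m n] N by linarith
      then show ?thesis using d by (simp add: power2_less_imp_less)
    qed
    then show "\<exists>N. \<forall>m\<ge>N. \<forall>n\<ge>N. sqrt (Re (ip (y m - y n) (y m - y n))) < d"
      unfolding hnorm_def by blast
  qed
  then obtain m where m: "m \<in> H" "(\<lambda>n. hnorm (y n - m)) \<longlonglongrightarrow> 0" unfolding hnorm_def by blast
  then have mM: "m \<in> M" using M y(1) unfolding closed_subspace_def by blast
  have "ip z (x - m) = 0" if z: "z \<in> M" for z
  proof -
    have zH: "z \<in> H" using z MH by blast
    have "(\<lambda>n. ip z (x - y n)) \<longlonglongrightarrow> 0"
    proof (rule Lim_null_comparison)
      have "cmod (ip z (x - y n)) \<le> hnorm z * sqrt (inverse (real (Suc n)))" for n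
      proof -
        have "(cmod (ip z (x - y n)))\<^sup>2 \<le> (hnorm z)\<^sup>2 * ((hnorm (x - y n))\<^sup>2 - \<delta>)"
          unfolding nrm[symmetric]
        proof (rule S.inner_sq_le[OF zH H_diff[OF x yH]])
          fix c
          have "y n + scale c z \<in> M" using sM y(1) z by (intro subspace_add subspace_scale) auto
          from low[OF this] show "\<delta> \<le> (S.nrm (x - y n - scale c z))\<^sup>2" by (simp add: nrm diff_diff_eq)
        qed
        also have "\<dots> \<le> (hnorm z)\<^sup>2 * inverse (real (Suc n))"
          using y(2)[of n] by (intro mult_left_mono) auto
        also have "\<dots> = (hnorm z * sqrt (inverse (real (Suc n))))\<^sup>2" by (simp add: power_mult_distrib)
        finally show ?thesis
          by (rule power2_le_imp_le) (simp add: hnorm_def ip_nonneg zH)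
      qed
      then show "\<forall>\<^sub>F n in sequentially. cmod (ip z (x - y n)) \<le> hnorm z * sqrt (inverse (real (Suc n)))"
        by (intro always_eventually) blast
      have "(\<lambda>n. hnorm z * sqrt (inverse (real (Suc n)))) \<longlonglongrightarrow> hnorm z * sqrt 0"
        by (intro tendsto_intros LIMSEQ_inverse_real_of_nat)
      then show "(\<lambda>n. hnorm z * sqrt (inverse (real (Suc n)))) \<longlonglongrightarrow> 0" by simp
    qed
    moreover have "(\<lambda>n. ip z (y n - m)) \<longlonglongrightarrow> 0"
    proof (rule Lim_null_comparison)
      show "\<forall>\<^sub>F n in sequentially. cmod (ip z (y n - m)) \<le> hnorm z * hnorm (y n - m)"
        by (intro always_eventually allI cauchy_schwarz zH H_diff yH m)
      show "(\<lambda>n. hnorm z * hnorm (y n - m)) \<longlonglongrightarrow> 0" using tendsto_mult_left[OF m(2), of "hnorm z"] by simp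
    qed
    ultimately have "(\<lambda>n. ip z (x - y n) + ip z (y n - m)) \<longlonglongrightarrow> 0 + 0" by (rule tendsto_add)
    moreover have "ip z (x - y n) + ip z (y n - m) = ip z (x - m)" for n
      using zH x yH m by (simp add: ip_diff)
    ultimately have "(\<lambda>n::nat. ip z (x - m)) \<longlonglongrightarrow> 0" by simp
    then show ?thesis by (simp add: LIMSEQ_const_iff)
  qed
  then show ?thesis using that mM by blast
qed

end

section \<open>The GNS representation\<close>

locale gns = unital_cstar e for e :: "'a::cstar_algebra" +
  fixes \<phi> :: "'a \<Rightarrow> real" and I :: "'a set"
  assumes state: "\<phi> \<in> states_vanishing_on I" and ideal: "two_sided_ideal I"
begin

lemma phi_add: "\<phi> (a + b) = \<phi> a + \<phi> b" and phi_scaleR: "\<phi> (r *\<^sub>R a) = r * \<phi> a"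
  and phi_star: "\<phi> (star a) = \<phi> a" and phi_nonneg: "0 \<le> \<phi> (star a * a)" and phi_e: "\<phi> e = 1"
  and phi_ideal: "\<lbrakk>y \<in> I; star y = y\<rbrakk> \<Longrightarrow> \<phi> y = 0"
  using state by (auto simp: states_vanishing_on_def)

lemma phi_minus: "\<phi> (- a) = - \<phi> a"
  using phi_scaleR[of "-1" a] by simp

text \<open>The complex-linear functional with real part \<open>\<phi>\<close>.\<close>

definition functional :: "'a \<Rightarrow> complex" where
  "functional a = Complex (\<phi> a) (- \<phi> (scaleC \<i> a))"

lemma functional_add: "functional (a + b) = functional a + functional b"
  by (simp add: functional_def complex_eq_iff phi_add scaleC_add_right)

lemma functional_scaleC: "functional (scaleC c a) = c * functional a"
proof -
  have c: "c = of_real (Re c) + of_real (Im c) * \<i>" by (simp add: complex_eq mult.commute)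
  have 1: "scaleC c a = Re c *\<^sub>R a + Im c *\<^sub>R scaleC \<i> a"
    by (subst c) (simp only: scaleC_add_left scaleC_scaleC[symmetric] scaleC_of_real)
  have "scaleC \<i> (scaleC c a) = Re c *\<^sub>R scaleC \<i> a + Im c *\<^sub>R scaleC \<i> (scaleC \<i> a)"
    unfolding 1 by (simp add: scaleC_add_right scaleC_scaleR)
  also have "scaleC \<i> (scaleC \<i> a) = - a" by (simp add: scaleC_scaleC scaleC_minus_one)
  finally have "\<phi> (scaleC \<i> (scaleC c a)) = Re c * \<phi> (scaleC \<i> a) - Im c * \<phi> a"
    by (simp only: phi_add phi_scaleR phi_minus)
  moreover have "\<phi> (scaleC c a) = Re c * \<phi> a + Im c * \<phi> (scaleC \<i> a)"
    unfolding 1 by (simp add: phi_add phi_scaleR)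
  ultimately show ?thesis by (simp add: functional_def complex_eq_iff)
qed

lemma functional_star: "functional (star a) = cnj (functional a)"
proof -
  have "star (scaleC (- \<i>) a) = scaleC \<i> (star a)" by (simp add: star_simps)
  then have "\<phi> (scaleC \<i> (star a)) = \<phi> (scaleC (- \<i>) a)" using phi_star by metis
  also have "\<dots> = - \<phi> (scaleC \<i> a)" by (simp add: scaleC_minus_left phi_minus)
  finally show ?thesis by (simp add: functional_def complex_eq_iff phi_star)
qed

lemma Re_functional: "Re (functional a) = \<phi> a"
  by (simp add: functional_def)

definition form :: "'a \<Rightarrow> 'a \<Rightarrow> complex" where
  "form x y = functional (star x * y)"

lemma form_self: "Re (form x x) = \<phi> (star x * x)"
  by (simp add: form_def Re_functional)

sublocale G: pre_hilbert scaleC form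
proof
  show "scaleC a (x + y) = scaleC a x + scaleC a y" for a and x y :: 'a by (rule scaleC_add_right)
  show "scaleC (a + b) x = scaleC a x + scaleC b x" for a b and x :: 'a by (rule scaleC_add_left)
  show "scaleC a (scaleC b x) = scaleC (a * b) x" for a b and x :: 'a by (rule scaleC_scaleC)
  show "scaleC 1 x = x" for x :: 'a by (rule scaleC_1)
  show "module.subspace scaleC (UNIV :: 'a set)" by (rule module.subspace_UNIV[OF module_scaleC])
  show "form x y = cnj (form y x)" for x y
    by (simp add: form_def functional_star[symmetric] star_simps)
  show "form x (y + z) = form x y + form x z" for x y z
    by (simp add: form_def distrib_left functional_add)
  show "form x (scaleC c y) = c * form x y" for x y c
    by (simp add: form_def mult_scaleC_right functional_scaleC)
  show "Re (form x x) \<ge> 0" for x by (simp add: form_self phi_nonneg)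
qed

sublocale H: complex_hilbert fun_scale G.completion G.cip
  by (rule G.complex_hilbert_completion)

lemma form_mult_left: "form x (a * y) = form (star a * x) y"
  by (simp add: form_def star_simps mult.assoc)

text \<open>The element \<open>\<parallel>a\<parallel>\<^sup>2 - a\<^sup>* a\<close> is positive, and so is its conjugate by \<open>x\<close>.\<close>

lemma nrm_mult_le: "G.nrm (a * x) \<le> norm a * G.nrm x"
proof -
  have "(norm a)\<^sup>2 *\<^sub>R e - star a * a \<in> positive"
    by (intro positive_diff_norm) (auto simp: star_simps norm_star_mult)
  then have "0 \<le> \<phi> (star x * ((norm a)\<^sup>2 *\<^sub>R e - star a * a) * x)"
    by (intro state_positive[OF state] positive_conjugate)
  also have "star x * ((norm a)\<^sup>2 *\<^sub>R e - star a * a) * x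
      = (norm a)\<^sup>2 *\<^sub>R (star x * x) + - (star (a * x) * (a * x))"
    by (simp add: algebra_simps star_simps)
  also have "\<phi> \<dots> = (norm a)\<^sup>2 * \<phi> (star x * x) - \<phi> (star (a * x) * (a * x))"
    by (simp only: phi_add phi_scaleR phi_minus)
  finally have "(G.nrm (a * x))\<^sup>2 \<le> (norm a * G.nrm x)\<^sup>2"
    by (simp add: G.nrm_sq form_self power_mult_distrib)
  then show ?thesis by (rule power2_le_imp_le) (simp add: G.nrm_nonneg)
qed

text \<open>Left multiplication by \<open>a\<close> on the algebra, extended to the completion: since \<open>\<langle>b, a c\<rangle> = \<langle>a\<^sup>* b, c\<rangle>\<close>, it acts on functionals by
translation of the argument.\<close>

definition gns_rep :: "'a \<Rightarrow> ('a \<Rightarrow> complex) \<Rightarrow> 'a \<Rightarrow> complex" where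
  "gns_rep a u = (\<lambda>b. u (star a * b))"

lemma represents_gns_rep:
  assumes "G.represents c u"
  shows "G.represents (\<lambda>n. a * c n) (gns_rep a u)"
proof -
  have "G.cauchy_seq (\<lambda>n. a * c n)"
    using G.representsD(1)[OF assms]
    by (rule G.cauchy_lipschitz[of _ _ "norm a"]) (simp add: nrm_mult_le right_diff_distrib[symmetric])
  then show ?thesis
    using G.representsD(2)[OF assms] by (simp add: G.represents_def gns_rep_def form_mult_left)
qed

sublocale R: star_representation fun_scale G.completion G.cip gns_rep
proof
  fix u assume u: "u \<in> G.completion"
  then obtain c where c: "G.represents c u" using G.completion_ex by blast
  show "gns_rep a u \<in> G.completion" for a
    using represents_gns_rep[OF c] by (auto simp: G.completion_def)
  show "gns_rep a (fun_scale k u) = fun_scale k (gns_rep a u)" for a k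
    by (simp add: gns_rep_def fun_scale_def)
  show "gns_rep (a + b) u = gns_rep a u + gns_rep b u" for a b
    using G.completion_antilinear(1)[OF u] by (simp add: gns_rep_def fun_eq_iff star_simps distrib_right)
  show "gns_rep (scaleC k a) u = fun_scale k (gns_rep a u)" for k a
    using G.completion_antilinear(2)[OF u]
    by (simp add: gns_rep_def fun_eq_iff star_simps mult_scaleC_left fun_scale_def)
  show "gns_rep (a * b) u = gns_rep a (gns_rep b u)" for a b
    by (simp add: gns_rep_def star_simps mult.assoc)
  fix v assume v: "v \<in> G.completion"
  then obtain d where d: "G.represents d v" using G.completion_ex by blast
  show "gns_rep a (u + v) = gns_rep a u + gns_rep a v" for a
    by (simp add: gns_rep_def fun_eq_iff)
  show "G.cip (gns_rep (star a) u) v = G.cip u (gns_rep a v)" for a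
  proof (rule LIMSEQ_unique[OF G.tendsto_cip[OF represents_gns_rep[OF c] d]])
    have "form (star a * x) y = form x (a * y)" for x y by (rule form_mult_left[symmetric])
    then show "(\<lambda>n. form (star a * c n) (d n)) \<longlonglongrightarrow> G.cip u (gns_rep a v)"
      using G.tendsto_cip[OF c represents_gns_rep[OF d]] by simp
  qed
next
  fix a
  have "H.hnorm (gns_rep a u) \<le> norm a * H.hnorm u" if u: "u \<in> G.completion" for u
  proof -
    obtain c where c: "G.represents c u" using G.completion_ex[OF u] by blast
    have lim: "(\<lambda>n. G.nrm (c n)) \<longlonglongrightarrow> H.hnorm u" if "G.represents c u" for c u
      unfolding G.nrm_def H.hnorm_def by (intro tendsto_real_sqrt tendsto_Re G.tendsto_cip that)
    show ?thesis
      by (rule LIMSEQ_le[OF lim[OF represents_gns_rep[OF c]] tendsto_mult_left[OF lim[OF c]]])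
        (use nrm_mult_le in blast)
  qed
  then show "\<exists>K. \<forall>u\<in>G.completion. H.hnorm (gns_rep a u) \<le> K * H.hnorm u" by blast
qed

definition cyclic :: "'a \<Rightarrow> complex" where
  "cyclic = G.embed e"

lemma cyclic_in: "cyclic \<in> G.completion"
  by (simp add: cyclic_def G.embed_in)

lemma gns_rep_cyclic: "gns_rep a cyclic = G.embed a"
  by (simp add: gns_rep_def cyclic_def G.embed_def form_def star_simps)

lemma reproducing: "v \<in> G.completion \<Longrightarrow> G.cip (gns_rep b cyclic) v = v b"
  by (simp add: gns_rep_cyclic G.cip_embed)

lemma cyclic_apply: "cyclic b = functional (star b)"
  by (simp add: cyclic_def G.embed_def form_def)

lemma gns_rep_e: "gns_rep e u = u"
  by (simp add: gns_rep_def)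

lemma rep_star_left: "\<lbrakk>u \<in> G.completion; v \<in> G.completion\<rbrakk> \<Longrightarrow> G.cip (gns_rep a u) v = G.cip u (gns_rep (star a) v)"
  using R.rep_star[of u v "star a"] by (simp add: star_star)

text \<open>For \<open>z = y\<^sup>* b\<close> the self-adjoint element \<open>z\<^sup>* z\<close> lies in \<open>I\<close>, so \<open>z\<close> has length \<open>0\<close>, and
every point of the completion vanishes at \<open>z\<close>.\<close>

lemma ideal_in_kernel: "I \<subseteq> R.kernel"
proof
  fix y assume y: "y \<in> I"
  have "gns_rep y u b = 0" if "u \<in> G.completion" for u b
  proof -
    obtain c where c: "G.represents c u" using G.completion_ex \<open>u \<in> G.completion\<close> by blast
    define z where "z = star y * b"
    have "star b * (y * z) = star z * z" by (simp add: z_def star_simps mult.assoc)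
    moreover have "star b * (y * z) \<in> I" using ideal_mult_left[OF ideal] ideal_mult_right[OF ideal y] by blast
    ultimately have "\<phi> (star z * z) = 0" by (intro phi_ideal) (auto simp: star_simps)
    then have "G.nrm z = 0" by (simp add: G.nrm_def form_self)
    then have "form z (c n) = 0" for n using G.cauchy_schwarz_pre[of z "c n"] by simp
    then have "(\<lambda>n. 0) \<longlonglongrightarrow> u z" using G.representsD(2)[OF c, of z] by simp
    then show ?thesis using LIMSEQ_unique[OF tendsto_const] by (fastforce simp: gns_rep_def z_def)
  qed
  then show "y \<in> R.kernel" by (auto simp: R.kernel_def fun_eq_iff)
qed

lemma not_in_kernel:
  assumes "0 < \<phi> (star a * a)"
  shows "a \<notin> R.kernel"
proof
  assume "a \<in> R.kernel"
  then have "G.embed a a = 0" using cyclic_in gns_rep_cyclic[of a] by (auto simp: R.kernel_def)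
  then have "Re (form a a) = 0" by (simp add: G.embed_def)
  then show False using assms by (simp add: form_self)
qed

lemma vector_state:
  assumes \<eta>: "\<eta> \<in> G.completion" and \<mu>: "\<mu> = Re (G.cip \<eta> \<eta>)" "\<mu> > 0"
  shows "(\<lambda>a. Re (G.cip \<eta> (gns_rep a \<eta>)) / \<mu>) \<in> states_vanishing_on I"
  unfolding states_vanishing_on_def
proof (intro CollectI conjI allI ballI impI)
  note in_H = R.rep_in[OF \<eta>]
  show "Re (G.cip \<eta> (gns_rep (a + b) \<eta>)) / \<mu> = Re (G.cip \<eta> (gns_rep a \<eta>)) / \<mu> + Re (G.cip \<eta> (gns_rep b \<eta>)) / \<mu>" for a b
    by (simp add: R.rep_add[OF \<eta>] H.ip_add[OF \<eta> in_H in_H] add_divide_distrib del: plus_fun_apply)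
  show "Re (G.cip \<eta> (gns_rep (r *\<^sub>R a) \<eta>)) / \<mu> = r * (Re (G.cip \<eta> (gns_rep a \<eta>)) / \<mu>)" for r a
    unfolding scaleC_of_real[symmetric] R.rep_scaleC[OF \<eta>] H.ip_scale[OF \<eta> in_H] by simp
  show "Re (G.cip \<eta> (gns_rep (star a) \<eta>)) / \<mu> = Re (G.cip \<eta> (gns_rep a \<eta>)) / \<mu>" for a
  proof -
    have "G.cip \<eta> (gns_rep (star a) \<eta>) = G.cip (gns_rep a \<eta>) \<eta>" using rep_star_left[OF \<eta> \<eta>] by simp
    also have "\<dots> = cnj (G.cip \<eta> (gns_rep a \<eta>))" by (rule H.ip_cnj[OF in_H \<eta>])
    finally show ?thesis by simp
  qed
  show "0 \<le> Re (G.cip \<eta> (gns_rep (star a * a) \<eta>)) / \<mu>" for a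
  proof -
    have "G.cip \<eta> (gns_rep (star a * a) \<eta>) = G.cip (gns_rep a \<eta>) (gns_rep a \<eta>)"
      using rep_star_left[OF \<eta> in_H[of a], of a] by (simp add: R.rep_mult[OF \<eta>])
    then show ?thesis using H.ip_nonneg[OF in_H] \<mu>(2) by simp
  qed
  show "Re (G.cip \<eta> (gns_rep e \<eta>)) / \<mu> = 1" using \<mu> by (simp add: gns_rep_e)
  fix y assume "y \<in> I"
  then have "gns_rep y \<eta> = 0" using ideal_in_kernel \<eta> by (auto simp: R.kernel_def)
  then show "Re (G.cip \<eta> (gns_rep y \<eta>)) / \<mu> = 0" by (simp only: H.ip_0[OF \<eta>]) simp
qed

text \<open>Let \<open>M\<close> be a closed invariant subspace and split the cyclic vector \<open>\<xi> = p + q\<close> along \<open>M\<close>. If \<open>p\<close> or \<open>q\<close> vanishes, then \<open>M\<close> is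
trivial, because \<open>\<xi>\<close> is cyclic. Otherwise \<open>\<phi>\<close> is the convex combination of the vector states of \<open>p\<close> and \<open>q\<close>
with the weights \<open>t = \<parallel>p\<parallel>\<^sup>2\<close> and \<open>1 - t\<close>. Since \<open>\<phi>\<close> is extreme, the vector state of \<open>p\<close> is \<open>\<phi>\<close>, which forces
\<open>p = t \<xi>\<close>. Then \<open>q = (1 - t) \<xi>\<close> is not orthogonal to \<open>p\<close>.\<close>

lemma irreducible_if_pure:
  assumes pure: "\<And>\<psi> \<omega> t. \<lbrakk>\<psi> \<in> states_vanishing_on I; \<omega> \<in> states_vanishing_on I; 0 < t; t < 1;
       \<phi> = (\<lambda>x. t * \<psi> x + (1 - t) * \<omega> x)\<rbrakk> \<Longrightarrow> \<psi> = \<phi>"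
  shows "irreducible_star_representation fun_scale G.completion G.cip gns_rep"
proof
  have Fe: "functional e = 1"
    using functional_star[of e] Re_functional[of e] by (simp add: complex_eq_iff phi_e)
  show "\<exists>a. \<exists>x\<in>G.completion. gns_rep a x \<noteq> 0"
  proof (intro exI bexI)
    show "gns_rep e cyclic \<noteq> 0"
      using cyclic_apply[of e] Fe by (auto simp: gns_rep_e)
  qed (rule cyclic_in)
  fix M
  assume M: "H.closed_subspace M" and inv: "\<And>a x. x \<in> M \<Longrightarrow> gns_rep a x \<in> M"
  have sM: "H.subspace M" and MH: "M \<subseteq> G.completion" using M by (auto simp: H.closed_subspace_def)
  obtain p where p: "p \<in> M" and orth: "\<And>y. y \<in> M \<Longrightarrow> G.cip y (cyclic - p) = 0"
    using H.orthogonal_projection[OF M cyclic_in] by blast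
  define q where "q = cyclic - p"
  have pH: "p \<in> G.completion" using p MH by blast
  have qH: "q \<in> G.completion" unfolding q_def by (rule H.H_diff[OF cyclic_in pH])
  have cpq: "cyclic = p + q" by (simp add: q_def)
  have yq: "G.cip y q = 0" if "y \<in> M" for y using orth[OF that] by (simp add: q_def)
  have qy: "G.cip q y = 0" if "y \<in> M" for y
    using H.ip_cnj[OF qH, of y] yq[OF that] that MH by auto
  show "M = {0} \<or> M = G.completion"
  proof (cases "p = 0 \<or> q = 0")
    case True
    then show ?thesis
    proof
      assume "p = 0"
      then have q: "q = cyclic" by (simp add: q_def)
      have "v = 0" if v: "v \<in> M" for v
      proof
        fix b
        have vH: "v \<in> G.completion" using v MH by blast
        have "v b = G.cip (gns_rep b cyclic) v" by (simp add: reproducing vH)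
        also have "\<dots> = G.cip q (gns_rep (star b) v)" unfolding q by (rule rep_star_left[OF cyclic_in vH])
        also have "\<dots> = 0" by (rule qy[OF inv[OF v]])
        finally show "v b = 0 b" by simp
      qed
      then show ?thesis using H.subspace_0[OF sM] by blast
    next
      assume "q = 0"
      then have "cyclic \<in> M" using p by (simp add: q_def)
      then have emb: "G.embed b \<in> M" for b using inv gns_rep_cyclic by metis
      have "v \<in> M" if v: "v \<in> G.completion" for v
      proof -
        obtain c where c: "G.represents c v" using G.completion_ex v by blast
        have "(\<lambda>n. H.hnorm (v - G.embed (c n))) \<longlonglongrightarrow> 0"
          using G.embed_dense[OF c] unfolding H.hnorm_def
            semi_inner_product.nrm_def[OF G.semi_inner_product_completion] .
        moreover have "H.hnorm (v - G.embed b) = H.hnorm (G.embed b - v)" for b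
          using semi_inner_product.nrm_minus_commute[OF H.semi_inner_product_H v G.embed_in]
          unfolding H.hnorm_def semi_inner_product.nrm_def[OF H.semi_inner_product_H] .
        ultimately have "(\<lambda>n. H.hnorm (G.embed (c n) - v)) \<longlonglongrightarrow> 0" by (simp only:)
        then show ?thesis using M emb v unfolding H.closed_subspace_def
          by (elim conjE) (erule allE[of _ "\<lambda>n. G.embed (c n)"], erule allE[of _ v], simp)
      qed
      then show ?thesis using MH by blast
    qed
  next
    case False
    define t where "t = Re (G.cip p p)"
    define t' where "t' = Re (G.cip q q)"
    have pos: "Re (G.cip u u) > 0" if u: "u \<in> G.completion" "u \<noteq> 0" for u
    proof -
      have "Re (G.cip u u) \<noteq> 0"
        using H.ip_definite[OF u(1)] H.ip_self_real[OF u(1)] u(2) by auto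
      then show ?thesis using H.ip_nonneg[OF u(1)] by simp
    qed
    have t: "t > 0" and t': "t' > 0" using pos pH qH False by (auto simp: t_def t'_def)
    have decomp: "\<phi> a = Re (G.cip p (gns_rep a p)) + Re (G.cip q (gns_rep a q))" for a
    proof -
      have ap: "gns_rep a p \<in> G.completion" and aq: "gns_rep a q \<in> G.completion"
        by (rule R.rep_in[OF pH], rule R.rep_in[OF qH])
      have "functional a = G.embed a e" by (simp add: G.embed_def form_def)
      also have "\<dots> = G.cip cyclic (gns_rep a cyclic)"
        unfolding gns_rep_cyclic unfolding cyclic_def by (rule G.cip_embed[OF G.embed_in, symmetric])
      also have "gns_rep a cyclic = gns_rep a p + gns_rep a q"
        unfolding cpq by (rule R.rep_add_vec[OF pH qH])
      also have "G.cip cyclic (gns_rep a p + gns_rep a q)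
          = G.cip p (gns_rep a p) + G.cip p (gns_rep a q) + (G.cip q (gns_rep a p) + G.cip q (gns_rep a q))"
        unfolding cpq H.ip_add_left[OF pH qH H.H_add[OF ap aq]] H.ip_add[OF pH ap aq] H.ip_add[OF qH ap aq] ..
      also have "G.cip q (gns_rep a p) = 0" by (rule qy[OF inv[OF p]])
      also have "G.cip p (gns_rep a q) = 0"
        using rep_star_left[OF pH qH, of "star a"] yq[OF inv[OF p]] by (simp add: star_star)
      finally show ?thesis using Re_functional[of a] by simp
    qed
    have tt: "t' = 1 - t" using decomp[of e] by (simp add: gns_rep_e phi_e t_def t'_def)
    have "(\<lambda>a. Re (G.cip p (gns_rep a p)) / t) = \<phi>"
    proof (rule pure[of _ "\<lambda>a. Re (G.cip q (gns_rep a q)) / t'" t])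
      show "(\<lambda>a. Re (G.cip p (gns_rep a p)) / t) \<in> states_vanishing_on I"
        using vector_state[OF pH t_def t] .
      show "(\<lambda>a. Re (G.cip q (gns_rep a q)) / t') \<in> states_vanishing_on I"
        using vector_state[OF qH t'_def t'] .
      show "0 < t" "t < 1" using t t' tt by auto
      show "\<phi> = (\<lambda>x. t * (Re (G.cip p (gns_rep x p)) / t) + (1 - t) * (Re (G.cip q (gns_rep x q)) / t'))"
        using t t' unfolding tt[symmetric] by (simp add: fun_eq_iff decomp)
    qed
    then have re: "Re (G.cip p (gns_rep a p)) = t * \<phi> a" for a
      using t by (auto simp: fun_eq_iff field_simps)
    have "G.cip p (gns_rep a p) = of_real t * functional a" for a
    proof -
      have "G.cip p (gns_rep (scaleC \<i> a) p) = \<i> * G.cip p (gns_rep a p)"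
        unfolding R.rep_scaleC[OF pH] by (rule H.ip_scale[OF pH R.rep_in[OF pH]])
      then have "- Im (G.cip p (gns_rep a p)) = t * \<phi> (scaleC \<i> a)" using re[of "scaleC \<i> a"] by simp
      then show ?thesis using re[of a] by (simp add: complex_eq_iff functional_def)
    qed
    then have "p b = of_real t * cyclic b" for b
    proof -
      have "p b = G.cip (p + q) (gns_rep (star b) p)"
        using reproducing[OF pH, of b] rep_star_left[OF cyclic_in pH, of b] cpq by simp
      also have "\<dots> = G.cip p (gns_rep (star b) p) + G.cip q (gns_rep (star b) p)"
        by (rule H.ip_add_left[OF pH qH R.rep_in[OF pH]])
      also have "G.cip q (gns_rep (star b) p) = 0" by (rule qy[OF inv[OF p]])
      finally show ?thesis using \<open>\<And>a. G.cip p (gns_rep a p) = of_real t * functional a\<close> cyclic_apply by simp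
    qed
    then have pc: "p = fun_scale (of_real t) cyclic" by (simp add: fun_scale_def fun_eq_iff)
    have "q = fun_scale (of_real t') cyclic"
      unfolding q_def by (subst pc) (simp add: fun_scale_def fun_eq_iff tt algebra_simps)
    then have "G.cip q p = cnj (of_real t') * (of_real t * G.cip cyclic cyclic)"
      using pc H.ip_scale_left[OF cyclic_in H.H_scale[OF cyclic_in]] H.ip_scale[OF cyclic_in cyclic_in] by metis
    moreover have "G.cip cyclic cyclic = 1"
      using reproducing[OF cyclic_in, of e] cyclic_apply[of e] Fe by (simp add: gns_rep_e)
    ultimately have False using qy[OF p] t t' by simp
    then show ?thesis ..
  qed
qed

end

context unital_cstar
begin

text \<open>The primitive ideal is the kernel of the GNS representation of a separating pure state.\<close>

theorem closed_ideal_separated_by_primitive: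
  fixes a :: 'a
  assumes I: "I \<in> closed_ideals" and a: "a \<notin> I"
  obtains P where "P \<in> primitive_ideals" "I \<subseteq> P" "a \<notin> P"
proof -
  obtain \<phi> where \<phi>: "\<phi> \<in> states_vanishing_on I" "0 < \<phi> (star a * a)"
    and pure: "\<And>\<psi> \<omega> t. \<lbrakk>\<psi> \<in> states_vanishing_on I; \<omega> \<in> states_vanishing_on I; 0 < t; t < 1;
       \<phi> = (\<lambda>x. t * \<psi> x + (1 - t) * \<omega> x)\<rbrakk> \<Longrightarrow> \<psi> = \<phi>"
    using separating_pure_state[OF assms] by blast
  interpret gns e \<phi> I
    by unfold_locales (use \<phi> I closed_ideals_iff in blast)+
  have "irreducible_star_representation fun_scale G.completion G.cip gns_rep"
    by (rule irreducible_if_pure[OF pure])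
  then have "R.kernel \<in> primitive_ideals" unfolding primitive_ideals_def by blast
  then show ?thesis using that ideal_in_kernel not_in_kernel[OF \<phi>(2)] by blast
qed

end

section \<open>Primitive ideals are closed and prime\<close>

context star_representation
begin

lemma hnorm_zero_iff: "x \<in> H \<Longrightarrow> hnorm x = 0 \<longleftrightarrow> x = 0"
  using ip_definite[of x] ip_self_real[of x] ip_0[OF H_0] by (auto simp: hnorm_def)

lemma rep_zero_vec: "\<pi> a 0 = 0"
  using rep_scale_vec[OF H_0, of a 0] by simp

lemma rep_diff: "x \<in> H \<Longrightarrow> \<pi> (a - b) x = \<pi> a x - \<pi> b x"
  using rep_add[of x "a - b" b] by simp

lemma rep_diff_vec: "\<lbrakk>x \<in> H; y \<in> H\<rbrakk> \<Longrightarrow> \<pi> a (x - y) = \<pi> a x - \<pi> a y"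
  using rep_add_vec[of "x - y" y a] H_diff by simp

lemma hnorm_nonneg: "x \<in> H \<Longrightarrow> 0 \<le> hnorm x"
  by (simp add: hnorm_def ip_nonneg)

lemma hnorm_rep_sq: "x \<in> H \<Longrightarrow> (hnorm (\<pi> a x))\<^sup>2 = Re (ip x (\<pi> (star a * a) x))"
  using rep_star[of x "\<pi> a x" "star a"] by (simp add: hnorm_sq rep_in rep_mult star_star)

text \<open>Automatic continuity: with \<open>p\<^sup>2 = \<parallel>a\<parallel>\<^sup>2 - a\<^sup>* a\<close>, the number
\<open>\<parallel>a\<parallel>\<^sup>2 \<langle>x, \<pi> e x\<rangle> - \<parallel>\<pi> a x\<parallel>\<^sup>2 = \<parallel>\<pi> p x\<parallel>\<^sup>2\<close> is nonnegative. The operator \<open>\<pi> e\<close> is a projection, possibly not the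
identity, so \<open>\<langle>x, \<pi> e x\<rangle> \<le> \<parallel>x\<parallel>\<^sup>2\<close>.\<close>

lemma rep_contractive:
  assumes "unital_cstar (e::'a)" and x: "x \<in> H"
  shows "hnorm (\<pi> a x) \<le> norm a * hnorm x"
proof -
  interpret unital_cstar e by fact
  have e: "(hnorm (\<pi> e x))\<^sup>2 \<le> hnorm x * hnorm (\<pi> e x)"
    using hnorm_rep_sq[OF x, of e] cauchy_schwarz[OF x rep_in[OF x, of e]]
      complex_Re_le_cmod[of "ip x (\<pi> e x)"] by simp
  have "hnorm (\<pi> e x) \<le> hnorm x"
  proof (cases "hnorm (\<pi> e x) = 0")
    case False
    then show ?thesis using e hnorm_nonneg[OF rep_in[OF x, of e]] by (simp add: power2_eq_square)
  qed (simp add: hnorm_nonneg[OF x])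
  then have "hnorm x * hnorm (\<pi> e x) \<le> hnorm x * hnorm x"
    by (intro mult_left_mono hnorm_nonneg x)
  then have e2: "Re (ip x (\<pi> e x)) \<le> (hnorm x)\<^sup>2"
    using e hnorm_rep_sq[OF x, of e] by (simp add: power2_eq_square)
  have "(norm a)\<^sup>2 *\<^sub>R e - star a * a \<in> positive"
    by (intro positive_diff_norm) (auto simp: star_simps norm_star_mult)
  then obtain p where p: "p \<in> positive" "p * p = (norm a)\<^sup>2 *\<^sub>R e - star a * a"
    using positive_sqrt by blast
  then have "0 \<le> Re (ip x (\<pi> ((norm a)\<^sup>2 *\<^sub>R e - star a * a) x))"
    using hnorm_rep_sq[OF x, of p] positive_star[OF p(1)] by (metis zero_le_power2)
  also have "\<pi> ((norm a)\<^sup>2 *\<^sub>R e - star a * a) x = scale (of_real ((norm a)\<^sup>2)) (\<pi> e x) - \<pi> (star a * a) x"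
    by (simp only: rep_diff[OF x] scaleC_of_real[symmetric] rep_scaleC[OF x])
  also have "ip x \<dots> = of_real ((norm a)\<^sup>2) * ip x (\<pi> e x) - ip x (\<pi> (star a * a) x)"
    by (simp only: ip_diff[OF x H_scale[OF rep_in[OF x]] rep_in[OF x]] ip_scale[OF x rep_in[OF x]])
  finally have "(hnorm (\<pi> a x))\<^sup>2 \<le> (norm a)\<^sup>2 * Re (ip x (\<pi> e x))"
    by (simp add: hnorm_rep_sq[OF x] del: of_real_power)
  also have "\<dots> \<le> (norm a * hnorm x)\<^sup>2"
    using e2 by (simp add: power_mult_distrib mult_left_mono)
  finally show ?thesis by (rule power2_le_imp_le) (simp add: hnorm_nonneg x)
qed

lemma kernel_closed_ideal:
  assumes "unital_cstar (e::'a)"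
  shows "kernel \<in> closed_ideals"
  unfolding closed_ideals_iff
proof
  show "two_sided_ideal kernel"
    by (rule two_sided_idealI)
      (auto simp: kernel_def rep_add rep_scaleC rep_mult rep_zero_vec rep_in
        rep_diff[of _ 0 0, simplified])
  show "closed kernel" unfolding closed_sequential_limits
  proof (intro allI impI, elim conjE)
    fix s a assume s: "\<forall>n. s n \<in> kernel" and lim: "s \<longlonglongrightarrow> a"
    have "\<pi> a x = 0" if x: "x \<in> H" for x
    proof -
      have "hnorm (\<pi> a x) \<le> norm (a - s n) * hnorm x" for n
      proof -
        have "\<pi> (a - s n) x = \<pi> a x" using s x by (simp add: rep_diff[OF x] kernel_def)
        then show ?thesis using rep_contractive[OF assms x, of "a - s n"] by simp
      qed
      moreover have "(\<lambda>n. norm (a - s n) * hnorm x) \<longlonglongrightarrow> norm (a - a) * hnorm x"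
        by (intro tendsto_intros lim)
      ultimately have "hnorm (\<pi> a x) \<le> 0" by (intro LIMSEQ_le_const) auto
      then have "hnorm (\<pi> a x) = 0" using hnorm_nonneg[OF rep_in[OF x, of a]] by simp
      then show ?thesis using hnorm_zero_iff[OF rep_in[OF x]] by simp
    qed
    then show "a \<in> kernel" by (simp add: kernel_def)
  qed
qed

end

context irreducible_star_representation
begin

text \<open>The vectors annihilated by \<open>I\<close> form a closed invariant subspace. It contains the image of \<open>J\<close>, so that it is
nonzero unless \<open>J\<close> lies in the kernel; by irreducibility it is then the whole space.\<close>

lemma kernel_prime:
  assumes I: "two_sided_ideal I" and J: "two_sided_ideal J" and IJ: "I \<inter> J \<subseteq> kernel"
  shows "I \<subseteq> kernel \<or> J \<subseteq> kernel"
proof (rule ccontr)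
  assume "\<not> (I \<subseteq> kernel \<or> J \<subseteq> kernel)"
  then obtain a y b x where a: "a \<in> I" "y \<in> H" "\<pi> a y \<noteq> 0" and b: "b \<in> J" "x \<in> H" "\<pi> b x \<noteq> 0"
    by (auto simp: kernel_def)
  define M where "M = {v\<in>H. \<forall>a\<in>I. \<pi> a v = 0}"
  have "closed_subspace M" unfolding closed_subspace_def
  proof (intro conjI allI impI)
    show "subspace M"
      by (rule subspaceI) (auto simp: M_def H_0 H_add H_scale rep_zero_vec rep_add_vec rep_scale_vec)
    show "M \<subseteq> H" by (auto simp: M_def)
    fix s v assume "(\<forall>n. s n \<in> M) \<and> v \<in> H \<and> (\<lambda>n. hnorm (s n - v)) \<longlonglongrightarrow> 0"
    then have s: "\<And>n. s n \<in> M" and v: "v \<in> H" and lim: "(\<lambda>n. hnorm (s n - v)) \<longlonglongrightarrow> 0" by auto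
    show "v \<in> M"
    proof -
      have "\<pi> c v = 0" if c: "c \<in> I" for c
      proof -
        obtain K where K: "\<And>x. x \<in> H \<Longrightarrow> hnorm (\<pi> c x) \<le> K * hnorm x" using rep_bounded by blast
        have sH: "s n \<in> H" and s0: "\<pi> c (s n) = 0" for n using s c by (auto simp: M_def)
        have "hnorm (\<pi> c v) \<le> K * hnorm (s n - v)" for n
        proof -
          have "\<pi> c (s n - v) = scale (- 1) (\<pi> c v)" using s0 by (simp add: rep_diff_vec[OF sH v])
          then have "hnorm (\<pi> c (s n - v)) = hnorm (\<pi> c v)"
            using rep_in[OF v, of c] by (simp only: hnorm_def ip_scale ip_scale_left H_scale) simp
          then show ?thesis using K[OF H_diff[OF sH v], of n] by simp
        qed
        moreover have "(\<lambda>n. K * hnorm (s n - v)) \<longlonglongrightarrow> K * 0" by (intro tendsto_mult_left lim)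
        ultimately have "hnorm (\<pi> c v) \<le> 0" by (intro LIMSEQ_le_const) auto
        then have "hnorm (\<pi> c v) = 0" using hnorm_nonneg[OF rep_in[OF v, of c]] by simp
        then show ?thesis using hnorm_zero_iff[OF rep_in[OF v]] by simp
      qed
      then show ?thesis using v by (simp add: M_def)
    qed
  qed
  moreover have "\<pi> c v \<in> M" if "v \<in> M" for c v
    using that ideal_mult_right[OF I] by (auto simp: M_def rep_in rep_mult[symmetric])
  ultimately have "M = {0} \<or> M = H" by (rule irreducible)
  moreover have "\<pi> b x \<in> M"
  proof -
    have "\<pi> c (\<pi> b x) = 0" if "c \<in> I" for c
    proof -
      have "c * b \<in> kernel" using ideal_mult_right[OF I that] ideal_mult_left[OF J b(1)] IJ by blast
      then show ?thesis using b(2) by (simp add: kernel_def rep_mult)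
    qed
    then show ?thesis using b(2) by (simp add: M_def rep_in)
  qed
  ultimately show False using a b(3) by (auto simp: M_def)
qed

end

section \<open>The Jacobson topology of a unital algebra\<close>

context unital_cstar
begin

lemma primitive_ideal_props:
  fixes P :: "'a set"
  assumes "P \<in> primitive_ideals"
  shows primitive_closed_ideal: "P \<in> closed_ideals" and primitive_proper: "P \<noteq> UNIV"
    and primitive_prime: "\<lbrakk>two_sided_ideal I; two_sided_ideal J; I \<inter> J \<subseteq> P\<rbrakk> \<Longrightarrow> I \<subseteq> P \<or> J \<subseteq> P"
proof -
  obtain H :: "('a \<Rightarrow> complex) set" and ip \<pi> where P: "P = star_representation.kernel H \<pi>"
    and irr: "irreducible_star_representation fun_scale H ip \<pi>"
    using assms unfolding primitive_ideals_def by blast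
  interpret irreducible_star_representation fun_scale H ip \<pi> by fact
  show "P \<in> closed_ideals" unfolding P by (rule kernel_closed_ideal) (rule unital_cstar_axioms)
  show "P \<noteq> UNIV" using rep_nonzero unfolding P kernel_def by blast
  show "\<lbrakk>two_sided_ideal I; two_sided_ideal J; I \<inter> J \<subseteq> P\<rbrakk> \<Longrightarrow> I \<subseteq> P \<or> J \<subseteq> P"
    unfolding P by (rule kernel_prime)
qed

text \<open>Finite unions of hulls are hulls because primitive ideals are prime. The intersection of the hulls of a family is the hull
of the smallest closed ideal above the family, because primitive ideals are closed.\<close>

lemma istopology_jacobson:
  "istopology (\<lambda>U. \<exists>I\<in>closed_ideals. U = primitive_ideals - ideal_hull (I :: 'a set))"
  unfolding istopology_def
proof (intro conjI allI impI)
  fix S T :: "'a set set"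
  assume "\<exists>I\<in>closed_ideals. S = primitive_ideals - ideal_hull I"
    and "\<exists>I\<in>closed_ideals. T = primitive_ideals - ideal_hull I"
  then obtain I J where IJ: "I \<in> closed_ideals" "J \<in> closed_ideals"
    and ST: "S = primitive_ideals - ideal_hull I" "T = primitive_ideals - ideal_hull J" by blast
  have "ideal_hull (I \<inter> J) = ideal_hull I \<union> ideal_hull J"
    using primitive_prime[of _ I J] IJ by (auto simp: ideal_hull_def closed_ideals_iff)
  moreover have "I \<inter> J \<in> closed_ideals" using Inter_closed_ideals[of "{I, J}"] IJ by simp
  ultimately show "\<exists>I\<in>closed_ideals. S \<inter> T = primitive_ideals - ideal_hull I"
    using ST by blast
next
  fix K :: "'a set set set"
  assume "\<forall>U\<in>K. \<exists>I\<in>closed_ideals. U = primitive_ideals - ideal_hull I"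
  then obtain f where f: "\<And>U. U \<in> K \<Longrightarrow> f U \<in> closed_ideals"
    "\<And>U. U \<in> K \<Longrightarrow> U = primitive_ideals - ideal_hull (f U)" by metis
  define J where "J = \<Inter>{L\<in>closed_ideals. \<forall>U\<in>K. f U \<subseteq> L}"
  have J: "J \<in> closed_ideals" unfolding J_def by (rule Inter_closed_ideals) blast
  have "P \<in> ideal_hull J \<longleftrightarrow> (\<forall>U\<in>K. P \<in> ideal_hull (f U))" if P: "P \<in> primitive_ideals" for P
    using primitive_closed_ideal[OF P] P unfolding J_def ideal_hull_def by blast
  then have "\<Union>K = primitive_ideals - ideal_hull J" using f(2) by blast
  then show "\<exists>I\<in>closed_ideals. \<Union>K = primitive_ideals - ideal_hull I" using J by blast
qed

lemma openin_jacobson: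
  "openin jacobson_topology U \<longleftrightarrow> (\<exists>I\<in>closed_ideals. U = primitive_ideals - ideal_hull (I :: 'a set))"
  unfolding jacobson_topology_def topology_inverse'[OF istopology_jacobson] ..

lemma topspace_jacobson: "topspace jacobson_topology = (primitive_ideals :: 'a set set)"
proof
  show "topspace jacobson_topology \<subseteq> (primitive_ideals :: 'a set set)"
    unfolding topspace_def using openin_jacobson by blast
  have "(UNIV :: 'a set) \<in> closed_ideals" using Inter_closed_ideals[of "{}"] by simp
  moreover have "ideal_hull (UNIV :: 'a set) = {}" using primitive_proper by (auto simp: ideal_hull_def)
  ultimately have "openin jacobson_topology (primitive_ideals :: 'a set set)"
    unfolding openin_jacobson by (metis Diff_empty)
  then show "(primitive_ideals :: 'a set set) \<subseteq> topspace jacobson_topology" by (rule openin_subset)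
qed

lemma ideal_hull_subset: "ideal_hull I \<subseteq> primitive_ideals"
  by (auto simp: ideal_hull_def)

lemma closedin_jacobson:
  "closedin jacobson_topology C \<longleftrightarrow> (\<exists>I\<in>closed_ideals. C = ideal_hull (I :: 'a set))"
proof
  assume "closedin jacobson_topology C"
  then obtain I where "I \<in> closed_ideals" "primitive_ideals - C = primitive_ideals - ideal_hull I"
    and "C \<subseteq> primitive_ideals"
    by (auto simp: closedin_def topspace_jacobson openin_jacobson)
  then show "\<exists>I\<in>closed_ideals. C = ideal_hull I" using ideal_hull_subset by blast
next
  assume "\<exists>I\<in>closed_ideals. C = ideal_hull I"
  then show "closedin jacobson_topology C"
    using ideal_hull_subset by (auto simp: closedin_def topspace_jacobson openin_jacobson)
qed

text \<open>The set \<open>V\<close> below is the sum of the ideals of a family whose hulls have no point in common, described as the union of the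
ideals generated by finite subfamilies. Its closure lies in no primitive ideal, hence contains the unit. An element
of \<open>V\<close> near the unit is left invertible, so that \<open>V\<close> itself contains the unit.\<close>

theorem compact_space_jacobson: "compact_space (jacobson_topology :: 'a set topology)"
  unfolding compact_space_def compactin_def topspace_jacobson
proof (intro conjI allI impI, simp, elim conjE)
  fix \<U> :: "'a set set set"
  assume op: "\<forall>U\<in>\<U>. openin jacobson_topology U" and cover: "primitive_ideals \<subseteq> \<Union>\<U>"
  then obtain f where f: "\<And>U. U \<in> \<U> \<Longrightarrow> f U \<in> closed_ideals"
    "\<And>U. U \<in> \<U> \<Longrightarrow> U = primitive_ideals - ideal_hull (f U)" unfolding openin_jacobson by metis
  have mem: "P \<in> U \<longleftrightarrow> \<not> f U \<subseteq> P" if "U \<in> \<U>" "P \<in> primitive_ideals" for U P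
    by (subst f(2)[OF that(1)]) (simp add: ideal_hull_def that(2))
  define above where "above \<F> L \<longleftrightarrow> two_sided_ideal L \<and> (\<forall>U\<in>\<F>. f U \<subseteq> L)" for \<F> and L :: "'a set"
  define V where "V = {x. \<exists>\<F>. finite \<F> \<and> \<F> \<subseteq> \<U> \<and> (\<forall>L. above \<F> L \<longrightarrow> x \<in> L)}"
  have VI: "x \<in> V" if "finite \<F>" "\<F> \<subseteq> \<U>" "\<And>L. above \<F> L \<Longrightarrow> x \<in> L" for x \<F>
    unfolding V_def using that by blast
  have V: "two_sided_ideal V"
  proof (rule two_sided_idealI)
    show "0 \<in> V" by (rule VI[of "{}"]) (simp_all add: above_def ideal_0)
    fix x assume "x \<in> V"
    then obtain \<F> where \<F>: "finite \<F>" "\<F> \<subseteq> \<U>" "\<forall>L. above \<F> L \<longrightarrow> x \<in> L" unfolding V_def by blast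
    have id: "two_sided_ideal L" "x \<in> L" if "above \<F> L" for L
      using that \<F>(3) by (auto simp: above_def)
    show "scaleC c x \<in> V" for c by (rule VI[OF \<F>(1,2) ideal_scaleC[OF id]])
    show "a * x \<in> V" for a by (rule VI[OF \<F>(1,2) ideal_mult_left[OF id]])
    show "x * a \<in> V" for a by (rule VI[OF \<F>(1,2) ideal_mult_right[OF id]])
    fix y assume "y \<in> V"
    then obtain \<G> where \<G>: "finite \<G>" "\<G> \<subseteq> \<U>" "\<forall>L. above \<G> L \<longrightarrow> y \<in> L" unfolding V_def by blast
    show "x + y \<in> V"
    proof (rule VI)
      show "finite (\<F> \<union> \<G>)" "\<F> \<union> \<G> \<subseteq> \<U>" using \<F> \<G> by auto
      fix L assume "above (\<F> \<union> \<G>) L"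
      then have "above \<F> L" "above \<G> L" by (auto simp: above_def)
      then show "x + y \<in> L" using ideal_add[OF id(1)] \<F>(3) \<G>(3) by blast
    qed
  qed
  have fV: "f U \<subseteq> V" if "U \<in> \<U>" for U
  proof
    show "x \<in> V" if "x \<in> f U" for x
      by (rule VI[of "{U}"]) (use \<open>U \<in> \<U>\<close> that in \<open>auto simp: above_def\<close>)
  qed
  have "e \<in> V"
  proof (rule ccontr)
    assume e: "e \<notin> V"
    have "e \<notin> closure V"
    proof
      assume "e \<in> closure V"
      then obtain v where v: "v \<in> V" "norm (e - v) < 1"
        unfolding closure_approachable by (metis dist_norm norm_minus_commute zero_less_one)
      then obtain c where "c * v = e" using left_inverse_near_e by blast
      then show False using e ideal_mult_left[OF V v(1)] by metis
    qed
    then obtain P where P: "P \<in> primitive_ideals" "closure V \<subseteq> P"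
      using closed_ideal_separated_by_primitive[OF closure_ideal[OF V]] by blast
    then obtain U where "U \<in> \<U>" "P \<in> U" using cover by blast
    then show False using mem P fV closure_subset[of V] by blast
  qed
  then obtain \<F> where \<F>: "finite \<F>" "\<F> \<subseteq> \<U>"
    "\<forall>L. above \<F> L \<longrightarrow> e \<in> L" unfolding V_def by blast
  have "P \<in> \<Union>\<F>" if P: "P \<in> primitive_ideals" for P
  proof (rule ccontr)
    assume "P \<notin> \<Union>\<F>"
    then have "\<forall>U\<in>\<F>. f U \<subseteq> P" using mem \<F>(2) P by blast
    moreover have id: "two_sided_ideal P" using primitive_closed_ideal[OF P] closed_ideals_iff by blast
    ultimately have "e \<in> P" using \<F>(3) by (simp add: above_def)
    then have "x \<in> P" for x using ideal_mult_left[OF id, of e x] by simp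
    then show False using primitive_proper[OF P] by blast
  qed
  then show "\<exists>\<F>. finite \<F> \<and> \<F> \<subseteq> \<U> \<and> primitive_ideals \<subseteq> \<Union>\<F>" using \<F>(1,2) by blast
qed

text \<open>The point \<open>P\<close> is closed, so it is the hull of some ideal, and \<open>ideal_hull P\<close> is the smallest hull that
contains \<open>P\<close>.\<close>

lemma hull_primitive:
  fixes P :: "'a set"
  assumes H: "Hausdorff_space (jacobson_topology :: 'a set topology)" and P: "P \<in> primitive_ideals"
  shows "ideal_hull P = {P}"
proof -
  have "closedin jacobson_topology {P}"
    using H P by (simp add: closedin_Hausdorff_singleton topspace_jacobson)
  then obtain I where "{P} = ideal_hull I" unfolding closedin_jacobson by blast
  then show ?thesis using P unfolding ideal_hull_def by blast
qed

lemma closed_ideal_eq_Inter_hull: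
  fixes I :: "'a set"
  assumes I: "I \<in> closed_ideals"
  shows "I = \<Inter>(ideal_hull I)"
  using closed_ideal_separated_by_primitive[OF I] unfolding ideal_hull_def by blast

end

section \<open>The Fell topology on primitive ideals\<close>

lemma openin_fell_basic:
  assumes "compactin X K" "finite F" "\<And>A. A \<in> F \<Longrightarrow> openin X A \<and> A \<noteq> {}"
  shows "openin (fell_topology X) (fell_basic X K F)"
  unfolding fell_topology_def using assms by (intro topology_generated_by_Basis) blast

text \<open>The preimage of a basic set \<open>U(K, F)\<close> consists of the points outside \<open>K\<close> that lie in all members of \<open>F\<close>, and \<open>K\<close> is closed
as a compact subset of a Hausdorff space.\<close>

lemma continuous_map_singleton_fell:
  assumes H: "Hausdorff_space X"
  shows "continuous_map X (fell_topology X) (\<lambda>x. {x})"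
  unfolding fell_topology_def
proof (rule continuous_on_generated_topo)
  fix U
  assume "U \<in> {fell_basic X K F | K F. compactin X K \<and> finite F \<and> (\<forall>A\<in>F. openin X A \<and> A \<noteq> {})}"
  then obtain K F where U: "U = fell_basic X K F" and K: "compactin X K" and F: "finite F" "\<forall>A\<in>F. openin X A" by blast
  have "(\<lambda>x. {x}) -` U \<inter> topspace X = (topspace X - K) \<inter> ((\<Inter>A\<in>F. A) \<inter> topspace X)"
    using closedin_Hausdorff_singleton[OF H] unfolding U fell_basic_def by auto
  moreover have "openin X (topspace X - K)"
    using compactin_imp_closedin[OF H K] by (simp add: openin_diff)
  moreover have "openin X ((\<Inter>A\<in>F. A) \<inter> topspace X)"
    using F by (cases "F = {}") (auto intro!: openin_Int openin_Inter)
  ultimately show "openin X ((\<lambda>x. {x}) -` U \<inter> topspace X)" by (simp add: openin_Int)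
next
  have "{x} \<in> fell_basic X {} {}" if "x \<in> topspace X" for x
    using closedin_Hausdorff_singleton[OF H that] by (simp add: fell_basic_def)
  moreover have "fell_basic X {} {} \<in> {fell_basic X K F | K F. compactin X K \<and> finite F \<and> (\<forall>A\<in>F. openin X A \<and> A \<noteq> {})}"
    by blast
  ultimately show "(\<lambda>x. {x}) ` topspace X
      \<subseteq> \<Union>{fell_basic X K F | K F. compactin X K \<and> finite F \<and> (\<forall>A\<in>F. openin X A \<and> A \<noteq> {})}"
    by blast
qed

context unital_cstar
begin

context
  assumes H: "Hausdorff_space (jacobson_topology :: 'a set topology)"
begin

lemma subtopology_fell_ideal: "subtopology fell_ideal_topology primitive_ideals = (jacobson_topology :: 'a set topology)"
  unfolding topology_eq
proof (intro allI iffI)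
  fix S :: "'a set set"
  assume "openin (subtopology fell_ideal_topology primitive_ideals) S"
  then obtain U where U: "openin (fell_topology (jacobson_topology :: 'a set topology)) U"
    and S: "S = ideal_hull -` U \<inter> closed_ideals \<inter> primitive_ideals"
    unfolding openin_subtopology fell_ideal_topology_def openin_pullback_topology by blast
  have "S = {P \<in> topspace jacobson_topology. {P} \<in> U}"
    unfolding S topspace_jacobson using hull_primitive[OF H] primitive_closed_ideal by auto
  then show "openin jacobson_topology S"
    using openin_continuous_map_preimage[OF continuous_map_singleton_fell[OF H] U] by simp
next
  fix S :: "'a set set"
  assume S: "openin jacobson_topology S"
  have SP: "S \<subseteq> primitive_ideals" using openin_subset[OF S] topspace_jacobson by simp
  show "openin (subtopology fell_ideal_topology primitive_ideals) S"
  proof (cases "S = {}")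
    case False
    \<comment> \<open>A singleton meets \<open>S\<close> exactly if its element lies in \<open>S\<close>.\<close>
    define W where "W = ideal_hull -` fell_basic jacobson_topology {} {S} \<inter> closed_ideals"
    have "openin fell_ideal_topology W"
      unfolding fell_ideal_topology_def openin_pullback_topology W_def
      using openin_fell_basic[of jacobson_topology "{}" "{S}"] S False by auto
    moreover have "closedin jacobson_topology {P}" if "P \<in> primitive_ideals" for P :: "'a set"
      using that H by (simp add: closedin_Hausdorff_singleton topspace_jacobson)
    then have "S = W \<inter> primitive_ideals"
      using SP hull_primitive[OF H] primitive_closed_ideal
      unfolding W_def fell_basic_def by auto
    ultimately show ?thesis unfolding openin_subtopology by blast
  qed simp
qed

lemma primitive_subset_topspace: "(primitive_ideals :: 'a set set) \<subseteq> topspace fell_ideal_topology"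
  using arg_cong[OF subtopology_fell_ideal, of topspace] by (auto simp: topspace_jacobson)

lemma compactin_primitive: "compactin fell_ideal_topology (primitive_ideals :: 'a set set)"
  unfolding compactin_subspace subtopology_fell_ideal
  using primitive_subset_topspace compact_space_jacobson by blast

text \<open>A closed ideal that is not primitive has a hull with two points, or with none: a single point \<open>P\<close> would give
\<open>I = \<Inter>(ideal_hull I) = P\<close>. In both cases a basic Fell neighbourhood of the hull contains no singleton of a primitive ideal.\<close>

lemma closedin_primitive: "closedin fell_ideal_topology (primitive_ideals :: 'a set set)"
  unfolding closedin_def
proof (intro conjI primitive_subset_topspace)
  show "openin fell_ideal_topology (topspace fell_ideal_topology - (primitive_ideals :: 'a set set))"
  proof (subst openin_subopen, intro ballI)
    fix I :: "'a set" assume I: "I \<in> topspace fell_ideal_topology - primitive_ideals"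
    then have Ic: "I \<in> closed_ideals" by (auto simp: fell_ideal_topology_def topspace_pullback_topology)
    have nbh: "\<exists>W. openin fell_ideal_topology W \<and> I \<in> W \<and> W \<subseteq> topspace fell_ideal_topology - primitive_ideals"
      if U: "openin (fell_topology jacobson_topology) U" "ideal_hull I \<in> U" and nU: "\<And>P. P \<in> primitive_ideals \<Longrightarrow> {P} \<notin> U"
      for U :: "'a set set set"
    proof -
      define W where "W = ideal_hull -` U \<inter> closed_ideals"
      have W: "openin fell_ideal_topology W"
        unfolding fell_ideal_topology_def openin_pullback_topology W_def using U(1) by blast
      moreover have "I \<in> W" using U(2) Ic by (simp add: W_def)
      moreover have "W \<inter> primitive_ideals = {}" using hull_primitive[OF H] nU by (auto simp: W_def)
      ultimately show ?thesis using openin_subset[OF W] by blast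
    qed
    have clI: "closedin jacobson_topology (ideal_hull I)" using Ic closedin_jacobson by blast
    show "\<exists>W. openin fell_ideal_topology W \<and> I \<in> W \<and> W \<subseteq> topspace fell_ideal_topology - primitive_ideals"
    proof (cases "\<exists>P Q. P \<in> ideal_hull I \<and> Q \<in> ideal_hull I \<and> P \<noteq> Q")
      case True
      then obtain P Q where PQ: "P \<in> ideal_hull I" "Q \<in> ideal_hull I" "P \<noteq> Q" by blast
      then have "P \<in> topspace jacobson_topology" "Q \<in> topspace jacobson_topology"
        unfolding topspace_jacobson using ideal_hull_subset by blast+
      then obtain A B where AB: "openin jacobson_topology A" "openin jacobson_topology B"
        "P \<in> A" "Q \<in> B" "disjnt A B"
        using H[unfolded Hausdorff_space_def, rule_format, of P Q] PQ(3) by blast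
      show ?thesis
      proof (rule nbh)
        show "openin (fell_topology jacobson_topology) (fell_basic jacobson_topology {} {A, B})"
          using AB by (intro openin_fell_basic) auto
        show "ideal_hull I \<in> fell_basic jacobson_topology {} {A, B}"
          using clI PQ AB by (auto simp: fell_basic_def)
        show "{P} \<notin> fell_basic jacobson_topology {} {A, B}" for P
          using AB(5) by (auto simp: fell_basic_def disjnt_def)
      qed
    next
      case False
      have "ideal_hull I = {}"
      proof (rule ccontr)
        assume "ideal_hull I \<noteq> {}"
        then obtain P where "ideal_hull I = {P}" using False by blast
        then have "I = P" "P \<in> primitive_ideals" using closed_ideal_eq_Inter_hull[OF Ic] by (auto simp: ideal_hull_def)
        then show False using I by blast
      qed
      show ?thesis
      proof (rule nbh)
        show "openin (fell_topology jacobson_topology) (fell_basic jacobson_topology (primitive_ideals :: 'a set set) {})"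
          using compact_space_jacobson unfolding compact_space_def topspace_jacobson
          by (intro openin_fell_basic) auto
        show "ideal_hull I \<in> fell_basic jacobson_topology primitive_ideals {}"
          using clI \<open>ideal_hull I = {}\<close> by (simp add: fell_basic_def)
        show "{P} \<notin> fell_basic jacobson_topology primitive_ideals {}" if "P \<in> primitive_ideals" for P
          using that by (simp add: fell_basic_def)
      qed
    qed
  qed
qed

end

end

theorem lemma3p30:
  assumes unital: "\<exists>e::'a::cstar_algebra. \<forall>x. e * x = x \<and> x * e = x"
    and Hausdorff: "Hausdorff_space (jacobson_topology :: 'a set topology)"
  shows "subtopology fell_ideal_topology primitive_ideals = (jacobson_topology :: 'a set topology)
    \<and> compactin fell_ideal_topology (primitive_ideals :: 'a set set)
    \<and> closedin fell_ideal_topology (primitive_ideals :: 'a set set)"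
proof -
  obtain e :: 'a where "\<forall>x. e * x = x \<and> x * e = x" using unital by blast
  then interpret unital_cstar e by unfold_locales auto
  show ?thesis
    using subtopology_fell_ideal[OF Hausdorff] compactin_primitive[OF Hausdorff]
      closedin_primitive[OF Hausdorff] by blast
qed

end
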